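(* Let $n\in\mathbb{N}$, $\alpha>-1$, and $a\in L^\infty([0,1))$. Then $T^{(\alpha)}_{(n),\widetilde{a}}\in\mathcal{R}_{(n)}^{(\alpha)}$, the operator $T^{(\alpha)}_{(n),\widetilde{a}}$ is diagonal with respect to the orthonormal basis $(b^{(\alpha)}_{p,n-1})_{p=0}^\infty$ of $\mathcal{A}_{(n)}^2(\mathbb{D},\mu_\alpha)$, and the corresponding eigenvalues can be computed by $$\lambda_{a,\alpha,n}(p)=\int_0^1 a(\sqrt{t})\,\Bigl(\mathcal{J}^{(\alpha,|p-n+1|)}_{\min\{p,n-1\}}(t)\Bigr)^2\,\mathrm{d}t\qquad(p\in\mathbb{N}_0).$$
   Context: $\mathbb{N}=\{1,2,\dots\}$, $\mathbb{N}_0=\{0,1,2,\dots\}$, $\mathbb{D}$ is the open unit disk, $\mathbb{T}$ the unit circle, and $\mathrm{d}\mu_\alpha(z)=\frac{\alpha+1}{\pi}(1-|z|^2)^\alpha\,\mathrm{d}\mu(z)$ on $\mathbb{D}$, where $\mu$ is Lebesgue plane measure. A function $f$ is $n$-analytic if it is smooth and $(\partial/\partial\overline{z})^n f=0$. $\mathcal{A}_n^2(\mathbb{D},\mu_\alpha)$ is the closed subspace of $L^2(\mathbb{D},\mu_\alpha)$ of $n$-analytic square-integrable functions on $\mathbb{D}$ (and $\mathcal{A}_0^2=\{0\}$); $\mathcal{A}_{(n)}^2(\mathbb{D},\mu_\alpha)$ is the orthogonal complement of $\mathcal{A}_{n-1}^2(\mathbb{D},\mu_\alpha)$ in $\mathcal{A}_n^2(\mathbb{D},\mu_\alpha)$.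 $\mathcal{R}_{(n)}^{(\alpha)}$ is the von Neumann algebra of all bounded operators on $\mathcal{A}_{(n)}^2(\mathbb{D},\mu_\alpha)$ commuting with all rotations $f\mapsto f(\tau^{-1}\,\cdot)$, $\tau\in\mathbb{T}$. For $g\in L^\infty(\mathbb{D})$, $T^{(\alpha)}_{(n),g}f=P(gf)$ on $\mathcal{A}_{(n)}^2(\mathbb{D},\mu_\alpha)$, where $P$ is the orthogonal projection of $L^2(\mathbb{D},\mu_\alpha)$ onto $\mathcal{A}_{(n)}^2(\mathbb{D},\mu_\alpha)$. For $a\in L^\infty([0,1))$, $\widetilde{a}(z)=a(|z|)$, $z\in\mathbb{D}$. For $p,q\in\mathbb{N}_0$ the normalized disk polynomial is $$b^{(\alpha)}_{p,q}(z)=(-1)^{p+q}\,\widetilde{c}^{(\alpha)}_{p,q}\,(1-z\overline{z})^{-\alpha}\,\frac{\partial^q}{\partial z^q}\frac{\partial^p}{\partial\overline{z}^p}\Bigl((1-z\overline{z})^{p+q+\alpha}\Bigr),\qquad \widetilde{c}^{(\alpha)}_{p,q}=\sqrt{\frac{(\alpha+p+q+1)\Gamma(\alpha+p+1)\Gamma(\alpha+q+1)}{(\alpha+1)\,p!\,q!\,\Gamma(\alpha+p+q+1)^2}}.$$ For $m\in\mathbb{N}_0$ and $\beta>-1$, $Q_m^{(\alpha,\beta)}(t)=\frac{(-1)^m}{m!}(1-t)^{-\alpha}t^{-\beta}\frac{\mathrm{d}^m}{\mathrm{d}t^m}\bigl((1-t)^{m+\alpha}t^{m+\beta}\bigr)$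 is the shifted Jacobi polynomial, and for $t\in(0,1)$ $$\mathcal{J}_m^{(\alpha,\beta)}(t)=\sqrt{\frac{(2m+\alpha+\beta+1)\Gamma(m+\alpha+\beta+1)\,m!}{\Gamma(m+\alpha+1)\Gamma(m+\beta+1)}}\,(1-t)^{\alpha/2}t^{\beta/2}Q_m^{(\alpha,\beta)}(t).$$ *)

theory Defs
  imports "HOL-Analysis.Analysis"
begin

text \<open>
  Conventions. Elements of \<open>L\<^sup>2\<close> and \<open>L\<^sup>\<infinity>\<close> are represented by
  functions rather than by classes modulo null sets. The poly-analytic spaces consist of smooth
  functions, so there every class has exactly one smooth representative on the disk; it is
  normalised to vanish off the disk, which makes equality of functions coincide with equality in
  the Hilbert space.
\<close>

abbreviation unit_disk :: "complex set" where
  "unit_disk \<equiv> ball 0 1"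

definition mu :: "real \<Rightarrow> complex measure" where
  "mu \<alpha> = density (lebesgue_on unit_disk)
     (\<lambda>z. ennreal ((\<alpha> + 1) / pi * (1 - (cmod z)\<^sup>2) powr \<alpha>))"


subsection \<open>Square-integrable and essentially bounded functions\<close>

definition L2 :: "'a measure \<Rightarrow> ('a \<Rightarrow> complex) set" where
  "L2 M = {f \<in> borel_measurable M. integrable M (\<lambda>x. (cmod (f x))\<^sup>2)}"

definition l2_inner :: "'a measure \<Rightarrow> ('a \<Rightarrow> complex) \<Rightarrow> ('a \<Rightarrow> complex) \<Rightarrow> complex" where
  "l2_inner M f g = (LINT x|M. f x * cnj (g x))"

definition l2_norm :: "'a measure \<Rightarrow> ('a \<Rightarrow> complex) \<Rightarrow> real" where
  "l2_norm M f = sqrt (LINT x|M. (cmod (f x))\<^sup>2)"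

definition Linfty :: "'a measure \<Rightarrow> ('a \<Rightarrow> complex) set" where
  "Linfty M = {f \<in> borel_measurable M. \<exists>C. AE x in M. cmod (f x) \<le> C}"

text \<open>The value of the orthogonal projection onto \<open>V\<close> is the unique \<open>u \<in> V\<close> with
  \<open>h - u\<close> orthogonal to \<open>V\<close>.\<close>

definition orth_proj :: "'a measure \<Rightarrow> ('a \<Rightarrow> complex) set \<Rightarrow> ('a \<Rightarrow> complex) \<Rightarrow> ('a \<Rightarrow> complex)" where
  "orth_proj M V h = (THE u. u \<in> V \<and> (\<forall>v\<in>V. l2_inner M (\<lambda>x. h x - u x) v = 0))"

text \<open>Operators on \<open>V\<close> are extensional functions, i.e. \<open>undefined\<close> outside \<open>V\<close>.\<close>

definition bounded_operators ::
  "'a measure \<Rightarrow> ('a \<Rightarrow> complex) set \<Rightarrow> (('a \<Rightarrow> complex) \<Rightarrow> ('a \<Rightarrow> complex)) set" where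
  "bounded_operators M V = {T \<in> V \<rightarrow>\<^sub>E V.
     (\<forall>f\<in>V. \<forall>g\<in>V. T (\<lambda>x. f x + g x) = (\<lambda>x. T f x + T g x)) \<and>
     (\<forall>c. \<forall>f\<in>V. T (\<lambda>x. c * f x) = (\<lambda>x. c * T f x)) \<and>
     (\<exists>C. \<forall>f\<in>V. l2_norm M (T f) \<le> C * l2_norm M f)}"

definition orthonormal_basis ::
  "'a measure \<Rightarrow> ('a \<Rightarrow> complex) set \<Rightarrow> (nat \<Rightarrow> 'a \<Rightarrow> complex) \<Rightarrow> bool" where
  "orthonormal_basis M V e \<longleftrightarrow>
     (\<forall>p. e p \<in> V) \<and>
     (\<forall>p q. l2_inner M (e p) (e q) = (if p = q then 1 else 0)) \<and>
     (\<forall>f\<in>V. (\<lambda>N. l2_norm M (\<lambda>x. f x - (\<Sum>p<N. l2_inner M f (e p) * e p x))) \<longlonglongrightarrow> 0)"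

definition diagonal_with_eigenvalues ::
  "(('a \<Rightarrow> complex) \<Rightarrow> ('a \<Rightarrow> complex)) \<Rightarrow> (nat \<Rightarrow> 'a \<Rightarrow> complex) \<Rightarrow> (nat \<Rightarrow> complex) \<Rightarrow> bool" where
  "diagonal_with_eigenvalues T e l \<longleftrightarrow> (\<forall>p. T (e p) = (\<lambda>x. l p * e p x))"


subsection \<open>Poly-analytic functions\<close>

primrec Ck_on :: "nat \<Rightarrow> complex set \<Rightarrow> (complex \<Rightarrow> complex) \<Rightarrow> bool" where
  "Ck_on 0 S f \<longleftrightarrow> continuous_on S f"
| "Ck_on (Suc k) S f \<longleftrightarrow>
     (\<forall>z\<in>S. f differentiable (at z)) \<and> (\<forall>v. Ck_on k S (\<lambda>z. frechet_derivative f (at z) v))"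

text \<open>Smoothness is in the real sense and is meant for open \<open>S\<close>: \<open>frechet_derivative\<close> is the
  real-linear derivative.\<close>

definition smooth_on :: "complex set \<Rightarrow> (complex \<Rightarrow> complex) \<Rightarrow> bool" where
  "smooth_on S f \<longleftrightarrow> (\<forall>k. Ck_on k S f)"

text \<open>The Wirtinger derivatives \<open>\<partial>/\<partial>z\<close> and \<open>\<partial>/\<partial>z\<^sup>*\<close>, as \<open>(\<partial>\<^sub>x \<mp> \<i> \<partial>\<^sub>y) / 2\<close>.\<close>

definition d_z :: "(complex \<Rightarrow> complex) \<Rightarrow> complex \<Rightarrow> complex" where
  "d_z f z = (frechet_derivative f (at z) 1 - \<i> * frechet_derivative f (at z) \<i>) / 2"

definition d_zbar :: "(complex \<Rightarrow> complex) \<Rightarrow> complex \<Rightarrow> complex" where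
  "d_zbar f z = (frechet_derivative f (at z) 1 + \<i> * frechet_derivative f (at z) \<i>) / 2"

definition n_analytic_on :: "nat \<Rightarrow> complex set \<Rightarrow> (complex \<Rightarrow> complex) \<Rightarrow> bool" where
  "n_analytic_on n S f \<longleftrightarrow> smooth_on S f \<and> (\<forall>z\<in>S. (d_zbar ^^ n) f z = 0)"

definition poly_bergman :: "nat \<Rightarrow> real \<Rightarrow> (complex \<Rightarrow> complex) set" where
  "poly_bergman n \<alpha> =
     {f \<in> L2 (mu \<alpha>). n_analytic_on n unit_disk f \<and> (\<forall>z. z \<notin> unit_disk \<longrightarrow> f z = 0)}"

text \<open>Meant for \<open>n \<ge> 1\<close>. Note that \<open>poly_bergman 0 \<alpha>\<close> is \<open>{0}\<close>, since
  0-analytic functions vanish on the disk.\<close>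

definition true_poly_bergman :: "nat \<Rightarrow> real \<Rightarrow> (complex \<Rightarrow> complex) set" where
  "true_poly_bergman n \<alpha> =
     {f \<in> poly_bergman n \<alpha>. \<forall>g \<in> poly_bergman (n - 1) \<alpha>. l2_inner (mu \<alpha>) f g = 0}"


subsection \<open>Toeplitz operators and radial operators\<close>

definition rotate_fun :: "complex \<Rightarrow> (complex \<Rightarrow> complex) \<Rightarrow> (complex \<Rightarrow> complex)" where
  "rotate_fun \<tau> f = (\<lambda>z. f (inverse \<tau> * z))"

definition radial_operators ::
  "nat \<Rightarrow> real \<Rightarrow> ((complex \<Rightarrow> complex) \<Rightarrow> (complex \<Rightarrow> complex)) set" where
  "radial_operators n \<alpha> = {T \<in> bounded_operators (mu \<alpha>) (true_poly_bergman n \<alpha>).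
     \<forall>\<tau>. cmod \<tau> = 1 \<longrightarrow>
       (\<forall>f \<in> true_poly_bergman n \<alpha>. T (rotate_fun \<tau> f) = rotate_fun \<tau> (T f))}"

definition toeplitz ::
  "nat \<Rightarrow> real \<Rightarrow> (complex \<Rightarrow> complex) \<Rightarrow> (complex \<Rightarrow> complex) \<Rightarrow> (complex \<Rightarrow> complex)" where
  "toeplitz n \<alpha> g = restrict
     (\<lambda>f. orth_proj (mu \<alpha>) (true_poly_bergman n \<alpha>) (\<lambda>z. g z * f z)) (true_poly_bergman n \<alpha>)"

definition radial_ext :: "(real \<Rightarrow> complex) \<Rightarrow> complex \<Rightarrow> complex" where
  "radial_ext a z = a (cmod z)"


subsection \<open>Disk polynomials and Jacobi functions\<close>

definition disk_poly_coeff :: "real \<Rightarrow> nat \<Rightarrow> nat \<Rightarrow> real" where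
  "disk_poly_coeff \<alpha> p q = sqrt
     ((\<alpha> + real p + real q + 1) * Gamma (\<alpha> + real p + 1) * Gamma (\<alpha> + real q + 1) /
      ((\<alpha> + 1) * fact p * fact q * (Gamma (\<alpha> + real p + real q + 1))\<^sup>2))"

definition disk_poly :: "real \<Rightarrow> nat \<Rightarrow> nat \<Rightarrow> complex \<Rightarrow> complex" where
  "disk_poly \<alpha> p q z =
     (if z \<in> unit_disk then
        (-1) ^ (p + q) * of_real (disk_poly_coeff \<alpha> p q) *
        of_real ((1 - (cmod z)\<^sup>2) powr (- \<alpha>)) *
        (d_z ^^ q) ((d_zbar ^^ p)
          (\<lambda>w. of_real ((1 - (cmod w)\<^sup>2) powr (real p + real q + \<alpha>)))) z
      else 0)"

definition shifted_jacobi :: "nat \<Rightarrow> real \<Rightarrow> real \<Rightarrow> real \<Rightarrow> real" where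
  "shifted_jacobi m \<alpha> \<beta> t =
     (-1) ^ m / fact m * (1 - t) powr (- \<alpha>) * t powr (- \<beta>) *
     (deriv ^^ m) (\<lambda>s. (1 - s) powr (real m + \<alpha>) * s powr (real m + \<beta>)) t"

text \<open>Meant for \<open>0 < t < 1\<close>, as is \<open>shifted_jacobi\<close>.\<close>

definition jacobi_fun :: "nat \<Rightarrow> real \<Rightarrow> real \<Rightarrow> real \<Rightarrow> real" where
  "jacobi_fun m \<alpha> \<beta> t =
     sqrt ((2 * real m + \<alpha> + \<beta> + 1) * Gamma (real m + \<alpha> + \<beta> + 1) * fact m /
           (Gamma (real m + \<alpha> + 1) * Gamma (real m + \<beta> + 1))) *
     (1 - t) powr (\<alpha> / 2) * t powr (\<beta> / 2) * shifted_jacobi m \<alpha> \<beta> t"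

definition eigenvalue_integrand ::
  "(real \<Rightarrow> complex) \<Rightarrow> real \<Rightarrow> nat \<Rightarrow> nat \<Rightarrow> real \<Rightarrow> complex" where
  "eigenvalue_integrand a \<alpha> n p t =
     a (sqrt t) * of_real ((jacobi_fun (min p (n - 1)) \<alpha> \<bar>real p - real n + 1\<bar> t)\<^sup>2)"

end

theory Submission
  imports Defs "HOL-Complex_Analysis.Complex_Analysis" "HOL-Real_Asymp.Real_Asymp"
begin

text \<open>
  Put \<open>q = n - 1\<close>. Iterating the Wirtinger derivatives and comparing with Rodrigues' formula shows that
  \<open>b\<^sub>p\<^sub>,\<^sub>q(z)\<close> is a constant times \<open>z\<^sup>p\<^sup>-\<^sup>m (z\<^sup>*)\<^sup>q\<^sup>-\<^sup>m P(|z|\<^sup>2)\<close>, where \<open>m = min p q\<close> and \<open>P\<close> is the shifted Jacobi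
  polynomial of degree \<open>m\<close> with parameters \<open>\<alpha>\<close> and \<open>|p - q|\<close>. The image of \<open>\<mu>\<^sub>\<alpha>\<close> under \<open>|z|\<^sup>2\<close> has density
  \<open>(\<alpha> + 1) (1 - t)\<^sup>\<alpha>\<close> on \<open>[0,1)\<close>, so norms, orthogonality to lower monomials and the eigenvalues reduce to
  one-dimensional Jacobi integrals; different \<open>p\<close> are orthogonal, even after multiplication by a radial
  symbol, because they have different rotation characters.

  Completeness: an \<open>n\<close>-analytic function is a polynomial of degree \<open>q\<close> in \<open>z\<^sup>*\<close> with holomorphic
  coefficients, hence the pointwise sum of its angular modes. Each mode lies in a finite-dimensional
  space of polynomials, and orthogonality to the \<open>(n-1)\<close>-analytic functions forces it to be a multiple of
  \<open>b\<^sub>p\<^sub>,\<^sub>q\<close>. Conversely the normalising constants of \<open>b\<^sub>p\<^sub>,\<^sub>q\<close> have ratio tending to 1 in \<open>p\<close>, so every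
  square-summable coefficient sequence gives a series converging pointwise to an \<open>n\<close>-analytic function,
  and by Fatou's lemma in norm. The space is thus isomorphic to the square-summable sequences, and both
  the Toeplitz operator and the rotations act diagonally.
\<close>

subsection \<open>Planar Lebesgue measure: rotations and the squared modulus\<close>

text \<open>Functions are compared literally, so expansions must hold at every point of the disk;
  almost-everywhere facts are upgraded by continuity. The obstacle to completeness is that the mode
  series converges absolutely only on disks |z| \<le> r < 1, while a square-integrable function need
  not be bounded near the circle. Inner products with a mode are therefore taken over the smaller
  disk first, and r tends to 1 by dominated convergence.

  Each of three forms of the disk polynomial serves one purpose. The Jacobi form yields the
  one-dimensional integrals. The form in monomials z^(p-j) cnj z^(q-j) separates the top monomial j
  = 0 from those with j \<ge> 1, which are (n-1)-analytic; hence one dimension of each mode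
  survives. In the form in powers of 1 - |z|^2 every term is a p-free factor times a multiple of
  z^(p-j) with j \<le> q, so a series in p becomes q + 1 power series in z, and ratio 1 of the
  constants makes them converge on the disk.

  The projection is not deduced from closedness of the space: its value is an explicit series,
  checked against the definition.\<close>

lemma distr_lborel_vec2_complex:
  "distr (lborel :: (real^2) measure) borel (\<lambda>v. Complex (v $ 1) (v $ 2)) = lborel"
proof (rule lborel_eqI[symmetric])
  fix l u :: complex assume le: "\<And>b. b \<in> Basis \<Longrightarrow> l \<bullet> b \<le> u \<bullet> b"
  have "(\<lambda>v::real^2. Complex (v $ 1) (v $ 2)) = (\<lambda>v. of_real (v $ 1) + \<i> * of_real (v $ 2))"
    by (simp add: complex_eq_iff fun_eq_iff)
  then have [measurable]: "(\<lambda>v::real^2. Complex (v $ 1) (v $ 2)) \<in> borel_measurable borel"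
    by simp
  let ?l = "vector [Re l, Im l] :: real^2" and ?u = "vector [Re u, Im u] :: real^2"
  have le': "Re l \<le> Re u" "Im l \<le> Im u" using le[of 1] le[of \<i>] by (simp_all add: Basis_complex_def)
  have eq: "(\<lambda>v::real^2. Complex (v $ 1) (v $ 2)) -` box l u = box ?l ?u"
    by (auto simp: mem_box_cart in_box_complex_iff forall_2)
  have "emeasure lborel (box ?l ?u) = (\<Prod>b\<in>Basis. (?u - ?l) \<bullet> b)"
  proof (rule emeasure_lborel_box)
    have "?l $ i \<le> ?u $ i" for i using exhaust_2[of i] le' by auto
    then show "?l \<bullet> b \<le> ?u \<bullet> b" if "b \<in> Basis" for b using that by (auto simp: Basis_vec_def inner_axis)
  qed
  also have "(\<Prod>b\<in>Basis. (?u - ?l) \<bullet> b) = (Re u - Re l) * (Im u - Im l)"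
  proof -
    have B: "(Basis :: (real^2) set) = {axis 1 1, axis 2 1}"
      by (auto simp: Basis_vec_def UNIV_2)
    show ?thesis unfolding B by (simp add: axis_eq_axis inner_axis)
  qed
  also have "\<dots> = (\<Prod>b\<in>Basis. (u - l) \<bullet> b)"
    by (simp add: Basis_complex_def)
  finally show "emeasure (distr lborel borel (\<lambda>v::real^2. Complex (v $ 1) (v $ 2))) (box l u)
      = (\<Prod>b\<in>Basis. (u - l) \<bullet> b)"
    by (simp add: emeasure_distr eq)
qed simp

lemma distr_lborel_orthogonal:
  fixes f :: "real^'n::{finite,wellorder} \<Rightarrow> real^'n::_"
  assumes f: "orthogonal_transformation f"
  shows "distr lborel borel f = lborel"
proof (rule lborel_eqI[symmetric])
  fix l u :: "real^'n::{finite,wellorder}" assume le: "\<And>b. b \<in> Basis \<Longrightarrow> l \<bullet> b \<le> u \<bullet> b"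
  have g: "orthogonal_transformation (inv f)" by (rule orthogonal_transformation_inv[OF f])
  have bij: "bij f" by (rule orthogonal_transformation_bij[OF f])
  have [measurable]: "f \<in> borel_measurable borel"
    by (intro borel_measurable_continuous_onI linear_continuous_on linear_conv_bounded_linear[THEN iffD1]
         orthogonal_transformation_linear f)
  have eq: "f -` box l u = inv f ` box l u" by (rule bij_vimage_eq_inv_image[OF bij])
  have m: "inv f ` box l u \<in> lmeasurable" by (intro measurable_orthogonal_image g) auto
  have meas: "f -` box l u \<in> sets borel"
    using measurable_sets[of f borel borel "box l u"] by simp
  have "emeasure lborel (f -` box l u) = emeasure lebesgue (inv f ` box l u)"
    using meas by (simp add: eq)
  also have "\<dots> = emeasure lebesgue (box l u)"
    using m measure_orthogonal_image[OF g lmeasurable_box, of l u]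
    by (simp add: emeasure_eq_measure2)
  finally show "emeasure (distr lborel borel f) (box l u) = (\<Prod>b\<in>Basis. (u - l) \<bullet> b)"
    using le by (simp add: emeasure_distr)
qed simp

text \<open>The coordinate map from \<open>real^2\<close> conjugates multiplication by \<tau> to the
  matrix rotation \<open>R\<close>, which is orthogonal because the squared entries of \<tau> add up
  to 1.\<close>

lemma distr_lborel_rotation:
  assumes "cmod \<tau> = 1"
  shows "distr lborel borel ((*) \<tau>) = (lborel :: complex measure)"
proof -
  define R :: "real^2 \<Rightarrow> real^2" where
    "R = (\<lambda>v. vector [Re \<tau> * v $ 1 - Im \<tau> * v $ 2, Re \<tau> * v $ 2 + Im \<tau> * v $ 1])"
  let ?c = "\<lambda>v::real^2. Complex (v $ 1) (v $ 2)"
  have \<tau>: "(Re \<tau>)\<^sup>2 + (Im \<tau>)\<^sup>2 = 1" using assms by (simp add: cmod_def)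
  have "linear R"
    by (rule linearI) (auto simp: R_def vec_eq_iff forall_2 algebra_simps)
  moreover have "norm (R v) = norm v" for v
  proof -
    have "(Re \<tau> * v $ 1 - Im \<tau> * v $ 2)\<^sup>2 + (Re \<tau> * v $ 2 + Im \<tau> * v $ 1)\<^sup>2
       = ((Re \<tau>)\<^sup>2 + (Im \<tau>)\<^sup>2) * ((v $ 1)\<^sup>2 + (v $ 2)\<^sup>2)" by algebra
    then show ?thesis by (simp add: norm_vec_def L2_set_def sum_2 R_def \<tau>)
  qed
  ultimately have R: "orthogonal_transformation R"
    by (simp add: orthogonal_transformation)
  have [measurable]: "R \<in> borel_measurable borel"
    by (intro borel_measurable_continuous_onI linear_continuous_on linear_conv_bounded_linear[THEN iffD1]
         orthogonal_transformation_linear R)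
  have "?c = (\<lambda>v. of_real (v $ 1) + \<i> * of_real (v $ 2))"
    by (simp add: complex_eq_iff fun_eq_iff)
  then have [measurable]: "?c \<in> borel_measurable borel" by simp
  have "distr lborel borel ((*) \<tau>) = distr (distr lborel borel ?c) borel ((*) \<tau>)"
    by (simp add: distr_lborel_vec2_complex)
  also have "\<dots> = distr lborel borel ((*) \<tau> \<circ> ?c)"
    by (simp add: distr_distr)
  also have "(*) \<tau> \<circ> ?c = ?c \<circ> R"
    by (auto simp: R_def fun_eq_iff complex_eq_iff)
  also have "distr lborel borel (?c \<circ> R) = distr (distr lborel borel R) borel ?c"
    by (subst distr_distr) simp_all
  also have "\<dots> = lborel"
    by (simp add: distr_lborel_orthogonal[OF R] distr_lborel_vec2_complex)
  finally show ?thesis .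
qed

lemma emeasure_lborel_ball_complex:
  "r \<ge> 0 \<Longrightarrow> emeasure lborel (ball (0::complex) r) = ennreal (pi * r\<^sup>2)"
  "r \<ge> 0 \<Longrightarrow> emeasure lborel (cball (0::complex) r) = ennreal (pi * r\<^sup>2)"
  by (simp_all add: emeasure_ball emeasure_cball unit_ball_vol_2)

text \<open>A substitute for polar coordinates: the preimage of an interval is a disk or an annulus,
  whose area is \<pi> times the length of the part of the interval in [0,\<infinity>). Open
  intervals generate the Borel sets and are stable under intersection.\<close>

lemma distr_lborel_cmod_squared:
  "distr lborel borel (\<lambda>z. (cmod z)\<^sup>2) = density lborel (\<lambda>t. ennreal pi * indicator {0..} t)"
proof (rule measure_eqI_generator_eq)
  let ?M = "distr lborel borel (\<lambda>z::complex. (cmod z)\<^sup>2)"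
  let ?N = "density lborel (\<lambda>t. ennreal pi * indicator {0..} t)"
  let ?E = "range (\<lambda>(a, b). box a b::real set)"
  let ?A = "\<lambda>n::nat. box (- (real n *\<^sub>R One)) (real n *\<^sub>R One) :: real set"
  show "Int_stable ?E"
    by (auto simp: Int_stable_def box_Int_box)
  show "?E \<subseteq> Pow UNIV" "sets (?M) = sigma_sets UNIV ?E"
    "sets (?N) = sigma_sets UNIV ?E"
    by (simp_all add: borel_eq_box)
  show "range ?A \<subseteq> ?E" "(\<Union>i. ?A i) = UNIV"
    unfolding UN_box_eq_UNIV by auto
  have main: "emeasure (?M) {a<..<b} = ennreal (pi * (max 0 b - max 0 a))"
    if "a < b" for a b :: real
  proof -
    have "emeasure (?M) {a<..<b}
        = emeasure lborel ((\<lambda>z. (cmod z)\<^sup>2) -` {a<..<b})"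
      by (simp add: emeasure_distr)
    also have "\<dots> = ennreal (pi * (max 0 b - max 0 a))"
    proof -
      consider "b \<le> 0" | "a < 0" "0 < b" | "0 \<le> a" "0 < b" using that by linarith
      then show ?thesis
      proof cases
        case 1
        then have "(\<lambda>z::complex. (cmod z)\<^sup>2) -` {a<..<b} = {}"
          by (auto simp: not_less) (meson 1 less_le_trans not_less zero_le_power2)
        then show ?thesis using 1 that by simp
      next
        case 2
        have "cmod z ^ 2 < b \<longleftrightarrow> cmod z < sqrt b" for z
          by (metis abs_norm_cancel real_sqrt_abs real_sqrt_less_iff)
        with 2 have "(\<lambda>z::complex. (cmod z)\<^sup>2) -` {a<..<b} = ball 0 (sqrt b)"
          by (auto simp: less_le_trans[OF 2(1) zero_le_power2])
        then show ?thesis using 2 by (simp add: emeasure_lborel_ball_complex)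
      next
        case 3
        have *: "cmod z ^ 2 < b \<longleftrightarrow> cmod z < sqrt b" "a < cmod z ^ 2 \<longleftrightarrow> sqrt a < cmod z" for z
          by (metis abs_norm_cancel real_sqrt_abs real_sqrt_less_iff)+
        have "(\<lambda>z::complex. (cmod z)\<^sup>2) -` {a<..<b} = ball 0 (sqrt b) - cball 0 (sqrt a)"
          by (auto simp: *)
        also have "emeasure lborel \<dots> = ennreal (pi * b) - ennreal (pi * a)"
          using 3 that by (subst emeasure_Diff) (auto simp: emeasure_lborel_ball_complex
              intro: le_less_trans[OF _ real_sqrt_less_mono[OF that]])
        also have "\<dots> = ennreal (pi * b - pi * a)"
          using 3 by (simp add: ennreal_minus)
        finally show ?thesis using 3 that by (simp add: right_diff_distrib)
      qed
    qed
    finally show ?thesis .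
  qed
  show "emeasure (?M) (?A i) \<noteq> \<infinity>" for i
    using main[of "- real i" "real i"] by (cases "i = 0") auto
  show "emeasure (?M) X
      = emeasure (?N) X" if XE: "X \<in> ?E" for X
  proof -
    obtain a b where X: "X = {a<..<b}" using XE by auto
    have "emeasure (?N) X
        = (\<integral>\<^sup>+ t. ennreal pi * indicator ({0..} \<inter> {a<..<b}) t \<partial>lborel)"
      unfolding X by (subst emeasure_density) (auto simp: indicator_inter_arith mult.assoc)
    also have "\<dots> = ennreal pi * emeasure lborel ({0..} \<inter> {a<..<b})"
      by (simp add: nn_integral_cmult)
    also have "emeasure lborel ({0..} \<inter> {a<..<b}) = ennreal (max 0 b - max 0 a)"
    proof -
      consider "b \<le> 0 \<or> a \<ge> b" | "a < 0" "0 < b" | "0 \<le> a" "a < b" by linarith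
      then show ?thesis
      proof cases
        case 1 then have "{0..} \<inter> {a<..<b} = {}" by auto
        then show ?thesis using 1 by (auto simp: ennreal_neg)
      next
        case 2 then have "{0..} \<inter> {a<..<b} = {0..<b}" by auto
        then show ?thesis using 2 by simp
      next
        case 3 then have "{0..} \<inter> {a<..<b} = {a<..<b}" by auto
        then show ?thesis using 3 by simp
      qed
    qed
    finally have "emeasure (?N) X
        = ennreal (pi * (max 0 b - max 0 a))" by (simp add: ennreal_mult')
    then show ?thesis
      using main[of a b] X by (cases "a < b") (auto simp: ennreal_neg)
  qed
qed

text \<open>A Borel map lifts to the Lebesgue completions once preimages of Borel null sets are
  null. This applies to the squared modulus and to \<open>sqrt\<close>, so that symbols which are
  merely Lebesgue measurable can be substituted.\<close>

lemma nonsingular_lebesgue: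
  fixes f :: "'a::euclidean_space \<Rightarrow> 'b::euclidean_space"
  assumes f: "f \<in> borel_measurable borel"
    and null: "\<And>N. N \<in> null_sets lborel \<Longrightarrow> f -` N \<in> null_sets lebesgue"
  shows "f \<in> lebesgue \<rightarrow>\<^sub>M lebesgue"
    and "(AE y in lebesgue. P y) \<Longrightarrow> AE x in lebesgue. P (f x)"
proof -
  have *: "f \<in> lebesgue \<rightarrow>\<^sub>M lborel" using f by (intro measurable_completion) simp
  show "f \<in> lebesgue \<rightarrow>\<^sub>M lebesgue"
  proof (rule completion.measurable_completion2[OF *], rule subsetI)
    fix N :: "'b set" assume N: "N \<in> null_sets lborel"
    then have "emeasure (distr lebesgue lborel f) N = emeasure lebesgue (f -` N)"
      using * by (subst emeasure_distr) auto
    also have "\<dots> = 0" by (rule null_setsD1[OF null[OF N]])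
    finally show "N \<in> null_sets (distr lebesgue lborel f)" using N by (auto simp: null_sets_def)
  qed
  assume "AE y in lebesgue. P y"
  then have "AE y in lborel. P y" by (simp add: AE_completion_iff)
  then obtain N where N: "N \<in> null_sets lborel" and P: "\<And>y. y \<in> space lborel - N \<Longrightarrow> P y"
    by (rule AE_E3) blast
  show "AE x in lebesgue. P (f x)"
    using AE_not_in[OF null[OF N]] P by (auto elim!: eventually_mono)
qed

lemma
  assumes "cmod \<tau> = 1"
  shows measurable_rotation: "(*) \<tau> \<in> lebesgue \<rightarrow>\<^sub>M (lebesgue :: complex measure)"
    and distr_lebesgue_rotation: "distr lebesgue lebesgue ((*) \<tau>) = (lebesgue :: complex measure)"
proof -
  have *: "(*) \<tau> \<in> lborel \<rightarrow>\<^sub>M lborel" by simp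
  have **: "(*) \<tau> \<in> lebesgue \<rightarrow>\<^sub>M lborel" by (rule measurable_completion[OF *])
  have d: "distr lebesgue lborel ((*) \<tau>) = (lborel :: complex measure)"
    using distr_completion[OF *] distr_lborel_rotation[OF assms] by (simp cong: distr_cong)
  show "(*) \<tau> \<in> lebesgue \<rightarrow>\<^sub>M (lebesgue :: complex measure)"
    by (rule completion.measurable_completion2[OF **]) (simp add: d)
  show "distr lebesgue lebesgue ((*) \<tau>) = (lebesgue :: complex measure)"
    using completion.completion_distr_eq[OF **] by (simp add: d)
qed

section \<open>The weighted measure on the disk: rotation invariance and its image on [0,1)\<close>

lemma space_mu [simp]: "space (mu \<alpha>) = unit_disk"
  by (simp add: mu_def)

lemma sets_mu [measurable_cong]: "sets (mu \<alpha>) = sets (lebesgue_on unit_disk)"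
  by (simp add: mu_def)

lemma measurable_disk_weight:
  "(\<lambda>z. ennreal ((\<alpha> + 1) / pi * (1 - (cmod z)\<^sup>2) powr \<alpha>)) \<in> borel_measurable lebesgue"
  by (intro measurable_completion) simp

lemma nn_integral_mu:
  assumes "F \<in> borel_measurable (lebesgue_on unit_disk)"
  shows "(\<integral>\<^sup>+z. F z \<partial>mu \<alpha>) =
    (\<integral>\<^sup>+z. ennreal ((\<alpha> + 1) / pi * (1 - (cmod z)\<^sup>2) powr \<alpha>) * F z * indicator unit_disk z \<partial>lebesgue)"
  using assms measurable_disk_weight[of \<alpha>, THEN measurable_restrict_space1, of unit_disk]
  by (simp add: mu_def nn_integral_density nn_integral_restrict_space)

lemma emeasure_mu:
  assumes "A \<in> sets (lebesgue_on unit_disk)"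
  shows "emeasure (mu \<alpha>) A =
    (\<integral>\<^sup>+z. ennreal ((\<alpha> + 1) / pi * (1 - (cmod z)\<^sup>2) powr \<alpha>) * indicator A z \<partial>lebesgue)"
proof -
  have "emeasure (mu \<alpha>) A = (\<integral>\<^sup>+z. indicator A z \<partial>mu \<alpha>)"
    using assms by (simp add: sets_mu)
  moreover have "A \<subseteq> unit_disk" using assms by (auto simp: sets_restrict_space)
  ultimately show ?thesis using assms
    by (subst (asm) nn_integral_mu) (auto intro!: nn_integral_cong simp: indicator_def)
qed

lemma measurable_mu_rotation:
  assumes "cmod \<tau> = 1"
  shows "(*) \<tau> \<in> mu \<alpha> \<rightarrow>\<^sub>M mu \<alpha>"
proof -
  have "(*) \<tau> \<in> lebesgue_on unit_disk \<rightarrow>\<^sub>M lebesgue_on unit_disk"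
    using measurable_rotation[OF assms] assms
    by (auto intro!: measurable_restrict_space3 simp: norm_mult)
  then show ?thesis using measurable_cong_sets[OF sets_mu sets_mu] by blast
qed

text \<open>The density depends on |z| alone and the disk is invariant, so the invariance is
  inherited from Lebesgue measure.\<close>

lemma distr_mu_rotation:
  assumes \<tau>: "cmod \<tau> = 1"
  shows "distr (mu \<alpha>) (mu \<alpha>) ((*) \<tau>) = mu \<alpha>"
proof (rule measure_eqI)
  fix A assume "A \<in> sets (distr (mu \<alpha>) (mu \<alpha>) ((*) \<tau>))"
  then have A: "A \<in> sets (mu \<alpha>)" by simp
  let ?w = "\<lambda>z. ennreal ((\<alpha> + 1) / pi * (1 - (cmod z)\<^sup>2) powr \<alpha>)"
  have A': "A \<in> sets (lebesgue_on unit_disk)" using A by (simp add: sets_mu)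
  then have AD: "A \<subseteq> unit_disk" and AL: "A \<in> sets lebesgue" by (auto simp: sets_restrict_space)
  let ?B = "(*) \<tau> -` A \<inter> unit_disk"
  have B: "?B \<in> sets (lebesgue_on unit_disk)"
    using measurable_sets[OF measurable_mu_rotation[OF \<tau>] A] by (simp add: sets_mu)
  have "emeasure (distr (mu \<alpha>) (mu \<alpha>) ((*) \<tau>)) A = emeasure (mu \<alpha>) ?B"
    using measurable_mu_rotation[OF \<tau>] A by (simp add: emeasure_distr)
  also have "\<dots> = (\<integral>\<^sup>+z. ?w z * indicator ?B z \<partial>lebesgue)"
    by (rule emeasure_mu[OF B])
  also have "\<dots> = (\<integral>\<^sup>+z. ?w (\<tau> * z) * indicator A (\<tau> * z) \<partial>lebesgue)"
    using AD \<tau> by (intro nn_integral_cong) (auto simp: indicator_def norm_mult)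
  also have "\<dots> = (\<integral>\<^sup>+z. ?w z * indicator A z \<partial>distr lebesgue lebesgue ((*) \<tau>))"
    using measurable_disk_weight AL
    by (intro nn_integral_distr[symmetric] measurable_rotation[OF \<tau>]) auto
  also have "\<dots> = emeasure (mu \<alpha>) A"
    by (simp add: distr_lebesgue_rotation[OF \<tau>] emeasure_mu[OF A'])
  finally show "emeasure (distr (mu \<alpha>) (mu \<alpha>) ((*) \<tau>)) A = emeasure (mu \<alpha>) A" .
qed simp

lemma integral_mu_rotation:
  fixes F :: "complex \<Rightarrow> complex"
  assumes \<tau>: "cmod \<tau> = 1" and F: "F \<in> borel_measurable (mu \<alpha>)"
  shows "(LINT z|mu \<alpha>. F (\<tau> * z)) = (LINT z|mu \<alpha>. F z)"
proof -
  have "(LINT z|mu \<alpha>. F z) = (LINT z|distr (mu \<alpha>) (mu \<alpha>) ((*) \<tau>). F z)"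
    by (simp add: distr_mu_rotation[OF \<tau>])
  also have "\<dots> = (LINT z|mu \<alpha>. F (\<tau> * z))"
    by (rule integral_distr[OF measurable_mu_rotation[OF \<tau>] F])
  finally show ?thesis by simp
qed

lemma null_sets_cmod_squared_vimage:
  assumes "N \<in> null_sets lborel"
  shows "(\<lambda>z::complex. (cmod z)\<^sup>2) -` N \<in> null_sets lborel"
proof -
  have N: "N \<in> sets borel" using assms by auto
  have "emeasure lborel ((\<lambda>z::complex. (cmod z)\<^sup>2) -` N)
     = emeasure (distr lborel borel (\<lambda>z::complex. (cmod z)\<^sup>2)) N"
    using N by (simp add: emeasure_distr)
  also have "\<dots> = (\<integral>\<^sup>+t. ennreal pi * indicator {0..} t * indicator N t \<partial>lborel)"
    using N by (simp add: distr_lborel_cmod_squared emeasure_density)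
  also have "\<dots> = 0"
    using AE_not_in[OF assms] by (subst nn_integral_0_iff_AE) (use N in auto)
  finally show ?thesis
    using measurable_sets[of "\<lambda>z::complex. (cmod z)\<^sup>2" borel borel N] N
    by (auto simp: null_sets_def)
qed

lemmas nonsingular_cmod_squared =
  nonsingular_lebesgue[of "\<lambda>z::complex. (cmod z)\<^sup>2", OF _ null_sets_completionI[OF null_sets_cmod_squared_vimage], simplified]

text \<open>\<open>F\<close> is replaced by a Borel function that agrees with it almost everywhere;
  nonsingularity of the squared modulus carries this agreement back to the plane, and the Borel case
  is \<open>distr_lborel_cmod_squared\<close>.\<close>

lemma nn_integral_cmod_squared:
  assumes "F \<in> borel_measurable lebesgue"
  shows "(\<integral>\<^sup>+z. F ((cmod z)\<^sup>2) \<partial>(lebesgue :: complex measure)) = (\<integral>\<^sup>+t. ennreal pi * indicator {0..} t * F t \<partial>lebesgue)"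
proof -
  obtain G where G: "G \<in> borel_measurable lborel" and ae: "AE t in lborel. F t = G t"
    using completion_ex_borel_measurable[OF assms] by blast
  have "AE z in (lebesgue :: complex measure). F ((cmod z)\<^sup>2) = G ((cmod z)\<^sup>2)"
    by (rule nonsingular_cmod_squared(2)[OF AE_completion[OF ae]])
  then have "(\<integral>\<^sup>+z. F ((cmod z)\<^sup>2) \<partial>(lebesgue :: complex measure)) = (\<integral>\<^sup>+z. G ((cmod z)\<^sup>2) \<partial>(lebesgue :: complex measure))"
    by (rule nn_integral_cong_AE)
  also have "\<dots> = (\<integral>\<^sup>+z. G ((cmod z)\<^sup>2) \<partial>(lborel :: complex measure))"
    by (rule nn_integral_completion)
  also have "\<dots> = (\<integral>\<^sup>+t. G t \<partial>distr lborel borel (\<lambda>z::complex. (cmod z)\<^sup>2))"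
    using G by (subst nn_integral_distr) auto
  also have "\<dots> = (\<integral>\<^sup>+t. ennreal pi * indicator {0..} t * G t \<partial>lborel)"
    using G by (simp add: distr_lborel_cmod_squared nn_integral_density)
  also have "\<dots> = (\<integral>\<^sup>+t. ennreal pi * indicator {0..} t * G t \<partial>lebesgue)"
    by (rule nn_integral_completion[symmetric])
  also have "\<dots> = (\<integral>\<^sup>+t. ennreal pi * indicator {0..} t * F t \<partial>lebesgue)"
    using AE_completion[OF ae] by (intro nn_integral_cong_AE) (auto elim!: eventually_mono)
  finally show ?thesis .
qed

lemma measurable_mu_cmod_squared: "(\<lambda>z. (cmod z)\<^sup>2) \<in> mu \<alpha> \<rightarrow>\<^sub>M lebesgue_on {0..<1}"
proof -
  have "(\<lambda>z. (cmod z)\<^sup>2) \<in> lebesgue_on unit_disk \<rightarrow>\<^sub>M lebesgue_on {0..<1}"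
    using nonsingular_cmod_squared(1)
    by (auto intro!: measurable_restrict_space3 simp: power_less_one_iff abs_square_less_1)
  then show ?thesis using measurable_cong_sets[OF sets_mu refl] by blast
qed

text \<open>The factor \<pi> coming from planar area cancels the 1/\<pi> in the density of
  \<open>mu\<close>.\<close>

lemma distr_mu_cmod_squared:
  assumes \<alpha>: "\<alpha> > -1"
  shows "distr (mu \<alpha>) (lebesgue_on {0..<1}) (\<lambda>z. (cmod z)\<^sup>2) =
    density (lebesgue_on {0..<1}) (\<lambda>t. ennreal ((\<alpha> + 1) * (1 - t) powr \<alpha>))"
proof (rule measure_eqI)
  fix A assume "A \<in> sets (distr (mu \<alpha>) (lebesgue_on {0..<1}) (\<lambda>z. (cmod z)\<^sup>2))"
  then have A: "A \<in> sets (lebesgue_on {0..<1})" by simp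
  then have A1: "A \<subseteq> {0..<1}" and AL: "A \<in> sets lebesgue" by (auto simp: sets_restrict_space)
  let ?B = "(\<lambda>z. (cmod z)\<^sup>2) -` A \<inter> unit_disk"
  have B: "?B \<in> sets (lebesgue_on unit_disk)"
    using measurable_sets[OF measurable_mu_cmod_squared A] by (simp add: sets_mu)
  let ?w = "\<lambda>t. ennreal ((\<alpha> + 1) / pi * (1 - t) powr \<alpha>)"
  have w: "?w \<in> borel_measurable lebesgue" by (intro measurable_completion) simp
  have w': "(\<lambda>t. ennreal ((\<alpha> + 1) * (1 - t) powr \<alpha>)) \<in> borel_measurable (lebesgue_on {0..<1})"
    by (intro measurable_restrict_space1 measurable_completion) simp
  have "emeasure (distr (mu \<alpha>) (lebesgue_on {0..<1}) (\<lambda>z. (cmod z)\<^sup>2)) A = emeasure (mu \<alpha>) ?B"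
    using measurable_mu_cmod_squared A by (simp add: emeasure_distr)
  also have "\<dots> = (\<integral>\<^sup>+z. ?w ((cmod z)\<^sup>2) * indicator ?B z \<partial>lebesgue)"
    by (rule emeasure_mu[OF B])
  also have "\<dots> = (\<integral>\<^sup>+z. (\<lambda>t. ?w t * indicator A t) ((cmod z)\<^sup>2) \<partial>(lebesgue :: complex measure))"
    using A1 by (intro nn_integral_cong) (auto simp: indicator_def power_less_one_iff abs_square_less_1)
  also have "\<dots> = (\<integral>\<^sup>+t. ennreal pi * indicator {0..} t * (?w t * indicator A t) \<partial>lebesgue)"
    by (rule nn_integral_cmod_squared) (use w AL in auto)
  also have "\<dots> = (\<integral>\<^sup>+t. ennreal ((\<alpha> + 1) * (1 - t) powr \<alpha>) * indicator A t * indicator {0..<1} t \<partial>lebesgue)"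
    using A1 \<alpha> by (intro nn_integral_cong) (auto simp: indicator_def ennreal_mult'[symmetric])
  also have "\<dots> = emeasure (density (lebesgue_on {0..<1}) (\<lambda>t. ennreal ((\<alpha> + 1) * (1 - t) powr \<alpha>))) A"
    using A w' by (subst emeasure_density) (auto simp: nn_integral_restrict_space)
  finally show "emeasure (distr (mu \<alpha>) (lebesgue_on {0..<1}) (\<lambda>z. (cmod z)\<^sup>2)) A
     = emeasure (density (lebesgue_on {0..<1}) (\<lambda>t. ennreal ((\<alpha> + 1) * (1 - t) powr \<alpha>))) A" .
qed simp

text \<open>The substitution t = |z|^2. The image measure lives on [0,1); the null point 0 is
  dropped to reach the open interval of the eigenvalue formula, where Rodrigues' formula is
  valid.\<close>

lemma radial_integral_mu:
  fixes F :: "real \<Rightarrow> complex"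
  assumes \<alpha>: "\<alpha> > -1" and F: "F \<in> borel_measurable (lebesgue_on {0..<1})"
  shows "integrable (mu \<alpha>) (\<lambda>z. F ((cmod z)\<^sup>2)) \<longleftrightarrow>
      set_integrable lebesgue {0<..<1} (\<lambda>t. of_real ((\<alpha> + 1) * (1 - t) powr \<alpha>) * F t)" (is ?th1)
    and "(LINT z|mu \<alpha>. F ((cmod z)\<^sup>2)) =
      (LINT t:{0<..<1}|lebesgue. of_real ((\<alpha> + 1) * (1 - t) powr \<alpha>) * F t)" (is ?th2)
proof -
  let ?w = "\<lambda>t. (\<alpha> + 1) * (1 - t) powr \<alpha>"
  have w: "?w \<in> borel_measurable (lebesgue_on {0..<1})"
    by (intro measurable_restrict_space1 measurable_completion) simp
  have w0: "AE t in lebesgue_on {0..<1}. 0 \<le> ?w t" using \<alpha> by auto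
  have *: "AE t in lebesgue. indicator {0..<1} t *\<^sub>R (?w t *\<^sub>R F t)
      = indicator {0<..<1} t *\<^sub>R (of_real (?w t) * F t)"
  proof -
    have "AE t in lebesgue. t \<noteq> (0::real)" by (rule AE_completion) (rule AE_lborel_singleton)
    then show ?thesis
      by (elim eventually_mono) (auto simp: indicator_def scaleR_conv_of_real)
  qed
  have m1: "(\<lambda>t. ?w t *\<^sub>R F t) \<in> borel_measurable (lebesgue_on {0..<1})" using w F by simp
  then have m1': "(\<lambda>t. indicator {0..<1} t *\<^sub>R (?w t *\<^sub>R F t)) \<in> borel_measurable lebesgue"
    by (rule borel_measurable_restrict_space_iff[THEN iffD1, rotated]) auto
  have m2: "(\<lambda>t. indicator {0<..<1} t *\<^sub>R (of_real (?w t) * F t)) \<in> borel_measurable lebesgue"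
  proof -
    have "(\<lambda>t. indicator {0<..<1} t *\<^sub>R (indicator {0..<1} t *\<^sub>R (?w t *\<^sub>R F t))) \<in> borel_measurable lebesgue"
      by (rule borel_measurable_scaleR[OF borel_measurable_indicator m1']) simp
    also have "(\<lambda>t. indicator {0<..<1} t *\<^sub>R (indicator {0..<1} t *\<^sub>R (?w t *\<^sub>R F t))) =
        (\<lambda>t. indicator {0<..<1} t *\<^sub>R (of_real (?w t) * F t))"
      by (auto simp: indicator_def fun_eq_iff scaleR_conv_of_real)
    finally show ?thesis .
  qed
  have "integrable (mu \<alpha>) (\<lambda>z. F ((cmod z)\<^sup>2)) \<longleftrightarrow>
      integrable (density (lebesgue_on {0..<1}) ?w) F"
    using integrable_distr_eq[OF measurable_mu_cmod_squared F, of \<alpha>]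
    by (simp add: distr_mu_cmod_squared[OF \<alpha>])
  also have "\<dots> \<longleftrightarrow> integrable (lebesgue_on {0..<1}) (\<lambda>t. ?w t *\<^sub>R F t)"
    by (rule integrable_density[OF F w w0])
  also have "\<dots> \<longleftrightarrow> integrable lebesgue (\<lambda>t. indicator {0..<1} t *\<^sub>R (?w t *\<^sub>R F t))"
    by (subst integrable_restrict_space) auto
  also have "\<dots> \<longleftrightarrow> integrable lebesgue (\<lambda>t. indicator {0<..<1} t *\<^sub>R (of_real (?w t) * F t))"
    by (rule integrable_cong_AE[OF m1' m2 *])
  finally show ?th1 by (simp add: set_integrable_def)
  have "(LINT z|mu \<alpha>. F ((cmod z)\<^sup>2)) = integral\<^sup>L (density (lebesgue_on {0..<1}) ?w) F"
    using integral_distr[OF measurable_mu_cmod_squared F, of \<alpha>]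
    by (simp add: distr_mu_cmod_squared[OF \<alpha>])
  also have "\<dots> = (LINT t|lebesgue_on {0..<1}. ?w t *\<^sub>R F t)"
    by (rule integral_density[OF F w w0])
  also have "\<dots> = (LINT t|lebesgue. indicator {0..<1} t *\<^sub>R (?w t *\<^sub>R F t))"
    by (subst integral_restrict_space) auto
  also have "\<dots> = (LINT t|lebesgue. indicator {0<..<1} t *\<^sub>R (of_real (?w t) * F t))"
    by (rule integral_cong_AE[OF m1' m2 *])
  finally show ?th2 by (simp add: set_lebesgue_integral_def)
qed

subsection \<open>Polyanalytic functions\<close>

text \<open>The real derivative in the basis h, cnj h; \<open>A\<close> and \<open>B\<close> are
  then the two Wirtinger derivatives. One predicate carries both through sums and products, and its
  uniqueness clause \<open>has_wirtingerD\<close> evaluates \<open>d_z\<close> and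
  \<open>d_zbar\<close>.\<close>

definition has_wirtinger :: "(complex \<Rightarrow> complex) \<Rightarrow> complex \<Rightarrow> complex \<Rightarrow> complex \<Rightarrow> bool" where
  "has_wirtinger f A B z \<longleftrightarrow> (f has_derivative (\<lambda>h. A * h + B * cnj h)) (at z)"

lemma has_wirtingerD:
  assumes "has_wirtinger f A B z"
  shows "d_z f z = A" "d_zbar f z = B" "f differentiable (at z)"
    "frechet_derivative f (at z) v = A * v + B * cnj v"
proof -
  have eq: "frechet_derivative f (at z) = (\<lambda>h. A * h + B * cnj h)"
    using assms by (simp add: has_wirtinger_def frechet_derivative_at[symmetric])
  show "frechet_derivative f (at z) v = A * v + B * cnj v" by (simp add: eq)
  show "d_z f z = A" by (simp add: d_z_def eq algebra_simps)
  show "d_zbar f z = B" by (simp add: d_zbar_def eq algebra_simps)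
  show "f differentiable (at z)" using assms by (auto simp: has_wirtinger_def differentiable_def)
qed

text \<open>Every real-linear map of the plane has the form A h + B cnj h, by writing the real and
  imaginary parts of h through h and cnj h.\<close>

lemma differentiable_has_wirtinger:
  assumes "f differentiable (at z)"
  shows "has_wirtinger f (d_z f z) (d_zbar f z) z"
proof -
  let ?f' = "frechet_derivative f (at z)"
  have d: "(f has_derivative ?f') (at z)" using assms by (simp add: frechet_derivative_works)
  have "?f' h = d_z f z * h + d_zbar f z * cnj h" for h
  proof -
    have lin: "linear ?f'" by (rule linear_frechet_derivative[OF assms])
    have "?f' h = ?f' (Re h *\<^sub>R 1 + Im h *\<^sub>R \<i>)"
      by (rule arg_cong[where f = ?f']) (simp add: complex_eq_iff)
    also have "\<dots> = of_real (Re h) * ?f' 1 + of_real (Im h) * ?f' \<i>"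
      by (simp only: linear_add[OF lin] linear_scale[OF lin]) (simp add: scaleR_conv_of_real)
    also have "\<dots> = (h + cnj h) / 2 * ?f' 1 - \<i> * (h - cnj h) / 2 * ?f' \<i>"
      by (simp add: complex_eq_iff)
    also have "\<dots> = d_z f z * h + d_zbar f z * cnj h"
      by (simp add: d_z_def d_zbar_def field_simps)
    finally show ?thesis .
  qed
  then have "?f' = (\<lambda>h. d_z f z * h + d_zbar f z * cnj h)" by blast
  then show ?thesis using d by (simp add: has_wirtinger_def)
qed

lemma has_wirtinger_cong:
  assumes "has_wirtinger g A B z" "open S" "z \<in> S" "\<And>w. w \<in> S \<Longrightarrow> f w = g w"
  shows "has_wirtinger f A B z"
  using has_derivative_transform_within_open[of g _ z UNIV S f] assms
  by (simp add: has_wirtinger_def)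

lemma has_wirtinger_const: "has_wirtinger (\<lambda>_. c) 0 0 z"
  by (simp add: has_wirtinger_def)

lemma has_wirtinger_cnj: "has_wirtinger cnj 0 1 z"
  by (auto simp: has_wirtinger_def intro!: derivative_eq_intros)

lemma has_wirtinger_holomorphic:
  "(f has_field_derivative A) (at z) \<Longrightarrow> has_wirtinger f A 0 z"
  by (simp add: has_wirtinger_def has_field_derivative_def)

lemma has_wirtinger_add:
  "has_wirtinger f A B z \<Longrightarrow> has_wirtinger g C D z \<Longrightarrow>
    has_wirtinger (\<lambda>z. f z + g z) (A + C) (B + D) z"
  unfolding has_wirtinger_def
  by (drule (1) has_derivative_add) (simp add: algebra_simps)

lemma has_wirtinger_sum:
  "(\<And>i. i \<in> I \<Longrightarrow> has_wirtinger (f i) (A i) (B i) z) \<Longrightarrow>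
    has_wirtinger (\<lambda>z. \<Sum>i\<in>I. f i z) (\<Sum>i\<in>I. A i) (\<Sum>i\<in>I. B i) z"
  by (induction I rule: infinite_finite_induct)
     (auto intro: has_wirtinger_const has_wirtinger_add)

lemma has_wirtinger_mult:
  "has_wirtinger f A B z \<Longrightarrow> has_wirtinger g C D z \<Longrightarrow>
    has_wirtinger (\<lambda>z. f z * g z) (A * g z + f z * C) (B * g z + f z * D) z"
  unfolding has_wirtinger_def
  by (rule has_derivative_eq_rhs[OF has_derivative_mult]) (auto simp: algebra_simps)

lemma has_wirtinger_cnj_power: "has_wirtinger (\<lambda>z. cnj z ^ k) 0 (of_nat k * cnj z ^ (k - 1)) z"
proof (induction k)
  case 0 then show ?case by (simp add: has_wirtinger_const)
next
  case (Suc k)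
  from has_wirtinger_mult[OF has_wirtinger_cnj Suc] show ?case
    by (cases k) (auto simp: algebra_simps)
qed

text \<open>The classical description of n-analytic functions. On open sets it is equivalent to
  \<open>n_analytic_on\<close>, and after this subsection membership in the spaces is always handled
  through it. Values of \<open>f\<close> outside \<open>S\<close> are unconstrained.\<close>

definition polyanalytic_rep :: "nat \<Rightarrow> complex set \<Rightarrow> (complex \<Rightarrow> complex) \<Rightarrow> bool" where
  "polyanalytic_rep n S f \<longleftrightarrow> (\<exists>h. (\<forall>k<n. h k holomorphic_on S) \<and>
     (\<forall>z\<in>S. f z = (\<Sum>k<n. cnj z ^ k * h k z)))"

lemma has_wirtinger_polyanalytic:
  assumes S: "open S" "z \<in> S" and h: "\<And>k. k < n \<Longrightarrow> h k holomorphic_on S"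
    and f: "\<And>z. z \<in> S \<Longrightarrow> f z = (\<Sum>k<n. cnj z ^ k * h k z)"
  shows "has_wirtinger f (\<Sum>k<n. cnj z ^ k * deriv (h k) z) (\<Sum>k<n. of_nat k * cnj z ^ (k - 1) * h k z) z"
proof (rule has_wirtinger_cong[OF _ S f])
  let ?A = "\<Sum>k<n. cnj z ^ k * deriv (h k) z"
  let ?B = "\<Sum>k<n. of_nat k * cnj z ^ (k - 1) * h k z"
  have "has_wirtinger (\<lambda>z. cnj z ^ k * h k z) (cnj z ^ k * deriv (h k) z) (of_nat k * cnj z ^ (k - 1) * h k z) z"
    if "k < n" for k
    using has_wirtinger_mult[OF has_wirtinger_cnj_power
        has_wirtinger_holomorphic[OF holomorphic_derivI[OF h[OF that] S]]] by simp
  then show "has_wirtinger (\<lambda>z. \<Sum>k<n. cnj z ^ k * h k z) ?A ?B z"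
    by (intro has_wirtinger_sum) auto
qed

text \<open>Stability under directional derivatives gives smoothness by induction; the drop of the
  order under \<open>d_zbar\<close> gives the vanishing of its n-th iterate.\<close>

lemma polyanalytic_rep_frechet:
  assumes S: "open S" and f: "polyanalytic_rep n S f"
  shows "\<And>z. z \<in> S \<Longrightarrow> f differentiable (at z)"
    and "polyanalytic_rep n S (\<lambda>z. frechet_derivative f (at z) v)"
    and "polyanalytic_rep (n - 1) S (d_zbar f)"
proof -
  obtain h where h: "\<And>k. k < n \<Longrightarrow> h k holomorphic_on S"
    and fz: "\<And>z. z \<in> S \<Longrightarrow> f z = (\<Sum>k<n. cnj z ^ k * h k z)"
    using f unfolding polyanalytic_rep_def by blast
  note W = has_wirtinger_polyanalytic[OF S _ h fz]
  show "f differentiable (at z)" if "z \<in> S" for z by (rule has_wirtingerD[OF W]) (use that in auto)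
  have B: "(\<Sum>k<n. of_nat k * cnj z ^ (k - 1) * h k z) = (\<Sum>k<n - 1. cnj z ^ k * (of_nat (Suc k) * h (Suc k) z))" for z
    by (cases n) (auto simp: sum.lessThan_Suc_shift algebra_simps simp del: sum.lessThan_Suc)
  have dz: "d_zbar f z = (\<Sum>k<n - 1. cnj z ^ k * (of_nat (Suc k) * h (Suc k) z))" if "z \<in> S" for z
    unfolding B[symmetric] by (rule has_wirtingerD[OF W]) (use that in auto)
  have hol: "(\<lambda>z. of_nat (Suc k) * h (Suc k) z) holomorphic_on S" if "k < n - 1" for k
    using that h[of "Suc k"] by (intro holomorphic_intros) auto
  show "polyanalytic_rep (n - 1) S (d_zbar f)"
    unfolding polyanalytic_rep_def using dz hol
    by (intro exI[of _ "\<lambda>k z. of_nat (Suc k) * h (Suc k) z"]) blast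
  \<comment> \<open>The \<open>d_zbar\<close> part has one term fewer, so its coefficient at the top
    index n - 1 is padded by 0.\<close>
  define g where "g k z = deriv (h k) z * v + (if k < n - 1 then of_nat (Suc k) * h (Suc k) z * cnj v else 0)" for k z
  have "g k holomorphic_on S" if "k < n" for k
    unfolding g_def using that h[of k] hol[of k]
    by (cases "k < n - 1") (auto intro!: holomorphic_intros holomorphic_deriv S)
  moreover have "frechet_derivative f (at z) v = (\<Sum>k<n. cnj z ^ k * g k z)" if "z \<in> S" for z
  proof -
    have "(\<Sum>k<n - 1. cnj z ^ k * (of_nat (Suc k) * h (Suc k) z)) =
      (\<Sum>k<n. if k < n - 1 then cnj z ^ k * (of_nat (Suc k) * h (Suc k) z) else 0)"
      by (subst sum.inter_filter[symmetric]) (auto intro!: sum.cong)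
    then have "frechet_derivative f (at z) v = (\<Sum>k<n. cnj z ^ k * deriv (h k) z) * v +
       (\<Sum>k<n. if k < n - 1 then cnj z ^ k * (of_nat (Suc k) * h (Suc k) z) else 0) * cnj v"
      using has_wirtingerD(4)[OF W, of z v] that unfolding B by metis
    also have "\<dots> = (\<Sum>k<n. cnj z ^ k * g k z)"
      unfolding sum_distrib_right sum.distrib[symmetric] g_def
      by (intro sum.cong refl) (auto simp: algebra_simps)
    finally show ?thesis .
  qed
  ultimately show "polyanalytic_rep n S (\<lambda>z. frechet_derivative f (at z) v)"
    unfolding polyanalytic_rep_def by blast
qed

lemma polyanalytic_rep_smooth:
  assumes S: "open S" and f: "polyanalytic_rep n S f"
  shows "smooth_on S f"
proof -
  have "Ck_on k S f" for k using f
  proof (induction k arbitrary: f)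
    case 0
    then show ?case using polyanalytic_rep_frechet(1)[OF S 0]
      by (auto intro!: continuous_at_imp_continuous_on differentiable_imp_continuous_within)
  next
    case (Suc k)
    then show ?case using polyanalytic_rep_frechet(1,2)[OF S Suc.prems] by auto
  qed
  then show ?thesis by (simp add: smooth_on_def)
qed

lemma polyanalytic_rep_n_analytic:
  assumes S: "open S" and f: "polyanalytic_rep n S f"
  shows "n_analytic_on n S f"
proof -
  have "(d_zbar ^^ n) f z = 0" if "z \<in> S" for z using f
  proof (induction n arbitrary: f)
    case 0
    then show ?case using that by (auto simp: polyanalytic_rep_def)
  next
    case (Suc n)
    then show ?case using polyanalytic_rep_frechet(3)[OF S Suc.prems]
      by (simp add: funpow_Suc_right del: funpow.simps)
  qed
  then show ?thesis using polyanalytic_rep_smooth[OF assms] by (simp add: n_analytic_on_def)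
qed

section \<open>From vanishing iterated derivatives to the polynomial form in cnj z\<close>

lemma Ck_on_cong:
  assumes "open S" "\<And>z. z \<in> S \<Longrightarrow> f z = g z" "Ck_on k S f"
  shows "Ck_on k S g"
  using assms(2,3)
proof (induction k arbitrary: f g)
  case 0
  then show ?case using continuous_on_cong[OF refl, of S f g] by auto
next
  case (Suc k)
  have W: "has_wirtinger g (d_z f z) (d_zbar f z) z" if "z \<in> S" for z
    by (rule has_wirtinger_cong[OF differentiable_has_wirtinger assms(1) that])
       (use Suc.prems that in auto)
  have eq: "frechet_derivative f (at z) v = frechet_derivative g (at z) v" if "z \<in> S" for z v
    using has_wirtingerD(4)[OF W[OF that]] has_wirtingerD(4)[OF differentiable_has_wirtinger] Suc.prems that
    by auto
  have "Ck_on k S (\<lambda>z. frechet_derivative g (at z) v)" for v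
    by (rule Suc.IH[of "\<lambda>z. frechet_derivative f (at z) v"]) (use eq Suc.prems in auto)
  then show ?case using has_wirtingerD(3)[OF W] by auto
qed

lemma Ck_on_linear_combination:
  assumes "open S" "Ck_on k S f" "Ck_on k S g"
  shows "Ck_on k S (\<lambda>z. a * f z + b * g z)"
  using assms(2,3)
proof (induction k arbitrary: f g)
  case 0
  then show ?case by (auto intro!: continuous_intros)
next
  case (Suc k)
  have W: "has_wirtinger (\<lambda>z. a * f z + b * g z) (a * d_z f z + b * d_z g z) (a * d_zbar f z + b * d_zbar g z) z"
    if "z \<in> S" for z
    using has_wirtinger_add[OF has_wirtinger_mult[OF has_wirtinger_const[of a] differentiable_has_wirtinger[of f z]]
       has_wirtinger_mult[OF has_wirtinger_const[of b] differentiable_has_wirtinger[of g z]]] Suc.prems that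
    by simp
  have eq: "a * frechet_derivative f (at z) v + b * frechet_derivative g (at z) v
     = frechet_derivative (\<lambda>z. a * f z + b * g z) (at z) v" if "z \<in> S" for z v
    using has_wirtingerD(4)[OF W[OF that]] has_wirtingerD(4)[OF differentiable_has_wirtinger] Suc.prems that
    by (auto simp: algebra_simps)
  have "Ck_on k S (\<lambda>z. frechet_derivative (\<lambda>z. a * f z + b * g z) (at z) v)" for v
    by (rule Ck_on_cong[OF assms(1) eq]) (use Suc in auto)
  then show ?case using has_wirtingerD(3)[OF W] by auto
qed

lemma smooth_on_d_zbar:
  assumes "open S" "smooth_on S f"
  shows "smooth_on S (d_zbar f)"
proof -
  have "Ck_on k S (d_zbar f)" for k
  proof -
    have "Ck_on (Suc k) S f" using assms by (simp add: smooth_on_def del: Ck_on.simps)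
    then have "Ck_on k S (\<lambda>z. frechet_derivative f (at z) v)" for v by simp
    from Ck_on_linear_combination[OF assms(1) this this, of "1/2" 1 "\<i> / 2" \<i>]
    show ?thesis by (simp add: d_zbar_def[abs_def] add_divide_distrib)
  qed
  then show ?thesis by (simp add: smooth_on_def)
qed

text \<open>Induction on n: the polynomial form of \<open>d_zbar f\<close> has an explicit
  antiderivative with respect to cnj z, obtained by raising each power of cnj z and dividing.
  Subtracting it from \<open>f\<close> leaves a function with \<open>d_zbar\<close> equal to 0, that
  is, a holomorphic one.\<close>

lemma n_analytic_imp_polyanalytic_rep:
  assumes S: "open S" and f: "n_analytic_on n S f"
  shows "polyanalytic_rep n S f"
  using f
proof (induction n arbitrary: f)
  case 0
  then show ?case by (simp add: n_analytic_on_def polyanalytic_rep_def)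
next
  case (Suc n)
  have sm: "smooth_on S f" and z: "\<And>z. z \<in> S \<Longrightarrow> (d_zbar ^^ n) (d_zbar f) z = 0"
    using Suc.prems by (auto simp: n_analytic_on_def funpow_Suc_right simp del: funpow.simps)
  have "polyanalytic_rep n S (d_zbar f)"
    by (rule Suc.IH) (use smooth_on_d_zbar[OF S sm] z in \<open>auto simp: n_analytic_on_def\<close>)
  then obtain h where h: "\<And>k. k < n \<Longrightarrow> h k holomorphic_on S"
    and dz: "\<And>z. z \<in> S \<Longrightarrow> d_zbar f z = (\<Sum>k<n. cnj z ^ k * h k z)"
    unfolding polyanalytic_rep_def by blast
  define H where "H k = (case k of 0 \<Rightarrow> (\<lambda>z. 0) | Suc j \<Rightarrow> (\<lambda>z. h j z / of_nat (Suc j)))" for k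
  define F where "F z = (\<Sum>k<Suc n. cnj z ^ k * H k z)" for z
  have H: "H k holomorphic_on S" if "k < Suc n" for k
    using that h by (auto simp: H_def simp del: of_nat_Suc split: nat.splits intro!: holomorphic_intros)
  have df: "f differentiable (at z)" if "z \<in> S" for z
    using sm that by (auto simp: smooth_on_def dest!: spec[of _ "Suc 0"])
  define u where "u z = f z - F z" for z
  have "u holomorphic_on S"
  proof (rule holomorphic_onI)
    fix z assume z: "z \<in> S"
    have "(\<Sum>k<Suc n. of_nat k * cnj z ^ (k - 1) * H k z) = (\<Sum>k<n. cnj z ^ k * h k z)"
      by (subst sum.lessThan_Suc_shift) (auto simp: H_def simp del: of_nat_Suc intro!: sum.cong)
    then have "has_wirtinger F (\<Sum>k<Suc n. cnj z ^ k * deriv (H k) z) (d_zbar f z) z"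
      using has_wirtinger_polyanalytic[OF S z H F_def] dz[OF z] by auto
    from has_wirtinger_add[OF differentiable_has_wirtinger[OF df[OF z]]
         has_wirtinger_mult[OF has_wirtinger_const[of "-1"] this]]
    have "has_wirtinger u (d_z f z - (\<Sum>k<Suc n. cnj z ^ k * deriv (H k) z)) 0 z"
      by (simp add: u_def[abs_def] del: sum.lessThan_Suc)
    then show "u field_differentiable at z within S"
      by (auto simp: has_wirtinger_def has_field_derivative_def field_differentiable_def intro: has_derivative_at_withinI)
  qed
  \<comment> \<open>The antiderivative has no term of degree 0 in cnj z, so the holomorphic
    remainder takes that place.\<close>
  moreover define G where "G k = (if k = 0 then u else H k)" for k
  ultimately have "\<forall>k<Suc n. G k holomorphic_on S" using H by auto
  moreover have "f z = (\<Sum>k<Suc n. cnj z ^ k * G k z)" for z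
    unfolding G_def by (subst sum.lessThan_Suc_shift)
      (simp add: u_def F_def sum.lessThan_Suc_shift[of _ n] H_def del: sum.lessThan_Suc)
  ultimately show ?case unfolding polyanalytic_rep_def by blast
qed

subsection \<open>Shifted Jacobi polynomials\<close>

text \<open>The falling factorial at a real argument: the factor produced by differentiating a real
  power k times.\<close>

definition ffact_real :: "real \<Rightarrow> nat \<Rightarrow> real" where
  "ffact_real a k = (\<Prod>l<k. a - real l)"

lemma ffact_real_0 [simp]: "ffact_real a 0 = 1"
  and ffact_real_Suc: "ffact_real a (Suc k) = ffact_real a k * (a - real k)"
  by (simp_all add: ffact_real_def)

lemma ffact_real_gbinomial: "ffact_real a k = fact k * (a gchoose k)"
  by (simp add: ffact_real_def gbinomial_mult_fact lessThan_atLeast0)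

lemma ffact_real_of_nat: "ffact_real (real n) k = fact k * real (n choose k)"
  by (simp add: ffact_real_gbinomial binomial_gbinomial)

lemma ffact_real_Gamma:
  assumes "a - real k > -1"
  shows "ffact_real a k * Gamma (a - real k + 1) = Gamma (a + 1)"
  using assms
proof (induction k)
  case (Suc k)
  have "Gamma (a - real k + 1) = (a - real k) * Gamma (a - real k)"
  proof (rule Gamma_plus1)
    show "a - real k \<notin> \<int>\<^sub>\<le>\<^sub>0" using Suc.prems by (auto elim!: nonpos_Ints_cases)
  qed
  moreover have "a - real (Suc k) + 1 = a - real k" by simp
  ultimately have "ffact_real a (Suc k) * Gamma (a - real (Suc k) + 1) = ffact_real a k * Gamma (a - real k + 1)"
    by (simp only: ffact_real_Suc mult.assoc)
  with Suc show ?case by simp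
qed simp

text \<open>The induction step of Leibniz's rule, with \<open>u j\<close> and \<open>v j\<close>
  standing for j-th derivatives. Stated for sequences in a ring so that it serves both the real
  derivatives below and the iterated \<open>d_z\<close> on the disk.\<close>

lemma leibniz_step:
  fixes u v :: "nat \<Rightarrow> 'a::comm_ring_1"
  shows "(\<Sum>j\<le>i. of_nat (i choose j) * (u (Suc j) * v (i - j) + u j * v (Suc (i - j))))
     = (\<Sum>j\<le>Suc i. of_nat (Suc i choose j) * (u j * v (Suc i - j)))"
proof -
  have "(\<Sum>j\<le>Suc i. of_nat (Suc i choose j) * (u j * v (Suc i - j)))
    = u 0 * v (Suc i) + (\<Sum>j\<le>i. of_nat (i choose Suc j) * (u (Suc j) * v (i - j)))
        + (\<Sum>j\<le>i. of_nat (i choose j) * (u (Suc j) * v (i - j)))"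
    by (subst sum.atMost_Suc_shift) (simp add: algebra_simps sum.distrib)
  also have "u 0 * v (Suc i) + (\<Sum>j\<le>i. of_nat (i choose Suc j) * (u (Suc j) * v (i - j)))
     = (\<Sum>j\<le>Suc i. of_nat (i choose j) * (u j * v (Suc i - j)))"
    by (subst sum.atMost_Suc_shift) simp
  also have "\<dots> = (\<Sum>j\<le>i. of_nat (i choose j) * (u j * v (Suc (i - j))))"
    by (simp add: Suc_diff_le binomial_eq_0)
  finally show ?thesis by (simp add: algebra_simps sum.distrib)
qed

text \<open>Leibniz's expansion of the i-th derivative of (1 - t)^A t^B. As a closed formula it also
  has values at 0 and 1, which the boundary terms of the integration by parts require.\<close>

definition rodrigues_deriv :: "real \<Rightarrow> real \<Rightarrow> nat \<Rightarrow> real \<Rightarrow> real" where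
  "rodrigues_deriv A B i t = (\<Sum>j\<le>i. real (i choose j) *
     (((-1) ^ j * ffact_real A j * (1 - t) powr (A - real j)) *
      (ffact_real B (i - j) * t powr (B - real (i - j)))))"

lemma rodrigues_deriv_0: "rodrigues_deriv A B 0 t = (1 - t) powr A * t powr B"
  by (simp add: rodrigues_deriv_def)

lemma has_real_derivative_rodrigues:
  assumes t: "0 < t" "t < 1"
  shows "(rodrigues_deriv A B i has_real_derivative rodrigues_deriv A B (Suc i) t) (at t)"
proof -
  let ?u = "\<lambda>j t. (-1) ^ j * ffact_real A j * (1 - t) powr (A - real j)"
  let ?v = "\<lambda>j t. ffact_real B j * t powr (B - real j)"
  have u: "(?u j has_real_derivative ?u (Suc j) t) (at t)" for j
    using t by (auto intro!: derivative_eq_intros simp: ffact_real_Suc algebra_simps)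
  have v: "(?v j has_real_derivative ?v (Suc j) t) (at t)" for j
    using t by (auto intro!: derivative_eq_intros simp: ffact_real_Suc algebra_simps)
  have "(rodrigues_deriv A B i has_real_derivative
     (\<Sum>j\<le>i. real (i choose j) * (?u (Suc j) t * ?v (i - j) t + ?u j t * ?v (Suc (i - j)) t))) (at t)"
    unfolding rodrigues_deriv_def[abs_def]
    by (rule DERIV_sum DERIV_cmult)+
       (rule DERIV_cong[OF DERIV_mult[OF u v]], simp add: mult.commute add.commute)
  also have "(\<Sum>j\<le>i. real (i choose j) * (?u (Suc j) t * ?v (i - j) t + ?u j t * ?v (Suc (i - j)) t))
     = rodrigues_deriv A B (Suc i) t"
    unfolding rodrigues_deriv_def by (rule leibniz_step)
  finally show ?thesis .
qed

lemma deriv_rodrigues: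
  assumes t: "0 < t" "t < 1"
  shows "(deriv ^^ i) (\<lambda>s. (1 - s) powr A * s powr B) t = rodrigues_deriv A B i t"
  using t
proof (induction i arbitrary: t)
  case 0
  then show ?case by (simp add: rodrigues_deriv_0)
next
  case (Suc i)
  have "eventually (\<lambda>s. s \<in> {0<..<1}) (nhds t)"
    using Suc.prems by (intro eventually_nhds_in_open) auto
  then have "eventually (\<lambda>s. (deriv ^^ i) (\<lambda>s. (1 - s) powr A * s powr B) s = rodrigues_deriv A B i s) (nhds t)"
    by eventually_elim (use Suc.IH in auto)
  then have "deriv ((deriv ^^ i) (\<lambda>s. (1 - s) powr A * s powr B)) t = deriv (rodrigues_deriv A B i) t"
    by (rule deriv_cong_ev) simp
  also have "\<dots> = rodrigues_deriv A B (Suc i) t"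
    by (rule DERIV_imp_deriv has_real_derivative_rodrigues Suc.prems)+
  finally show ?case by simp
qed

text \<open>Repeated integration by parts. Each step moves one derivative onto the monomial, at the
  cost of the factor -k; after i steps either the monomial has been annihilated or a Beta integral
  remains.\<close>

lemma has_integral_monomial_rodrigues:
  assumes A: "A > real m - 1" and B: "B > real m - 1" and i: "i \<le> m"
  shows "((\<lambda>t. t ^ k * rodrigues_deriv A B i t) has_integral
     (if k < i then 0 else (-1) ^ i * (fact k / fact (k - i)) * Beta (real (k - i) + B + 1) (A + 1))) {0..1}"
  using i
proof (induction i arbitrary: k)
  case 0
  have "((\<lambda>t. t powr (real k + B + 1 - 1) * (1 - t) powr (A + 1 - 1)) has_integral Beta (real k + B + 1) (A + 1)) {0..1}"
    using A B by (intro has_integral_Beta_real) auto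
  moreover have "t powr (real k + B + 1 - 1) * (1 - t) powr (A + 1 - 1) = t ^ k * rodrigues_deriv A B 0 t"
    if "t \<in> {0..1}" for t
    using that by (cases "t = 0") (auto simp: rodrigues_deriv_0 powr_add powr_realpow)
  ultimately show ?case by (subst has_integral_cong[OF sym]) auto
next
  case (Suc i)
  let ?F = "rodrigues_deriv A B i"
  let ?D = "\<lambda>t. (real k * t ^ (k - 1)) * ?F t + t ^ k * rodrigues_deriv A B (Suc i) t"
  \<comment> \<open>Here \<open>Suc i \<le> m\<close>, so every exponent in \<open>?F\<close> is
    positive and the powers are continuous up to the endpoints.\<close>
  have cont: "continuous_on {0..1} (\<lambda>t. t ^ k * ?F t)"
    unfolding rodrigues_deriv_def using Suc.prems A B
    by (auto intro!: continuous_intros continuous_on_powr' simp: of_nat_diff)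
  have "(?D has_integral
     1 ^ k * ?F 1 - 0 ^ k * ?F 0) {0..1}"
  proof (rule fundamental_theorem_of_calculus_interior[OF _ cont])
    fix t :: real assume t: "t \<in> {0<..<1}"
    have "((\<lambda>t. t ^ k * ?F t) has_real_derivative
        ?D t) (at t)"
      by (rule DERIV_cong[OF DERIV_mult[OF DERIV_pow has_real_derivative_rodrigues]]) (use t in auto)
    then show "((\<lambda>t. t ^ k * ?F t) has_vector_derivative
        ?D t) (at t)"
      by (simp add: has_real_derivative_iff_has_vector_derivative)
  qed simp
  \<comment> \<open>Every summand contains a power with base 0 at each endpoint; the continuity
    above makes this the true boundary value.\<close>
  moreover have "?F 1 = 0" "?F 0 = 0"
    by (simp_all add: rodrigues_deriv_def)
  ultimately have 1: "(?D has_integral 0) {0..1}"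
    by simp
  define V where "V = (if k - 1 < i then 0 else (-1) ^ i * (fact (k - 1) / fact (k - 1 - i)) * Beta (real (k - 1 - i) + B + 1) (A + 1))"
  have "((\<lambda>t. t ^ (k - 1) * ?F t) has_integral V) {0..1}"
    unfolding V_def using Suc.prems by (intro Suc.IH) auto
  from has_integral_diff[OF 1 has_integral_mult_right[OF this, of "real k"]]
  have "((\<lambda>t. t ^ k * rodrigues_deriv A B (Suc i) t) has_integral (- (real k * V))) {0..1}"
    by (simp add: mult.assoc)
  moreover have "- (real k * V) = (if k < Suc i then 0 else (-1) ^ Suc i * (fact k / fact (k - Suc i)) * Beta (real (k - Suc i) + B + 1) (A + 1))"
    by (cases k) (auto simp: V_def)
  ultimately show ?case by simp
qed

text \<open>Rodrigues' formula with the weight divided out. It agrees with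
  \<open>shifted_jacobi\<close> on the open interval, but being a polynomial it also has
  coefficients and a value at 0, the image of the centre of the disk.\<close>

definition jacobi_poly :: "nat \<Rightarrow> real \<Rightarrow> real \<Rightarrow> real poly" where
  "jacobi_poly m \<alpha> \<beta> = (\<Sum>j\<le>m. smult ((-1) ^ (m + j) / fact m * real (m choose j) *
      ffact_real (real m + \<alpha>) j * ffact_real (real m + \<beta>) (m - j)) ([:1, -1:] ^ (m - j) * [:0, 1:] ^ j))"

lemma poly_jacobi_poly_rodrigues:
  assumes "0 < t" "t < 1"
  shows "(1 - t) powr \<alpha> * t powr \<beta> * poly (jacobi_poly m \<alpha> \<beta>) t =
    (-1) ^ m / fact m * rodrigues_deriv (real m + \<alpha>) (real m + \<beta>) m t"
proof -
  have 1: "(1 - t) powr (real m + \<alpha> - real j) = (1 - t) powr \<alpha> * (1 - t) ^ (m - j)"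
    "t powr (real m + \<beta> - real (m - j)) = t powr \<beta> * t ^ j" if "j \<le> m" for j
  proof -
    have e: "real m + \<alpha> - real j = \<alpha> + real (m - j)" "real m + \<beta> - real (m - j) = \<beta> + real j"
      using that by (auto simp: of_nat_diff)
    show "(1 - t) powr (real m + \<alpha> - real j) = (1 - t) powr \<alpha> * (1 - t) ^ (m - j)"
      "t powr (real m + \<beta> - real (m - j)) = t powr \<beta> * t ^ j"
      unfolding e using assms by (simp_all add: powr_add powr_realpow)
  qed
  show ?thesis
    unfolding jacobi_poly_def rodrigues_deriv_def poly_sum sum_distrib_left
  proof (intro sum.cong refl)
    fix j assume "j \<in> {..m}"
    then have j: "j \<le> m" by simp
    show "(1 - t) powr \<alpha> * t powr \<beta> * poly (smult ((-1) ^ (m + j) / fact m * real (m choose j) *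
        ffact_real (real m + \<alpha>) j * ffact_real (real m + \<beta>) (m - j)) ([:1, -1:] ^ (m - j) * [:0, 1:] ^ j)) t
      = (-1) ^ m / fact m * (real (m choose j) *
        ((-1) ^ j * ffact_real (real m + \<alpha>) j * (1 - t) powr (real m + \<alpha> - real j) *
        (ffact_real (real m + \<beta>) (m - j) * t powr (real m + \<beta> - real (m - j)))))"
      unfolding 1[OF j] by (simp add: power_add mult_ac)
  qed
qed

lemma shifted_jacobi_eq_poly:
  assumes "0 < t" "t < 1"
  shows "shifted_jacobi m \<alpha> \<beta> t = poly (jacobi_poly m \<alpha> \<beta>) t"
proof -
  have "shifted_jacobi m \<alpha> \<beta> t = (1 - t) powr (- \<alpha>) * t powr (- \<beta>) * ((-1) ^ m / fact m * rodrigues_deriv (real m + \<alpha>) (real m + \<beta>) m t)"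
    using assms by (simp add: shifted_jacobi_def deriv_rodrigues)
  also have "\<dots> = poly (jacobi_poly m \<alpha> \<beta>) t"
    using assms unfolding poly_jacobi_poly_rodrigues[OF assms, symmetric] by (simp add: powr_minus field_simps)
  finally show ?thesis .
qed

lemma degree_jacobi_poly: "degree (jacobi_poly m \<alpha> \<beta>) \<le> m"
proof -
  have "degree (smult c ([:1, -1:] ^ (m - j) * [:0, 1:] ^ j)) \<le> m" if "j \<le> m" for c :: real and j
  proof -
    have "degree (smult c ([:1, -1:] ^ (m - j) * [:0, 1:] ^ j)) \<le> degree ([:1, -1 :: real:] ^ (m - j)) + degree ([:0, 1 :: real:] ^ j)"
      by (rule order_trans[OF degree_smult_le degree_mult_le])
    also have "\<dots> \<le> (m - j) + j"
      by (simp add: degree_power_eq)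
    finally show ?thesis using that by simp
  qed
  then show ?thesis unfolding jacobi_poly_def by (intro degree_sum_le) (simp_all del: degree_smult_eq)
qed

text \<open>Only the sign of (1 - t)^(m-j) survives at the top degree. It cancels the alternating
  sign, and Vandermonde's convolution sums the products of binomials.\<close>

lemma coeff_jacobi_poly_top:
  "coeff (jacobi_poly m \<alpha> \<beta>) m = (2 * real m + \<alpha> + \<beta>) gchoose m"
proof -
  let ?X = "\<lambda>j. (-1) ^ (m + j) / fact m * real (m choose j) * ffact_real (real m + \<alpha>) j * ffact_real (real m + \<beta>) (m - j) * (-1) ^ (m - j)"
  have c: "coeff ([:1, -1 :: real:] ^ (m - j) * [:0, 1:] ^ j) m = (-1) ^ (m - j)" if "j \<le> m" for j
  proof -
    have 1: "[:0, 1 :: real:] ^ j = monom 1 j" by (simp add: monom_altdef)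
    have "coeff ([:1, -1 :: real:] ^ (m - j) * [:0, 1:] ^ j) m = coeff ([:1, -1 :: real:] ^ (m - j)) (m - j)"
      unfolding 1 using that by (subst mult.commute) (simp add: coeff_monom_mult)
    also have "\<dots> = lead_coeff ([:1, -1 :: real:] ^ (m - j))" by (simp add: degree_power_eq)
    also have "\<dots> = (-1) ^ (m - j)" by (subst lead_coeff_power) simp
    finally show ?thesis .
  qed
  have "coeff (jacobi_poly m \<alpha> \<beta>) m = (\<Sum>j\<le>m. ?X j)"
    unfolding jacobi_poly_def by (simp add: coeff_sum c)
  also have "\<dots> = (\<Sum>j\<le>m. ((real m + \<alpha>) gchoose j) * ((real m + \<beta>) gchoose (m - j)))"
  proof (rule sum.cong)
    fix j assume "j \<in> {..m}"
    then have j: "j \<le> m" by simp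
    have s: "(-1 :: real) ^ (m + j) * (-1) ^ (m - j) = 1"
      using j by (simp flip: power_add)
    have b: "real (m choose j) * fact j * fact (m - j) = fact m"
      using binomial_fact[OF j, where 'a = real] by simp
    show "?X j =
      ((real m + \<alpha>) gchoose j) * ((real m + \<beta>) gchoose (m - j))"
    proof -
      have "?X j =
        ((-1) ^ (m + j) * (-1) ^ (m - j)) * (real (m choose j) * fact j * fact (m - j)) / fact m *
        (((real m + \<alpha>) gchoose j) * ((real m + \<beta>) gchoose (m - j)))"
        by (simp add: ffact_real_gbinomial)
      then show ?thesis unfolding s b by simp
    qed
  qed simp
  also have "\<dots> = ((real m + \<alpha>) + (real m + \<beta>)) gchoose m"
    using gbinomial_Vandermonde[of "real m + \<alpha>" "real m + \<beta>" m] by (simp add: atLeast0AtMost)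
  finally show ?thesis by (simp add: algebra_simps)
qed

text \<open>Rodrigues' formula turns the weighted polynomial into an m-th derivative, so all lower
  powers are annihilated by the m integrations by parts.\<close>

lemma has_integral_monomial_jacobi:
  assumes "\<alpha> > -1" "\<beta> > -1" "k \<le> m"
  shows "((\<lambda>t. (1 - t) powr \<alpha> * t powr \<beta> * t ^ k * poly (jacobi_poly m \<alpha> \<beta>) t) has_integral
    (if k < m then 0 else Beta (real m + \<beta> + 1) (real m + \<alpha> + 1))) {0<..<1}"
proof -
  have "((\<lambda>t. t ^ k * rodrigues_deriv (real m + \<alpha>) (real m + \<beta>) m t) has_integral
     (if k < m then 0 else (-1) ^ m * (fact k / fact (k - m)) * Beta (real (k - m) + (real m + \<beta>) + 1) (real m + \<alpha> + 1))) {0..1}"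
    using assms by (intro has_integral_monomial_rodrigues) auto
  from has_integral_mult_right[OF this, of "(-1) ^ m / fact m"]
  have 1: "((\<lambda>t. (-1) ^ m / fact m * (t ^ k * rodrigues_deriv (real m + \<alpha>) (real m + \<beta>) m t)) has_integral
     (if k < m then 0 else Beta (real m + \<beta> + 1) (real m + \<alpha> + 1))) {0<..<1}"
    using assms(3) by (auto simp: has_integral_Icc_iff_Ioo add.assoc split: if_splits simp flip: power_add)
  have 2: "(1 - t) powr \<alpha> * t powr \<beta> * t ^ k * poly (jacobi_poly m \<alpha> \<beta>) t =
      (-1) ^ m / fact m * (t ^ k * rodrigues_deriv (real m + \<alpha>) (real m + \<beta>) m t)" if "t \<in> {0<..<1}" for t
    using poly_jacobi_poly_rodrigues[of t \<alpha> \<beta> m] that by (simp add: algebra_simps)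
  show ?thesis by (rule has_integral_cong[THEN iffD1, OF _ 1]) (use 2 in simp)
qed

text \<open>One of the two factors is expanded in monomials; orthogonality to lower powers leaves
  only its top coefficient times a Beta value.\<close>

lemma has_integral_jacobi_squared:
  assumes "\<alpha> > -1" "\<beta> > -1"
  shows "((\<lambda>t. (1 - t) powr \<alpha> * t powr \<beta> * (poly (jacobi_poly m \<alpha> \<beta>) t)\<^sup>2) has_integral
    ((2 * real m + \<alpha> + \<beta>) gchoose m) * Beta (real m + \<beta> + 1) (real m + \<alpha> + 1)) {0<..<1}"
proof -
  let ?P = "jacobi_poly m \<alpha> \<beta>"
  have "((\<lambda>t. \<Sum>k\<le>m. coeff ?P k * ((1 - t) powr \<alpha> * t powr \<beta> * t ^ k * poly ?P t)) has_integral
     (\<Sum>k\<le>m. coeff ?P k * (if k < m then 0 else Beta (real m + \<beta> + 1) (real m + \<alpha> + 1)))) {0<..<1}"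
    by (intro has_integral_sum has_integral_mult_right has_integral_monomial_jacobi assms) auto
  also have "(\<Sum>k\<le>m. coeff ?P k * (if k < m then 0 else Beta (real m + \<beta> + 1) (real m + \<alpha> + 1)))
     = (\<Sum>k\<in>{m}. coeff ?P k * (if k < m then 0 else Beta (real m + \<beta> + 1) (real m + \<alpha> + 1)))"
    by (rule sum.mono_neutral_right) auto
  also have "\<dots> = ((2 * real m + \<alpha> + \<beta>) gchoose m) * Beta (real m + \<beta> + 1) (real m + \<alpha> + 1)"
    by (simp add: coeff_jacobi_poly_top)
  also have "(\<lambda>t. \<Sum>k\<le>m. coeff ?P k * ((1 - t) powr \<alpha> * t powr \<beta> * t ^ k * poly ?P t))
     = (\<lambda>t. (1 - t) powr \<alpha> * t powr \<beta> * (poly ?P t)\<^sup>2)"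
  proof
    fix t
    have "poly ?P t = (\<Sum>k\<le>m. coeff ?P k * t ^ k)"
      unfolding poly_altdef using degree_jacobi_poly[of m \<alpha> \<beta>]
      by (intro sum.mono_neutral_left) (auto simp: coeff_eq_0)
    then show "(\<Sum>k\<le>m. coeff ?P k * ((1 - t) powr \<alpha> * t powr \<beta> * t ^ k * poly ?P t))
     = (1 - t) powr \<alpha> * t powr \<beta> * (poly ?P t)\<^sup>2"
      by (simp add: power2_eq_square sum_distrib_left sum_distrib_right algebra_simps)
  qed
  finally show ?thesis .
qed

text \<open>With \<beta> \<ge> 0 the argument m + \<alpha> + \<beta> + 1 stays positive even for m =
  0, so all Gamma values in the normalisation are positive.\<close>

lemma has_integral_jacobi_fun_squared:
  assumes "\<alpha> > -1" "\<beta> \<ge> 0"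
  shows "((\<lambda>t. (jacobi_fun m \<alpha> \<beta> t)\<^sup>2) has_integral 1) {0<..<1}"
proof -
  let ?g = "2 * real m + \<alpha> + \<beta> + 1"
  let ?c = "(?g) * Gamma (real m + \<alpha> + \<beta> + 1) * fact m / (Gamma (real m + \<alpha> + 1) * Gamma (real m + \<beta> + 1))"
  have g: "Gamma (real m + \<alpha> + \<beta> + 1) > 0" "Gamma (real m + \<alpha> + 1) > 0" "Gamma (real m + \<beta> + 1) > 0"
    using assms by (auto intro!: Gamma_real_pos)
  have "?g > 0" using assms by simp
  then have c: "?c \<ge> 0" using g by simp
  \<comment> \<open>The top coefficient times m! is a falling factorial, hence a quotient of Gamma
    values; \<open>be\<close> below supplies the matching quotient for the Beta value.\<close>
  have b: "fact m * ((2 * real m + \<alpha> + \<beta>) gchoose m) * Gamma (real m + \<alpha> + \<beta> + 1) = Gamma (?g)"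
    using ffact_real_Gamma[of "2 * real m + \<alpha> + \<beta>" m] assms by (simp add: ffact_real_gbinomial algebra_simps)
  have "Gamma (?g + 1) = (?g) * Gamma (?g)"
    by (rule Gamma_plus1) (use assms in auto)
  moreover have "Gamma (?g + 1) > 0" using assms by (intro Gamma_real_pos) auto
  moreover have "real m + \<beta> + 1 + (real m + \<alpha> + 1) = ?g + 1" by simp
  ultimately have be: "Beta (real m + \<beta> + 1) (real m + \<alpha> + 1) * ((?g) * Gamma (?g))
     = Gamma (real m + \<beta> + 1) * Gamma (real m + \<alpha> + 1)"
    unfolding Beta_def by (metis less_irrefl nonzero_eq_divide_eq)
  have one: "?c * (((2 * real m + \<alpha> + \<beta>) gchoose m) * Beta (real m + \<beta> + 1) (real m + \<alpha> + 1)) = 1"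
  proof -
    have "?c * (((2 * real m + \<alpha> + \<beta>) gchoose m) * Beta (real m + \<beta> + 1) (real m + \<alpha> + 1))
      = (Beta (real m + \<beta> + 1) (real m + \<alpha> + 1) * ((?g) *
          (fact m * ((2 * real m + \<alpha> + \<beta>) gchoose m) * Gamma (real m + \<alpha> + \<beta> + 1))))
        / (Gamma (real m + \<alpha> + 1) * Gamma (real m + \<beta> + 1))" by simp
    also have "\<dots> = 1" unfolding b be using g by simp
    finally show ?thesis .
  qed
  have sq: "?c * ((1 - t) powr \<alpha> * t powr \<beta> * (poly (jacobi_poly m \<alpha> \<beta>) t)\<^sup>2) = (jacobi_fun m \<alpha> \<beta> t)\<^sup>2"
    if "t \<in> {0<..<1}" for t
  proof -
    have "((1 - t) powr (\<alpha> / 2))\<^sup>2 = (1 - t) powr \<alpha>" "(t powr (\<beta> / 2))\<^sup>2 = t powr \<beta>"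
      by (simp_all add: power2_eq_square flip: powr_add)
    moreover have "(sqrt ?c)\<^sup>2 = ?c" using c by (rule real_sqrt_pow2)
    ultimately show ?thesis
      using that unfolding jacobi_fun_def power_mult_distrib by (simp add: shifted_jacobi_eq_poly)
  qed
  from has_integral_mult_right[OF has_integral_jacobi_squared[of \<alpha> \<beta> m], of ?c] assms
  have "((\<lambda>t. ?c * ((1 - t) powr \<alpha> * t powr \<beta> * (poly (jacobi_poly m \<alpha> \<beta>) t)\<^sup>2)) has_integral 1) {0<..<1}"
    unfolding one by simp
  then show ?thesis by (rule has_integral_cong[THEN iffD1, rotated]) (use sq in simp)
qed

subsection \<open>Disk polynomials\<close>

lemma has_wirtinger_disk_powr:
  assumes "cmod z < 1"
  shows "has_wirtinger (\<lambda>w. of_real ((1 - (cmod w)\<^sup>2) powr b))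
    (- of_real b * cnj z * of_real ((1 - (cmod z)\<^sup>2) powr (b - 1)))
    (- of_real b * z * of_real ((1 - (cmod z)\<^sup>2) powr (b - 1))) z"
proof -
  have pos: "1 - (cmod z)\<^sup>2 > 0" using assms by (simp add: power_less_one_iff abs_square_less_1)
  have 1: "((\<lambda>w. 1 - (cmod w)\<^sup>2) has_derivative (\<lambda>h. - (2 * (z \<bullet> h)))) (at z)"
    unfolding power2_norm_eq_inner
    by (rule has_derivative_eq_rhs[OF has_derivative_diff[OF has_derivative_const has_derivative_inner[OF has_derivative_ident has_derivative_ident]]])
       (auto simp: inner_commute)
  have "((\<lambda>x. x powr b) has_real_derivative b * (1 - (cmod z)\<^sup>2) powr (b - 1)) (at (1 - (cmod z)\<^sup>2))"
    by (rule has_real_derivative_powr[OF pos])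
  from has_derivative_of_real[OF DERIV_compose_FDERIV[OF this 1]]
  have "((\<lambda>w. of_real ((1 - (cmod w)\<^sup>2) powr b)) has_derivative
     (\<lambda>h. of_real (- (2 * (z \<bullet> h)) * (b * (1 - (cmod z)\<^sup>2) powr (b - 1))) :: complex)) (at z)" .
  moreover have "(\<lambda>h. of_real (- (2 * (z \<bullet> h)) * (b * (1 - (cmod z)\<^sup>2) powr (b - 1))) :: complex)
    = (\<lambda>h. - of_real b * cnj z * of_real ((1 - (cmod z)\<^sup>2) powr (b - 1)) * h
      + (- of_real b * z * of_real ((1 - (cmod z)\<^sup>2) powr (b - 1))) * cnj h)"
    by (auto simp: fun_eq_iff complex_eq_iff inner_complex_def algebra_simps)
  ultimately show ?thesis by (simp only: has_wirtinger_def)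
qed

lemma has_wirtinger_cmult:
  "has_wirtinger f A B z \<Longrightarrow> has_wirtinger (\<lambda>z. c * f z) (c * A) (c * B) z"
  using has_wirtinger_mult[OF has_wirtinger_const[of c]] by simp

lemma has_wirtinger_power: "has_wirtinger (\<lambda>z. z ^ k) (of_nat k * z ^ (k - 1)) 0 z"
  by (intro has_wirtinger_holomorphic) (auto intro!: derivative_eq_intros)

lemma d_zbar_funpow_disk_powr:
  assumes "z \<in> unit_disk"
  shows "(d_zbar ^^ i) (\<lambda>w. of_real ((1 - (cmod w)\<^sup>2) powr s)) z =
    of_real ((-1) ^ i * ffact_real s i) * z ^ i * of_real ((1 - (cmod z)\<^sup>2) powr (s - real i))"
  using assms
proof (induction i arbitrary: z)
  case (Suc i)
  let ?c = "of_real ((-1) ^ i * ffact_real s i) :: complex"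
  have "has_wirtinger (\<lambda>z. ?c * (z ^ i * of_real ((1 - (cmod z)\<^sup>2) powr (s - real i))))
     (?c * (of_nat i * z ^ (i - 1) * of_real ((1 - (cmod z)\<^sup>2) powr (s - real i)) +
        z ^ i * (- of_real (s - real i) * cnj z * of_real ((1 - (cmod z)\<^sup>2) powr (s - real i - 1)))))
     (?c * (z ^ i * (- of_real (s - real i) * z * of_real ((1 - (cmod z)\<^sup>2) powr (s - real i - 1))))) z"
    using has_wirtinger_mult[OF has_wirtinger_const[of ?c]
       has_wirtinger_mult[OF has_wirtinger_power[of i] has_wirtinger_disk_powr[of z "s - real i"]]] Suc.prems
    by simp
  from has_wirtinger_cong[OF this open_ball Suc.prems, of "(d_zbar ^^ i) (\<lambda>w. of_real ((1 - (cmod w)\<^sup>2) powr s))"]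
  have "d_zbar ((d_zbar ^^ i) (\<lambda>w. of_real ((1 - (cmod w)\<^sup>2) powr s))) z =
     ?c * (z ^ i * (- of_real (s - real i) * z * of_real ((1 - (cmod z)\<^sup>2) powr (s - real i - 1))))"
    by (intro has_wirtingerD(2)) (simp add: Suc.IH mult.assoc)
  then show ?case by (simp add: ffact_real_Suc algebra_simps)
qed simp

text \<open>For \<open>d_z\<close> the variable cnj z is a constant, so this is Leibniz's rule for
  z^p and a power of 1 - |z|^2. \<open>G\<close> is known only on the disk, since it will be an
  iterated derivative computed there.\<close>

lemma d_z_funpow_disk_powr:
  assumes z: "z \<in> unit_disk"
    and G: "\<And>w. w \<in> unit_disk \<Longrightarrow> G w = c * w ^ p * of_real ((1 - (cmod w)\<^sup>2) powr b)"
  shows "(d_z ^^ i) G z = c * (\<Sum>j\<le>i. of_nat (i choose j) * ((of_real (ffact_real (real p) j) * z ^ (p - j)) *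
     (of_real ((-1) ^ (i - j) * ffact_real b (i - j)) * cnj z ^ (i - j) * of_real ((1 - (cmod z)\<^sup>2) powr (b - real (i - j))))))"
  using z
proof (induction i arbitrary: z)
  case 0
  then show ?case by (simp add: G)
next
  case (Suc i)
  let ?u = "\<lambda>j z. of_real (ffact_real (real p) j) * z ^ (p - j) :: complex"
  let ?v = "\<lambda>j z. of_real ((-1) ^ j * ffact_real b j) * cnj z ^ j * of_real ((1 - (cmod z)\<^sup>2) powr (b - real j)) :: complex"
  have zd: "cmod z < 1" using Suc.prems by simp
  have u: "has_wirtinger (?u j) (?u (Suc j) z) 0 z" for j
  proof -
    \<comment> \<open>For j > p the exponent p - j is truncated to 0, but then the falling factorial
      vanishes.\<close>
    have eq: "of_real (ffact_real (real p) j) * (of_nat (p - j) * z ^ (p - j - 1)) = ?u (Suc j) z"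
    proof (cases "j \<le> p")
      case True
      then show ?thesis by (simp add: ffact_real_Suc of_nat_diff)
    next
      case False
      then have "ffact_real (real p) j = 0" "ffact_real (real p) (Suc j) = 0"
        by (simp_all add: ffact_real_of_nat binomial_eq_0)
      then show ?thesis by simp
    qed
    have "has_wirtinger (?u j) (of_real (ffact_real (real p) j) * (of_nat (p - j) * z ^ (p - j - 1))) 0 z"
      using has_wirtinger_mult[OF has_wirtinger_const[of "of_real (ffact_real (real p) j)"] has_wirtinger_power[of "p - j" z]]
      by simp
    then show ?thesis by (simp only: eq)
  qed
  \<comment> \<open>The \<open>d_zbar\<close> component does not enter the next \<open>d_z\<close>,
    so it is kept anonymous.\<close>
  have v: "\<exists>B. has_wirtinger (?v j) (?v (Suc j) z) B z" for j
  proof -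
    let ?c = "of_real ((-1) ^ j * ffact_real b j) :: complex"
    have "has_wirtinger (\<lambda>z. ?c * cnj z ^ j * of_real ((1 - (cmod z)\<^sup>2) powr (b - real j)))
       (?c * cnj z ^ j * (- of_real (b - real j) * cnj z * of_real ((1 - (cmod z)\<^sup>2) powr (b - real j - 1))))
       (?c * (of_nat j * cnj z ^ (j - 1)) * of_real ((1 - (cmod z)\<^sup>2) powr (b - real j)) +
        ?c * cnj z ^ j * (- of_real (b - real j) * z * of_real ((1 - (cmod z)\<^sup>2) powr (b - real j - 1)))) z"
      using has_wirtinger_mult[OF has_wirtinger_mult[OF has_wirtinger_const[of ?c] has_wirtinger_cnj_power[of j]]
        has_wirtinger_disk_powr[OF zd, of "b - real j"]] by simp
    moreover have "?c * cnj z ^ j * (- of_real (b - real j) * cnj z * of_real ((1 - (cmod z)\<^sup>2) powr (b - real j - 1))) = ?v (Suc j) z"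
      by (simp add: ffact_real_Suc algebra_simps)
    ultimately show ?thesis by metis
  qed
  then have "\<forall>j. \<exists>B. has_wirtinger (?v j) (?v (Suc j) z) B z" ..
  from choice[OF this] obtain B where v: "\<And>j. has_wirtinger (?v j) (?v (Suc j) z) (B j) z" by blast
  have trm: "has_wirtinger (\<lambda>z. of_nat (i choose j) * (?u j z * ?v (i - j) z))
      (of_nat (i choose j) * (?u (Suc j) z * ?v (i - j) z + ?u j z * ?v (Suc (i - j)) z))
      (of_nat (i choose j) * (?u j z * B (i - j))) z" for j
    by (rule has_wirtinger_cmult) (use has_wirtinger_mult[OF u v, of j "i - j"] in \<open>simp only: mult_zero_left add_0_left\<close>)
  have "has_wirtinger (\<lambda>z. c * (\<Sum>j\<le>i. of_nat (i choose j) * (?u j z * ?v (i - j) z)))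
      (c * (\<Sum>j\<le>i. of_nat (i choose j) * (?u (Suc j) z * ?v (i - j) z + ?u j z * ?v (Suc (i - j)) z)))
      (c * (\<Sum>j\<le>i. of_nat (i choose j) * (?u j z * B (i - j)))) z"
    by (intro has_wirtinger_cmult has_wirtinger_sum trm)
  note W = has_wirtinger_cong[OF this open_ball Suc.prems Suc.IH]
  have "d_z ((d_z ^^ i) G) z = c * (\<Sum>j\<le>i. of_nat (i choose j) * (?u (Suc j) z * ?v (i - j) z + ?u j z * ?v (Suc (i - j)) z))"
    by (rule has_wirtingerD(1)[OF W])
  also have "\<dots> = c * (\<Sum>j\<le>Suc i. of_nat (Suc i choose j) * (?u j z * ?v (Suc i - j) z))"
    by (subst leibniz_step[where u = "\<lambda>j. ?u j z" and v = "\<lambda>j. ?v j z"]) (rule refl)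
  finally show ?case by simp
qed

text \<open>The p derivatives in cnj z and q - j in z produce Gamma(\<alpha>+p+q+1) /
  Gamma(\<alpha>+j+1); the numerator cancels the squared Gamma under the root of
  \<open>disk_poly_coeff\<close> and leaves a constant with tractable growth in p.\<close>

definition disk_poly_scale :: "real \<Rightarrow> nat \<Rightarrow> nat \<Rightarrow> real" where
  "disk_poly_scale \<alpha> p q = disk_poly_coeff \<alpha> p q * Gamma (\<alpha> + real p + real q + 1)"

text \<open>The index j is the power of 1 - |z|^2 left over after the derivatives. Terms with j > p
  vanish through \<open>p choose j\<close>, so the range j \<le> q does not depend on p; the series
  over p relies on this.\<close>

lemma disk_poly_explicit:
  assumes \<alpha>: "\<alpha> > -1" and z: "z \<in> unit_disk"
  shows "disk_poly \<alpha> p q z = of_real (disk_poly_scale \<alpha> p q) * (\<Sum>j\<le>q.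
    of_real ((-1) ^ j * real (q choose j) * real (p choose j) * fact j / Gamma (\<alpha> + real j + 1) * (1 - (cmod z)\<^sup>2) ^ j)
      * z ^ (p - j) * cnj z ^ (q - j))"
proof -
  have pos: "1 - (cmod z)\<^sup>2 > 0" using z by (simp add: power_less_one_iff abs_square_less_1)
  let ?s = "real p + real q + \<alpha>" and ?b = "real q + \<alpha>"
  let ?G = "(d_zbar ^^ p) (\<lambda>w. of_real ((1 - (cmod w)\<^sup>2) powr ?s))"
  let ?c = "of_real ((-1) ^ p * ffact_real ?s p) :: complex"
  let ?K = "(-1) ^ (p + q) * of_real (disk_poly_coeff \<alpha> p q) * of_real ((1 - (cmod z)\<^sup>2) powr (- \<alpha>)) :: complex"
  let ?I = "\<lambda>j. of_nat (q choose j) * ((of_real (ffact_real (real p) j) * z ^ (p - j)) *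
     (of_real ((-1) ^ (q - j) * ffact_real ?b (q - j)) * cnj z ^ (q - j) * of_real ((1 - (cmod z)\<^sup>2) powr (?b - real (q - j)))))"
  let ?R = "\<lambda>j. of_real (disk_poly_scale \<alpha> p q) * (
    of_real ((-1) ^ j * real (q choose j) * real (p choose j) * fact j / Gamma (\<alpha> + real j + 1) * (1 - (cmod z)\<^sup>2) ^ j)
      * z ^ (p - j) * cnj z ^ (q - j))"
  have G: "?G w = ?c * w ^ p * of_real ((1 - (cmod w)\<^sup>2) powr ?b)" if "w \<in> unit_disk" for w
    using d_zbar_funpow_disk_powr[OF that, of p ?s] by (simp add: algebra_simps)
  have Gp: "ffact_real ?s p * Gamma (?b + 1) = Gamma (?s + 1)"
    using ffact_real_Gamma[of ?s p] \<alpha> by (simp add: algebra_simps)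
  have Gq: "ffact_real ?b (q - j) = Gamma (?b + 1) / Gamma (\<alpha> + real j + 1)" if "j \<le> q" for j
  proof -
    have "ffact_real ?b (q - j) * Gamma (\<alpha> + real j + 1) = Gamma (?b + 1)"
      using ffact_real_Gamma[of ?b "q - j"] \<alpha> that by (simp add: of_nat_diff algebra_simps)
    moreover have "Gamma (\<alpha> + real j + 1) > 0" using \<alpha> by (intro Gamma_real_pos) auto
    ultimately show ?thesis by (simp add: field_simps)
  qed
  have "disk_poly \<alpha> p q z = ?K *
     (?c * (\<Sum>j\<le>q. ?I j))"
    unfolding disk_poly_def if_P[OF z] by (subst d_z_funpow_disk_powr[OF z G]) (simp_all only: mult.assoc)
  also have "\<dots> = (\<Sum>j\<le>q. ?R j)"
    unfolding sum_distrib_left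
  proof (rule sum.cong[OF refl])
    fix j assume "j \<in> {..q}"
    then have j: "j \<le> q" by simp
    have e: "?b - real (q - j) = \<alpha> + real j" using j by (simp add: of_nat_diff)
    have pw: "(1 - (cmod z)\<^sup>2) powr (- \<alpha>) * (1 - (cmod z)\<^sup>2) powr (?b - real (q - j)) = (1 - (cmod z)\<^sup>2) ^ j"
      unfolding e using pos by (simp add: powr_realpow flip: powr_add)
    \<comment> \<open>The three signs come from the definition, from the p derivatives in cnj z and
      from the q - j derivatives falling on the power of 1 - |z|^2.\<close>
    have sg: "(-1::real) ^ (p + q) * (-1) ^ p * (-1) ^ (q - j) = (-1) ^ j"
    proof -
      have "(-1::real) ^ (p + q) * (-1) ^ p * (-1) ^ (q - j) = (-1) ^ (2 * p + 2 * (q - j) + j)"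
      proof -
        have "p + q + p + (q - j) = 2 * p + 2 * (q - j) + j" using j by simp
        then show ?thesis by (simp only: power_add[symmetric])
      qed
      then show ?thesis by (simp add: power_add)
    qed
    have "?K *
     (?c * (?I j))
     = of_real (((-1) ^ (p + q) * (-1) ^ p * (-1) ^ (q - j)) * disk_poly_coeff \<alpha> p q *
       ((1 - (cmod z)\<^sup>2) powr (- \<alpha>) * (1 - (cmod z)\<^sup>2) powr (?b - real (q - j))) *
       (ffact_real ?s p * ffact_real ?b (q - j)) * real (q choose j) * ffact_real (real p) j) * z ^ (p - j) * cnj z ^ (q - j)"
      by (simp add: mult_ac)
    also have "\<dots> = ?R j"
      unfolding pw sg Gq[OF j] using Gp by (simp add: disk_poly_scale_def ffact_real_of_nat algebra_simps)
    finally show "?K *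
     (?c * (?I j))
     = ?R j" .
  qed
  finally show ?thesis by (simp add: sum_distrib_left)
qed

text \<open>Reversing the order of summation makes the index the power of 1 - t, which aligns the
  sum with that of \<open>disk_poly_explicit\<close>.\<close>

lemma jacobi_poly_nat:
  assumes \<alpha>: "\<alpha> > -1"
  shows "poly (jacobi_poly m \<alpha> (real b)) t = Gamma (real m + \<alpha> + 1) / fact m *
    (\<Sum>i\<le>m. (-1) ^ i * real (m choose i) * real ((m + b) choose i) * fact i / Gamma (\<alpha> + real i + 1) * (1 - t) ^ i * t ^ (m - i))"
proof -
  let ?A = "\<lambda>i. (-1) ^ (m + (m - i)) / fact m * real (m choose (m - i)) *
      ffact_real (real m + \<alpha>) (m - i) * ffact_real (real m + real b) (m - (m - i)) * ((1 - t) ^ (m - (m - i)) * t ^ (m - i))"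
  let ?B = "\<lambda>i. Gamma (real m + \<alpha> + 1) / fact m *
    ((-1) ^ i * real (m choose i) * real ((m + b) choose i) * fact i / Gamma (\<alpha> + real i + 1) * (1 - t) ^ i * t ^ (m - i))"
  have "poly (jacobi_poly m \<alpha> (real b)) t = (\<Sum>j\<le>m. (-1) ^ (m + j) / fact m * real (m choose j) *
      ffact_real (real m + \<alpha>) j * ffact_real (real m + real b) (m - j) * ((1 - t) ^ (m - j) * t ^ j))"
    by (simp add: jacobi_poly_def poly_sum)
  also have "\<dots> = (\<Sum>i\<le>m. ?A i)"
    by (rule sum.reindex_bij_witness[where i = "\<lambda>i. m - i" and j = "\<lambda>i. m - i"]) auto
  also have "\<dots> = (\<Sum>i\<le>m. ?B i)"
  proof (rule sum.cong[OF refl])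
    fix i assume "i \<in> {..m}"
    then have i: "i \<le> m" by simp
    have sg: "(-1::real) ^ (m + (m - i)) = (-1) ^ i"
    proof -
      have "m + (m - i) = 2 * (m - i) + i" using i by simp
      then show ?thesis by (simp only: power_add power_mult) simp
    qed
    have ch: "m choose (m - i) = m choose i" using binomial_symmetric[OF i] by simp
    have "ffact_real (real m + \<alpha>) (m - i) * Gamma (\<alpha> + real i + 1) = Gamma (real m + \<alpha> + 1)"
      using ffact_real_Gamma[of "real m + \<alpha>" "m - i"] \<alpha> i by (simp add: of_nat_diff algebra_simps)
    moreover have "Gamma (\<alpha> + real i + 1) > 0" using \<alpha> by (intro Gamma_real_pos) auto
    ultimately have fa: "ffact_real (real m + \<alpha>) (m - i) = Gamma (real m + \<alpha> + 1) / Gamma (\<alpha> + real i + 1)"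
      by (simp add: field_simps)
    have fb: "ffact_real (real m + real b) (m - (m - i)) = fact i * real ((m + b) choose i)"
      using i ffact_real_of_nat[of "m + b" i] by simp
    show "?A i
     = ?B i"
      unfolding sg ch fa fb using i by simp
  qed
  finally show ?thesis by (simp add: sum_distrib_left)
qed

lemma of_real_cmod_squared_power: "complex_of_real (((cmod z)\<^sup>2) ^ k) = z ^ k * cnj z ^ k"
  by (metis complex_norm_square of_real_power power_mult_distrib)

text \<open>The factor between the disk polynomial and its Jacobi form: the constant
  Gamma(m+\<alpha>+1)/m! carried by \<open>jacobi_poly_nat\<close> is divided out.\<close>

definition jacobi_scale :: "real \<Rightarrow> nat \<Rightarrow> nat \<Rightarrow> real" where
  "jacobi_scale \<alpha> p q = disk_poly_scale \<alpha> p q * fact (min p q) / Gamma (real (min p q) + \<alpha> + 1)"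

abbreviation radial_part :: "real \<Rightarrow> nat \<Rightarrow> nat \<Rightarrow> real poly" where
  "radial_part \<alpha> p q \<equiv> jacobi_poly (min p q) \<alpha> (real (max p q - min p q))"

text \<open>With m = min p q, each term has the common factor z^(p-m) cnj z^(q-m), and what is left
  is (|z|^2)^(m-j). The product of the two binomials is symmetric in p and q, so both cases p \<le>
  q and q \<le> p give the same polynomial.\<close>

lemma disk_poly_jacobi:
  assumes \<alpha>: "\<alpha> > -1" and z: "z \<in> unit_disk"
  shows "disk_poly \<alpha> p q z = of_real (jacobi_scale \<alpha> p q * poly (radial_part \<alpha> p q) ((cmod z)\<^sup>2)) *
    (z ^ (p - min p q) * cnj z ^ (q - min p q))"
proof -
  define m where "m = min p q"
  define b where "b = max p q - m"
  have mp: "m \<le> p" "m \<le> q" by (auto simp: m_def)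
  let ?t = "(cmod z)\<^sup>2"
  let ?f = "\<lambda>j. of_real ((-1) ^ j * real (q choose j) * real (p choose j) * fact j / Gamma (\<alpha> + real j + 1) * (1 - ?t) ^ j)
      * z ^ (p - j) * cnj z ^ (q - j)"
  let ?T = "\<lambda>j. (-1) ^ j * real (m choose j) * real ((m + b) choose j) * fact j / Gamma (\<alpha> + real j + 1) * (1 - ?t) ^ j * ?t ^ (m - j)"
  have "(\<Sum>j\<le>q. ?f j) = (\<Sum>j\<le>m. ?f j)"
  proof (rule sum.mono_neutral_right)
    show "\<forall>j\<in>{..q} - {..m}. ?f j = 0"
    proof
      fix j assume "j \<in> {..q} - {..m}"
      then have "j > p" by (auto simp: m_def)
      then show "?f j = 0" by (simp add: binomial_eq_0)
    qed
  qed (use mp in auto)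
  also have "\<dots> = (\<Sum>j\<le>m. of_real (?T j) *
      (z ^ (p - m) * cnj z ^ (q - m)))"
  proof (rule sum.cong[OF refl])
    fix j assume "j \<in> {..m}"
    then have j: "j \<le> m" by simp
    have ch: "real (q choose j) * real (p choose j) = real (m choose j) * real ((m + b) choose j)"
      unfolding b_def m_def by (cases "p \<le> q") (auto simp: min_def max_def)
    have "p - j = (p - m) + (m - j)" "q - j = (q - m) + (m - j)" using j mp by auto
    then have pw: "z ^ (p - j) * cnj z ^ (q - j) = of_real (?t ^ (m - j)) * (z ^ (p - m) * cnj z ^ (q - m))"
      unfolding of_real_cmod_squared_power by (simp only: power_add mult_ac)
    show "?f j = of_real (?T j) *
      (z ^ (p - m) * cnj z ^ (q - m))"
    proof -
      have "?f j = of_real ((-1) ^ j * (real (q choose j) * real (p choose j)) * fact j / Gamma (\<alpha> + real j + 1) * (1 - ?t) ^ j)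
        * (z ^ (p - j) * cnj z ^ (q - j))" by (simp add: mult.assoc)
      then show ?thesis unfolding ch pw by (simp add: mult.assoc)
    qed
  qed
  also have "\<dots> = of_real (\<Sum>j\<le>m. ?T j)
     * (z ^ (p - m) * cnj z ^ (q - m))"
    by (simp add: sum_distrib_right)
  finally have 1: "(\<Sum>j\<le>q. ?f j) = of_real (\<Sum>j\<le>m. ?T j)
     * (z ^ (p - m) * cnj z ^ (q - m))" .
  have "Gamma (real m + \<alpha> + 1) > 0" using \<alpha> by (intro Gamma_real_pos) auto
  then have 2: "(\<Sum>j\<le>m. ?T j)
     = fact m / Gamma (real m + \<alpha> + 1) * poly (jacobi_poly m \<alpha> (real b)) ?t"
    unfolding jacobi_poly_nat[OF \<alpha>] by simp
  show ?thesis
    unfolding disk_poly_explicit[OF assms] 1 2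
    unfolding jacobi_scale_def m_def b_def by simp
qed

lemma disk_poly_scale_pos:
  assumes "\<alpha> > -1"
  shows "disk_poly_scale \<alpha> p q > 0"
  unfolding disk_poly_scale_def disk_poly_coeff_def using assms
  by (intro mult_pos_pos real_sqrt_gt_zero divide_pos_pos Gamma_real_pos zero_less_power) auto

lemma disk_poly_scale_squared:
  assumes \<alpha>: "\<alpha> > -1"
  shows "(disk_poly_scale \<alpha> p q)\<^sup>2 = (\<alpha> + real p + real q + 1) * Gamma (\<alpha> + real p + 1) * Gamma (\<alpha> + real q + 1) /
      ((\<alpha> + 1) * fact p * fact q)"
proof -
  have G: "Gamma (\<alpha> + real p + real q + 1) > 0" using \<alpha> by (intro Gamma_real_pos) auto
  have "(\<alpha> + real p + real q + 1) * Gamma (\<alpha> + real p + 1) * Gamma (\<alpha> + real q + 1) /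
      ((\<alpha> + 1) * fact p * fact q * (Gamma (\<alpha> + real p + real q + 1))\<^sup>2) \<ge> 0"
    using \<alpha> by (intro divide_nonneg_nonneg mult_nonneg_nonneg less_imp_le[OF Gamma_real_pos]) auto
  then show ?thesis
    unfolding disk_poly_scale_def disk_poly_coeff_def power_mult_distrib using G by simp
qed

text \<open>The right-hand side is the density of \<open>mu\<close> in t = |z|^2 times |b|^2 for the
  disk polynomial b. The identity of constants \<open>K\<close> in the proof is thus the source of
  both the normalisation and the eigenvalue formula.\<close>

lemma jacobi_fun_disk_poly:
  assumes \<alpha>: "\<alpha> > -1" and t: "0 < t" "t < 1"
  shows "(jacobi_fun (min p q) \<alpha> \<bar>real p - real q\<bar> t)\<^sup>2 =
    (\<alpha> + 1) * (1 - t) powr \<alpha> * ((jacobi_scale \<alpha> p q)\<^sup>2 * t ^ (max p q - min p q) * (poly (radial_part \<alpha> p q) t)\<^sup>2)"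
proof -
  define m where "m = min p q"
  define b where "b = max p q - m"
  have pq: "(p = m \<and> q = m + b) \<or> (q = m \<and> p = m + b)"
    by (auto simp: m_def b_def min_def max_def)
  have b: "\<bar>real p - real q\<bar> = real b" using pq by auto
  let ?c = "(2 * real m + \<alpha> + real b + 1) * Gamma (real m + \<alpha> + real b + 1) * fact m / (Gamma (real m + \<alpha> + 1) * Gamma (real m + real b + 1))"
  have c: "?c \<ge> 0"
    using \<alpha> by (intro divide_nonneg_nonneg mult_nonneg_nonneg less_imp_le[OF Gamma_real_pos]) auto
  have g: "Gamma (real m + \<alpha> + 1) > 0" using \<alpha> by (intro Gamma_real_pos) auto
  have fb: "Gamma (real m + real b + 1) = fact (m + b)"
    using Gamma_fact[of "m + b", where 'a = real] by (simp add: add_ac)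
  have s2: "(\<alpha> + 1) * (disk_poly_scale \<alpha> p q)\<^sup>2 = (2 * real m + \<alpha> + real b + 1) * Gamma (real m + \<alpha> + 1) * Gamma (real m + \<alpha> + real b + 1) / (fact m * fact (m + b))"
    unfolding disk_poly_scale_squared[OF \<alpha>] using pq \<alpha> by (auto simp: add_ac mult_ac)
  have "(\<alpha> + 1) * (jacobi_scale \<alpha> p q)\<^sup>2 = ((\<alpha> + 1) * (disk_poly_scale \<alpha> p q)\<^sup>2) * (fact m)\<^sup>2 / (Gamma (real m + \<alpha> + 1))\<^sup>2"
    unfolding jacobi_scale_def m_def by (simp add: power_divide power_mult_distrib)
  also have "\<dots> = ?c"
    unfolding s2 fb using g by (simp add: power2_eq_square divide_simps)
  finally have K: "(\<alpha> + 1) * (jacobi_scale \<alpha> p q)\<^sup>2 = ?c" .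
  have "((1 - t) powr (\<alpha> / 2))\<^sup>2 = (1 - t) powr \<alpha>" "(t powr (real b / 2))\<^sup>2 = t powr real b"
    by (simp_all add: power2_eq_square flip: powr_add)
  moreover have "(sqrt ?c)\<^sup>2 = ?c" using c by (rule real_sqrt_pow2)
  ultimately have "(jacobi_fun m \<alpha> (real b) t)\<^sup>2 = ?c * (1 - t) powr \<alpha> * t powr real b * (poly (jacobi_poly m \<alpha> (real b)) t)\<^sup>2"
    using t unfolding jacobi_fun_def power_mult_distrib by (simp add: shifted_jacobi_eq_poly)
  also have "t powr real b = t ^ b" using t by (simp add: powr_realpow)
  finally show ?thesis
    unfolding K[symmetric] b m_def[symmetric] b_def[symmetric] by (simp add: mult_ac)
qed

lemma norm_disk_poly_squared:
  assumes \<alpha>: "\<alpha> > -1" and z: "z \<in> unit_disk"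
  shows "(cmod (disk_poly \<alpha> p q z))\<^sup>2 =
    (jacobi_scale \<alpha> p q)\<^sup>2 * ((cmod z)\<^sup>2) ^ (max p q - min p q) * (poly (radial_part \<alpha> p q) ((cmod z)\<^sup>2))\<^sup>2"
proof -
  have "max p q - min p q = (p - min p q) + (q - min p q)" by auto
  then have "((cmod z)\<^sup>2) ^ (max p q - min p q) = ((cmod z) ^ (p - min p q) * (cmod z) ^ (q - min p q))\<^sup>2"
    by (metis power_add power_mult mult.commute)
  then show ?thesis
    unfolding disk_poly_jacobi[OF assms] norm_mult power_mult_distrib
    by (simp add: norm_power norm_mult power_mult_distrib)
qed

text \<open>The index j counts the factors |z|^2 removed from the top monomial z^p cnj z^q, which is
  why the coefficients are read from the top downwards.\<close>

definition disk_poly_monomial_coeff :: "real \<Rightarrow> nat \<Rightarrow> nat \<Rightarrow> nat \<Rightarrow> real" where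
  "disk_poly_monomial_coeff \<alpha> p q j = jacobi_scale \<alpha> p q * coeff (radial_part \<alpha> p q) (min p q - j)"

lemma disk_poly_monomials:
  assumes \<alpha>: "\<alpha> > -1" and z: "z \<in> unit_disk"
  shows "disk_poly \<alpha> p q z = (\<Sum>j\<le>min p q. of_real (disk_poly_monomial_coeff \<alpha> p q j) * (z ^ (p - j) * cnj z ^ (q - j)))"
proof -
  let ?m = "min p q" and ?P = "radial_part \<alpha> p q"
  have "poly ?P t = (\<Sum>k\<le>?m. coeff ?P k * t ^ k)" for t
    unfolding poly_altdef using degree_jacobi_poly[of ?m \<alpha>]
    by (intro sum.mono_neutral_left) (auto simp: coeff_eq_0)
  also have "\<And>t. (\<Sum>k\<le>?m. coeff ?P k * t ^ k) = (\<Sum>j\<le>?m. coeff ?P (?m - j) * t ^ (?m - j))"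
    by (rule sum.reindex_bij_witness[where i = "\<lambda>i. ?m - i" and j = "\<lambda>i. ?m - i"]) auto
  finally have P: "poly ?P t = (\<Sum>j\<le>?m. coeff ?P (?m - j) * t ^ (?m - j))" for t .
  have "of_real (jacobi_scale \<alpha> p q * coeff ?P (?m - j) * ((cmod z)\<^sup>2) ^ (?m - j)) * (z ^ (p - ?m) * cnj z ^ (q - ?m))
    = of_real (disk_poly_monomial_coeff \<alpha> p q j) * (z ^ (p - j) * cnj z ^ (q - j))" if j: "j \<le> ?m" for j
  proof -
    have "p - j = (p - ?m) + (?m - j)" "q - j = (q - ?m) + (?m - j)" using j by auto
    then have "z ^ (p - j) * cnj z ^ (q - j) = of_real (((cmod z)\<^sup>2) ^ (?m - j)) * (z ^ (p - ?m) * cnj z ^ (q - ?m))"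
      unfolding of_real_cmod_squared_power by (simp only: power_add mult_ac)
    then show ?thesis by (simp add: disk_poly_monomial_coeff_def)
  qed
  then show ?thesis
    unfolding disk_poly_jacobi[OF assms] P sum_distrib_left of_real_sum sum_distrib_right
    by (intro sum.cong refl) (simp add: mult.assoc)
qed

text \<open>All factors of the falling factorial in the top Jacobi coefficient are positive. The top
  monomial of any mode can therefore be cancelled by a multiple of the disk polynomial.\<close>

lemma disk_poly_leading_coeff:
  assumes \<alpha>: "\<alpha> > -1"
  shows "disk_poly_monomial_coeff \<alpha> p q 0 \<noteq> 0"
proof -
  let ?m = "min p q"
  let ?a = "2 * real ?m + \<alpha> + real (max p q - ?m)"
  have "ffact_real ?a ?m > 0"
    unfolding ffact_real_def using \<alpha> by (intro prod_pos) auto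
  then have "coeff (radial_part \<alpha> p q) ?m > 0"
    by (simp add: coeff_jacobi_poly_top ffact_real_gbinomial zero_less_mult_iff)
  moreover have "jacobi_scale \<alpha> p q > 0"
    unfolding jacobi_scale_def using disk_poly_scale_pos[OF \<alpha>, of p q] \<alpha> Gamma_real_pos[of "real ?m + \<alpha> + 1"]
    by auto
  ultimately show ?thesis by (simp add: disk_poly_monomial_coeff_def)
qed

subsection \<open>Orthonormal expansions in \<open>L\<^sup>2\<close>\<close>

lemma borel_measurable_cnj [measurable (raw)]:
  "f \<in> borel_measurable M \<Longrightarrow> (\<lambda>x. cnj (f x)) \<in> borel_measurable M"
  by (rule measurable_compose[OF _ borel_measurable_continuous_onI]) (auto intro: continuous_intros)

lemma L2D: "f \<in> L2 M \<Longrightarrow> f \<in> borel_measurable M" "f \<in> L2 M \<Longrightarrow> integrable M (\<lambda>x. (cmod (f x))\<^sup>2)"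
  by (auto simp: L2_def)

lemma L2_mult_cnj_integrable:
  assumes f: "f \<in> L2 M" and g: "g \<in> L2 M"
  shows "integrable M (\<lambda>x. f x * cnj (g x))"
proof (rule Bochner_Integration.integrable_bound)
  show "integrable M (\<lambda>x. (cmod (f x))\<^sup>2 + (cmod (g x))\<^sup>2)"
    by (intro Bochner_Integration.integrable_add L2D f g)
  show "(\<lambda>x. f x * cnj (g x)) \<in> borel_measurable M"
    using L2D(1)[OF f] L2D(1)[OF g] by measurable
  have "a * b \<le> a\<^sup>2 + b\<^sup>2" if "a \<ge> 0" "b \<ge> 0" for a b :: real
    using sum_squares_bound[of a b] mult_nonneg_nonneg[OF that] by linarith
  then show "AE x in M. norm (f x * cnj (g x)) \<le> norm ((cmod (f x))\<^sup>2 + (cmod (g x))\<^sup>2)"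
    by (intro AE_I2) (auto simp: norm_mult)
qed

lemma L2_add:
  assumes f: "f \<in> L2 M" and g: "g \<in> L2 M"
  shows "(\<lambda>x. f x + g x) \<in> L2 M"
proof -
  have m: "(\<lambda>x. f x + g x) \<in> borel_measurable M"
    using L2D(1)[OF f] L2D(1)[OF g] by measurable
  have "integrable M (\<lambda>x. (cmod (f x + g x))\<^sup>2)"
  proof (rule Bochner_Integration.integrable_bound)
    show "integrable M (\<lambda>x. 2 * (cmod (f x))\<^sup>2 + 2 * (cmod (g x))\<^sup>2)"
      by (intro Bochner_Integration.integrable_add integrable_mult_right L2D f g)
    show "(\<lambda>x. (cmod (f x + g x))\<^sup>2) \<in> borel_measurable M" using m by measurable
    have "(cmod (a + b))\<^sup>2 \<le> 2 * (cmod a)\<^sup>2 + 2 * (cmod b)\<^sup>2" for a b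
    proof -
      have "(cmod (a + b))\<^sup>2 \<le> (cmod a + cmod b)\<^sup>2" by (intro power_mono norm_triangle_ineq) auto
      also have "\<dots> \<le> 2 * (cmod a)\<^sup>2 + 2 * (cmod b)\<^sup>2"
        using sum_squares_bound[of "cmod a" "cmod b"] by (simp add: power2_sum)
      finally show ?thesis .
    qed
    then show "AE x in M. norm ((cmod (f x + g x))\<^sup>2) \<le> norm (2 * (cmod (f x))\<^sup>2 + 2 * (cmod (g x))\<^sup>2)"
      by (intro AE_I2) auto
  qed
  with m show ?thesis by (simp add: L2_def)
qed

lemma L2_bounded_mult:
  assumes f: "f \<in> L2 M" and g: "g \<in> borel_measurable M" and C: "AE x in M. cmod (g x) \<le> C"
  shows "(\<lambda>x. g x * f x) \<in> L2 M"
proof -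
  have m: "(\<lambda>x. g x * f x) \<in> borel_measurable M" using L2D(1)[OF f] g by measurable
  have "integrable M (\<lambda>x. (cmod (g x * f x))\<^sup>2)"
  proof (rule Bochner_Integration.integrable_bound)
    show "integrable M (\<lambda>x. C\<^sup>2 * (cmod (f x))\<^sup>2)" by (intro integrable_mult_right L2D f)
    show "(\<lambda>x. (cmod (g x * f x))\<^sup>2) \<in> borel_measurable M" using m by measurable
    show "AE x in M. norm ((cmod (g x * f x))\<^sup>2) \<le> norm (C\<^sup>2 * (cmod (f x))\<^sup>2)"
      using C by eventually_elim (auto simp: norm_mult power_mult_distrib intro!: mult_right_mono power_mono)
  qed
  with m show ?thesis by (simp add: L2_def)
qed

lemma L2_cmult: "f \<in> L2 M \<Longrightarrow> (\<lambda>x. c * f x) \<in> L2 M"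
  by (rule L2_bounded_mult[of _ _ "\<lambda>_. c" "cmod c"]) auto

lemma L2_diff: "f \<in> L2 M \<Longrightarrow> g \<in> L2 M \<Longrightarrow> (\<lambda>x. f x - g x) \<in> L2 M"
  using L2_add[of f M "\<lambda>x. -1 * g x"] L2_cmult[of g M "-1"] by simp

lemma L2_zero: "(\<lambda>_. 0) \<in> L2 M"
  by (simp add: L2_def)

lemma L2_sum: "(\<And>i. i \<in> I \<Longrightarrow> f i \<in> L2 M) \<Longrightarrow> (\<lambda>x. \<Sum>i\<in>I. f i x) \<in> L2 M"
  by (induction I rule: infinite_finite_induct) (auto intro: L2_zero L2_add)

lemma l2_inner_add_left:
  "f \<in> L2 M \<Longrightarrow> g \<in> L2 M \<Longrightarrow> h \<in> L2 M \<Longrightarrow> l2_inner M (\<lambda>x. f x + g x) h = l2_inner M f h + l2_inner M g h"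
  unfolding l2_inner_def distrib_right by (intro Bochner_Integration.integral_add L2_mult_cnj_integrable)

lemma l2_inner_diff_left:
  "f \<in> L2 M \<Longrightarrow> g \<in> L2 M \<Longrightarrow> h \<in> L2 M \<Longrightarrow> l2_inner M (\<lambda>x. f x - g x) h = l2_inner M f h - l2_inner M g h"
  unfolding l2_inner_def left_diff_distrib by (intro Bochner_Integration.integral_diff L2_mult_cnj_integrable)

lemma l2_inner_cmult_left: "l2_inner M (\<lambda>x. c * f x) h = c * l2_inner M f h"
  unfolding l2_inner_def mult.assoc by simp

lemma l2_inner_cnj: "l2_inner M g f = cnj (l2_inner M f g)"
  unfolding l2_inner_def by (subst Bochner_Integration.integral_cnj[symmetric]) (simp add: mult.commute)

lemma l2_inner_sum_left:
  assumes "\<And>i. i \<in> I \<Longrightarrow> f i \<in> L2 M" "h \<in> L2 M"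
  shows "l2_inner M (\<lambda>x. \<Sum>i\<in>I. f i x) h = (\<Sum>i\<in>I. l2_inner M (f i) h)"
  unfolding l2_inner_def sum_distrib_right
  by (intro Bochner_Integration.integral_sum L2_mult_cnj_integrable assms)

lemma l2_inner_self: "l2_inner M f f = of_real ((l2_norm M f)\<^sup>2)"
proof -
  have "l2_inner M f f = (LINT x|M. of_real ((cmod (f x))\<^sup>2))"
    unfolding l2_inner_def by (simp only: complex_norm_square)
  also have "\<dots> = of_real (LINT x|M. (cmod (f x))\<^sup>2)" by (rule integral_complex_of_real)
  also have "(LINT x|M. (cmod (f x))\<^sup>2) = (l2_norm M f)\<^sup>2"
    by (simp add: l2_norm_def)
  finally show ?thesis .
qed

lemma l2_norm_nonneg: "l2_norm M f \<ge> 0"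
  by (simp add: l2_norm_def)

lemma l2_Cauchy_Schwarz:
  assumes f: "f \<in> L2 M" and g: "g \<in> L2 M"
  shows "cmod (l2_inner M f g) \<le> l2_norm M f * l2_norm M g"
proof (cases "l2_norm M g = 0")
  case True
  then have "(LINT x|M. (cmod (g x))\<^sup>2) = 0" by (simp add: l2_norm_def)
  then have "AE x in M. g x = 0"
    by (subst (asm) integral_nonneg_eq_0_iff_AE) (use L2D(2)[OF g] in auto)
  then have "AE x in M. f x * cnj (g x) = 0" by eventually_elim simp
  then have "l2_inner M f g = 0" unfolding l2_inner_def by (rule integral_eq_zero_AE)
  then show ?thesis by (simp add: l2_norm_nonneg)
next
  case False
  define n where "n = (l2_norm M g)\<^sup>2"
  have n: "n > 0" using False by (simp add: n_def)
  define t where "t = l2_inner M f g / of_real n"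
  let ?h = "\<lambda>x. f x - t * g x"
  have tg: "(\<lambda>x. t * g x) \<in> L2 M" by (rule L2_cmult[OF g])
  have h: "?h \<in> L2 M" by (rule L2_diff[OF f tg])
  have "l2_inner M ?h g = l2_inner M f g - t * l2_inner M g g"
    by (simp only: l2_inner_diff_left[OF f tg g] l2_inner_cmult_left)
  then have hg: "l2_inner M ?h g = 0"
    unfolding l2_inner_self n_def[symmetric] t_def using n by simp
  have "of_real ((l2_norm M ?h)\<^sup>2) = l2_inner M ?h ?h" by (rule l2_inner_self[symmetric])
  also have "\<dots> = l2_inner M f ?h - t * l2_inner M g ?h"
    by (simp add: l2_inner_diff_left[OF f tg h] l2_inner_cmult_left)
  also have "l2_inner M g ?h = 0" using hg l2_inner_cnj[of M g ?h] by simp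
  also have "l2_inner M f ?h = cnj (l2_inner M f f - t * l2_inner M g f)"
    using l2_inner_cnj[of M f ?h] by (simp add: l2_inner_diff_left[OF f tg f] l2_inner_cmult_left)
  also have "t * l2_inner M g f = of_real ((cmod (l2_inner M f g))\<^sup>2 / n)"
    unfolding l2_inner_cnj[of M g f] t_def by (simp add: complex_norm_square[symmetric] del: of_real_power)
  finally have "of_real ((l2_norm M ?h)\<^sup>2) = (of_real ((l2_norm M f)\<^sup>2 - (cmod (l2_inner M f g))\<^sup>2 / n) :: complex)"
    by (simp add: l2_inner_self)
  then have "(l2_norm M ?h)\<^sup>2 = (l2_norm M f)\<^sup>2 - (cmod (l2_inner M f g))\<^sup>2 / n" by (simp only: of_real_eq_iff)
  then have "(cmod (l2_inner M f g))\<^sup>2 / n \<le> (l2_norm M f)\<^sup>2"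
    by (metis diff_ge_0_iff_ge zero_le_power2)
  then have "(cmod (l2_inner M f g))\<^sup>2 \<le> (l2_norm M f * l2_norm M g)\<^sup>2"
    using n by (simp add: divide_le_eq power_mult_distrib n_def)
  then show ?thesis by (rule power2_le_imp_le) (simp add: l2_norm_nonneg)
qed

lemma l2_inner_tendsto:
  assumes "\<And>N. s N \<in> L2 M" "g \<in> L2 M" "h \<in> L2 M" "(\<lambda>N. l2_norm M (\<lambda>x. g x - s N x)) \<longlonglongrightarrow> 0"
  shows "(\<lambda>N. l2_inner M (s N) h) \<longlonglongrightarrow> l2_inner M g h"
proof -
  have "(\<lambda>N. l2_inner M g h - l2_inner M (s N) h) \<longlonglongrightarrow> 0"
  proof (rule tendsto_norm_zero_cancel, rule tendsto_sandwich[OF _ _ tendsto_const])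
    show "\<forall>\<^sub>F N in sequentially. norm (l2_inner M g h - l2_inner M (s N) h) \<le> l2_norm M (\<lambda>x. g x - s N x) * l2_norm M h"
      using l2_Cauchy_Schwarz[OF L2_diff[OF assms(2,1)] assms(3)]
      by (simp add: l2_inner_diff_left[OF assms(2,1,3)])
    show "(\<lambda>N. l2_norm M (\<lambda>x. g x - s N x) * l2_norm M h) \<longlonglongrightarrow> 0"
      using tendsto_mult_left_zero[OF assms(4)] .
  qed simp
  from tendsto_diff[OF tendsto_const[of "l2_inner M g h"] this] show ?thesis by simp
qed

section \<open>Orthonormal families: Bessel's inequality and convergent expansions\<close>

locale l2_orthonormal =
  fixes M :: "'a measure" and e :: "nat \<Rightarrow> 'a \<Rightarrow> complex"
  assumes e_L2: "e p \<in> L2 M"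
    and e_orthonormal: "l2_inner M (e p) (e p') = (if p = p' then 1 else 0)"
begin

lemma lin_comb_L2: "(\<lambda>x. \<Sum>p\<in>I. c p * e p x) \<in> L2 M"
  by (intro L2_sum L2_cmult e_L2)

lemma inner_lin_comb:
  "h \<in> L2 M \<Longrightarrow> l2_inner M (\<lambda>x. \<Sum>p\<in>I. c p * e p x) h = (\<Sum>p\<in>I. c p * l2_inner M (e p) h)"
  by (simp add: l2_inner_sum_left L2_cmult e_L2 l2_inner_cmult_left)

lemma inner_lin_comb_e:
  "finite I \<Longrightarrow> l2_inner M (\<lambda>x. \<Sum>p\<in>I. c p * e p x) (e k) = (if k \<in> I then c k else 0)"
  by (simp add: inner_lin_comb e_L2 e_orthonormal if_distrib[of "\<lambda>x. _ * x"] cong: if_cong)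

lemma norm_lin_comb:
  assumes "finite I"
  shows "(l2_norm M (\<lambda>x. \<Sum>p\<in>I. c p * e p x))\<^sup>2 = (\<Sum>p\<in>I. (cmod (c p))\<^sup>2)"
proof -
  let ?s = "\<lambda>x. \<Sum>p\<in>I. c p * e p x"
  have "complex_of_real ((l2_norm M ?s)\<^sup>2) = (\<Sum>p\<in>I. c p * l2_inner M (e p) ?s)"
    unfolding l2_inner_self[symmetric] by (rule inner_lin_comb[OF lin_comb_L2])
  also have "\<dots> = (\<Sum>p\<in>I. c p * cnj (c p))"
    using inner_lin_comb_e[OF assms, of c] l2_inner_cnj[of M _ ?s] by (intro sum.cong) auto
  also have "\<dots> = of_real (\<Sum>p\<in>I. (cmod (c p))\<^sup>2)"
    by (simp only: of_real_sum complex_norm_square)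
  finally show ?thesis by (simp only: of_real_eq_iff)
qed

lemma Bessel:
  assumes f: "f \<in> L2 M"
  shows "summable (\<lambda>p. (cmod (l2_inner M f (e p)))\<^sup>2)" "(\<Sum>p. (cmod (l2_inner M f (e p)))\<^sup>2) \<le> (l2_norm M f)\<^sup>2"
proof -
  let ?c = "\<lambda>p. l2_inner M f (e p)"
  have le: "(\<Sum>p<N. (cmod (?c p))\<^sup>2) \<le> (l2_norm M f)\<^sup>2" for N
  proof -
    let ?s = "\<lambda>x. \<Sum>p<N. ?c p * e p x"
    let ?S = "\<Sum>p<N. (cmod (?c p))\<^sup>2"
    have s: "?s \<in> L2 M" by (rule lin_comb_L2)
    have fs: "l2_inner M ?s f = of_real ?S"
      by (simp only: inner_lin_comb[OF f] l2_inner_cnj[of M "e _" f] of_real_sum complex_norm_square)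
    have ss: "l2_inner M ?s ?s = of_real ?S"
      unfolding l2_inner_self by (simp add: norm_lin_comb)
    have fsh: "l2_inner M f ?s = of_real ?S" using fs l2_inner_cnj[of M f ?s] by simp
    have S0: "?S \<ge> 0" by (intro sum_nonneg) auto
    have S2: "(l2_norm M ?s)\<^sup>2 = ?S" by (simp add: norm_lin_comb)
    \<comment> \<open>The inner product of \<open>f\<close> with its partial sum is the squared norm
      of that sum, so Cauchy-Schwarz bounds this norm by the norm of \<open>f\<close>.\<close>
    have "?S \<le> l2_norm M f * l2_norm M ?s"
      using l2_Cauchy_Schwarz[OF f s] unfolding fsh norm_of_real abs_of_nonneg[OF S0] .
    then have "l2_norm M ?s * l2_norm M ?s \<le> l2_norm M f * l2_norm M ?s"
      unfolding S2[symmetric] by (simp only: power2_eq_square)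
    then have "l2_norm M ?s \<le> l2_norm M f"
      using l2_norm_nonneg[of M ?s] l2_norm_nonneg[of M f]
      by (cases "l2_norm M ?s = 0") auto
    then show ?thesis unfolding S2[symmetric] using l2_norm_nonneg[of M ?s] by (intro power_mono)
  qed
  then show "summable (\<lambda>p. (cmod (?c p))\<^sup>2)"
    by (intro summableI_nonneg_bounded[of _ "(l2_norm M f)\<^sup>2"]) auto
  then show "(\<Sum>p. (cmod (?c p))\<^sup>2) \<le> (l2_norm M f)\<^sup>2"
    using le by (intro suminf_le_const) auto
qed

text \<open>Fatou's lemma turns pointwise convergence of an expansion with square-summable coefficients
  into convergence in the norm.\<close>

lemma expansion_L2:
  assumes c: "summable (\<lambda>p. (cmod (c p))\<^sup>2)" and g: "\<And>x. x \<in> space M \<Longrightarrow> (\<lambda>p. c p * e p x) sums g x"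
  shows "g \<in> L2 M"
    and "(l2_norm M (\<lambda>x. g x - (\<Sum>p<N. c p * e p x)))\<^sup>2 \<le> (\<Sum>p. (cmod (c (p + N)))\<^sup>2)"
proof -
  let ?D = "\<lambda>N x. g x - (\<Sum>p<N. c p * e p x)" and ?S = "\<lambda>N. \<Sum>p. (cmod (c (p + N)))\<^sup>2"
  have em[measurable]: "e p \<in> borel_measurable M" for p by (rule L2D(1)[OF e_L2])
  have gm[measurable]: "g \<in> borel_measurable M"
    by (rule borel_measurable_LIMSEQ_metric[where f = "\<lambda>N x. \<Sum>p<N. c p * e p x"]) (use g in \<open>auto simp: sums_def\<close>)
  have key: "(\<integral>\<^sup>+x. ennreal ((cmod (?D N x))\<^sup>2) \<partial>M) \<le> ennreal (?S N)" for N
  proof -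
    \<comment> \<open>Finite blocks starting at N: they converge pointwise to the remainder, and
      orthonormality gives their norms exactly.\<close>
    let ?T = "\<lambda>K x. \<Sum>p\<in>{N..<N + K}. c p * e p x"
    have "(\<integral>\<^sup>+x. ennreal ((cmod (?D N x))\<^sup>2) \<partial>M) = (\<integral>\<^sup>+x. liminf (\<lambda>K. ennreal ((cmod (?T K x))\<^sup>2)) \<partial>M)"
    proof (rule nn_integral_cong)
      fix x assume "x \<in> space M"
      then have "(\<lambda>K. \<Sum>p<K. c p * e p x) \<longlonglongrightarrow> g x" using g by (simp add: sums_def)
      then have "(\<lambda>K. \<Sum>p<K + N. c p * e p x) \<longlonglongrightarrow> g x" by (rule LIMSEQ_ignore_initial_segment)
      then have "(\<lambda>K. (\<Sum>p<K + N. c p * e p x) - (\<Sum>p<N. c p * e p x)) \<longlonglongrightarrow> ?D N x"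
        by (intro tendsto_intros)
      also have "(\<lambda>K. (\<Sum>p<K + N. c p * e p x) - (\<Sum>p<N. c p * e p x)) = (\<lambda>K. ?T K x)"
        by (simp add: add.commute lessThan_atLeast0 sum_diff_nat_ivl)
      finally have "(\<lambda>K. ennreal ((cmod (?T K x))\<^sup>2)) \<longlonglongrightarrow> ennreal ((cmod (?D N x))\<^sup>2)"
        by (intro tendsto_intros)
      then show "ennreal ((cmod (?D N x))\<^sup>2) = liminf (\<lambda>K. ennreal ((cmod (?T K x))\<^sup>2))"
        by (rule lim_imp_Liminf[OF trivial_limit_sequentially, symmetric])
    qed
    also have "\<dots> \<le> liminf (\<lambda>K. \<integral>\<^sup>+x. ennreal ((cmod (?T K x))\<^sup>2) \<partial>M)"
      by (rule nn_integral_liminf) measurable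
    also have "\<dots> \<le> ennreal (?S N)"
    proof (rule Liminf_le)
      show "\<forall>\<^sub>F K in sequentially. (\<integral>\<^sup>+x. ennreal ((cmod (?T K x))\<^sup>2) \<partial>M) \<le> ennreal (?S N)"
      proof (intro always_eventually allI)
        fix K
        have "(\<integral>\<^sup>+x. ennreal ((cmod (?T K x))\<^sup>2) \<partial>M) = ennreal (LINT x|M. (cmod (?T K x))\<^sup>2)"
          by (rule nn_integral_eq_integral[OF L2D(2)[OF lin_comb_L2]]) auto
        also have "(LINT x|M. (cmod (?T K x))\<^sup>2) = (l2_norm M (?T K))\<^sup>2" by (simp add: l2_norm_def)
        also have "\<dots> = (\<Sum>p\<in>{N..<N + K}. (cmod (c p))\<^sup>2)" by (rule norm_lin_comb) simp
        also have "\<dots> = (\<Sum>p<K. (cmod (c (p + N)))\<^sup>2)"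
          using sum.shift_bounds_nat_ivl[of "\<lambda>p. (cmod (c p))\<^sup>2" 0 N K] by (simp add: lessThan_atLeast0 add.commute)
        also have "ennreal \<dots> \<le> ennreal (?S N)"
          using c by (intro ennreal_leI sum_le_suminf) (auto simp: summable_iff_shift[of "\<lambda>p. (cmod (c p))\<^sup>2"])
        finally show "(\<integral>\<^sup>+x. ennreal ((cmod (?T K x))\<^sup>2) \<partial>M) \<le> ennreal (?S N)" .
      qed
    qed simp
    finally show ?thesis .
  qed
  have "integrable M (\<lambda>x. (cmod (g x))\<^sup>2)"
    using le_less_trans[OF key[of 0] ennreal_less_top] by (intro integrableI_bounded) (auto simp: gm)
  then show g2: "g \<in> L2 M" using gm by (simp add: L2_def)
  have nn: "?S N \<ge> 0"
    using c by (intro suminf_nonneg) (auto simp: summable_iff_shift[of "\<lambda>p. (cmod (c p))\<^sup>2"])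
  have eq: "ennreal ((l2_norm M (\<lambda>x. ?D N x))\<^sup>2) = (\<integral>\<^sup>+x. ennreal ((cmod (?D N x))\<^sup>2) \<partial>M)"
    using nn_integral_eq_integral[OF L2D(2)[OF L2_diff[OF g2 lin_comb_L2]]] by (simp add: l2_norm_def)
  show "(l2_norm M (\<lambda>x. ?D N x))\<^sup>2 \<le> ?S N"
    using key[of N] unfolding eq[symmetric] ennreal_le_iff[OF nn] .
qed

lemma expansion_norm_tendsto:
  assumes c: "summable (\<lambda>p. (cmod (c p))\<^sup>2)" and g: "\<And>x. x \<in> space M \<Longrightarrow> (\<lambda>p. c p * e p x) sums g x"
  shows "(\<lambda>N. l2_norm M (\<lambda>x. g x - (\<Sum>p<N. c p * e p x))) \<longlonglongrightarrow> 0"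
proof -
  have "(\<lambda>N. (l2_norm M (\<lambda>x. g x - (\<Sum>p<N. c p * e p x)))\<^sup>2) \<longlonglongrightarrow> 0"
  proof (rule tendsto_sandwich[OF _ _ tendsto_const])
    show "(\<lambda>N. \<Sum>p. (cmod (c (p + N)))\<^sup>2) \<longlonglongrightarrow> 0"
      using suminf_exist_split2[OF c] .
  qed (use expansion_L2(2)[OF c g] in auto)
  from tendsto_real_sqrt[OF this] show ?thesis by (simp add: l2_norm_nonneg)
qed

lemma expansion_coeff:
  assumes c: "summable (\<lambda>p. (cmod (c p))\<^sup>2)" and g: "\<And>x. x \<in> space M \<Longrightarrow> (\<lambda>p. c p * e p x) sums g x"
  shows "l2_inner M g (e k) = c k"
proof -
  have "(\<lambda>N. l2_inner M (\<lambda>x. \<Sum>p<N. c p * e p x) (e k)) \<longlonglongrightarrow> l2_inner M g (e k)"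
    by (rule l2_inner_tendsto[OF lin_comb_L2 expansion_L2(1)[OF c g] e_L2 expansion_norm_tendsto[OF c g]])
  moreover have "\<forall>\<^sub>F N in sequentially. l2_inner M (\<lambda>x. \<Sum>p<N. c p * e p x) (e k) = c k"
    using eventually_gt_at_top[of k] by eventually_elim (simp add: inner_lin_comb_e)
  then have "(\<lambda>N. l2_inner M (\<lambda>x. \<Sum>p<N. c p * e p x) (e k)) \<longlonglongrightarrow> c k" by (rule tendsto_eventually)
  ultimately show ?thesis by (rule LIMSEQ_unique)
qed

text \<open>One inequality is the Fatou bound with N = 0, the other is Bessel's inequality for the
  coefficients found in \<open>expansion_coeff\<close>.\<close>

lemma expansion_norm:
  assumes c: "summable (\<lambda>p. (cmod (c p))\<^sup>2)" and g: "\<And>x. x \<in> space M \<Longrightarrow> (\<lambda>p. c p * e p x) sums g x"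
  shows "(l2_norm M g)\<^sup>2 = (\<Sum>p. (cmod (c p))\<^sup>2)"
  using expansion_L2(2)[OF c g, of 0] Bessel(2)[OF expansion_L2(1)[OF c g]] expansion_coeff[OF c g]
  by simp

end

text \<open>A closed span of the family, represented by functions vanishing off the space that equal their
  expansions pointwise rather than almost everywhere.\<close>

locale l2_expansion_space = l2_orthonormal +
  fixes V :: "('a \<Rightarrow> complex) set"
  assumes V_L2: "f \<in> V \<Longrightarrow> f \<in> L2 M"
    and V_off: "f \<in> V \<Longrightarrow> x \<notin> space M \<Longrightarrow> f x = 0"
    and e_V: "e p \<in> V"
    and V_expansion: "f \<in> V \<Longrightarrow> x \<in> space M \<Longrightarrow> (\<lambda>p. l2_inner M f (e p) * e p x) sums f x"
    and expansion_summable: "summable (\<lambda>p. (cmod (c p))\<^sup>2) \<Longrightarrow> x \<in> space M \<Longrightarrow> summable (\<lambda>p. c p * e p x)"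
    and expansion_V: "summable (\<lambda>p. (cmod (c p))\<^sup>2) \<Longrightarrow> (\<lambda>x. \<Sum>p. c p * e p x) \<in> V"
begin

text \<open>The inverse of the coefficient map, an isometry from square-summable sequences onto
  \<open>V\<close>. Off the space all terms are 0, so the sum respects the normalisation of
  \<open>V\<close>.\<close>

definition synth :: "(nat \<Rightarrow> complex) \<Rightarrow> 'a \<Rightarrow> complex" where
  "synth c x = (\<Sum>p. c p * e p x)"

definition square_summable :: "(nat \<Rightarrow> complex) \<Rightarrow> bool" where
  "square_summable c \<longleftrightarrow> summable (\<lambda>p. (cmod (c p))\<^sup>2)"

lemma synth_sums: "square_summable c \<Longrightarrow> x \<in> space M \<Longrightarrow> (\<lambda>p. c p * e p x) sums synth c x"
  unfolding synth_def square_summable_def by (intro summable_sums expansion_summable)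

lemma synth_V: "square_summable c \<Longrightarrow> synth c \<in> V"
  unfolding synth_def[abs_def] square_summable_def by (rule expansion_V)

lemma inner_synth: "square_summable c \<Longrightarrow> l2_inner M (synth c) (e p) = c p"
  by (rule expansion_coeff) (auto simp: synth_sums square_summable_def)

lemma norm_synth: "square_summable c \<Longrightarrow> (l2_norm M (synth c))\<^sup>2 = (\<Sum>p. (cmod (c p))\<^sup>2)"
  by (rule expansion_norm) (auto simp: synth_sums square_summable_def)

lemma square_summable_inner: "f \<in> L2 M \<Longrightarrow> square_summable (\<lambda>p. l2_inner M f (e p))"
  unfolding square_summable_def by (rule Bessel(1))

lemma V_synth:
  assumes "f \<in> V"
  shows "f = synth (\<lambda>p. l2_inner M f (e p))"
proof
  fix x
  show "f x = synth (\<lambda>p. l2_inner M f (e p)) x"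
  proof (cases "x \<in> space M")
    case True
    then show ?thesis using V_expansion[OF assms True] by (simp add: synth_def sums_iff)
  next
    case False
    then show ?thesis using V_off[OF assms False] V_off[OF e_V False] by (simp add: synth_def)
  qed
qed

lemma V_eqI:
  "f \<in> V \<Longrightarrow> g \<in> V \<Longrightarrow> (\<And>p. l2_inner M f (e p) = l2_inner M g (e p)) \<Longrightarrow> f = g"
  using V_synth[of f] V_synth[of g] by presburger

lemma V_norm_tendsto:
  "f \<in> V \<Longrightarrow> (\<lambda>N. l2_norm M (\<lambda>x. f x - (\<Sum>p<N. l2_inner M f (e p) * e p x))) \<longlonglongrightarrow> 0"
  by (rule expansion_norm_tendsto) (auto intro: Bessel V_L2 V_expansion)

lemma orthonormal_basis_V: "orthonormal_basis M V e"
  unfolding orthonormal_basis_def using e_V e_orthonormal V_norm_tendsto by blast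

lemma orthogonal_to_V:
  assumes h: "h \<in> L2 M" and 0: "\<And>p. l2_inner M h (e p) = 0" and v: "v \<in> V"
  shows "l2_inner M h v = 0"
proof -
  let ?s = "\<lambda>N x. \<Sum>p<N. l2_inner M v (e p) * e p x"
  have "l2_inner M (e p) h = 0" for p using 0[of p] l2_inner_cnj[of M "e p" h] by simp
  then have "l2_inner M (?s N) h = 0" for N
    by (simp add: inner_lin_comb[OF h])
  moreover have "(\<lambda>N. l2_inner M (?s N) h) \<longlonglongrightarrow> l2_inner M v h"
    by (rule l2_inner_tendsto[OF lin_comb_L2 V_L2[OF v] h V_norm_tendsto[OF v]])
  ultimately have "l2_inner M v h = 0" by (simp add: LIMSEQ_const_iff)
  then show ?thesis using l2_inner_cnj[of M h v] by simp
qed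

lemma V_add: "f \<in> V \<Longrightarrow> h \<in> V \<Longrightarrow> (\<lambda>x. f x + h x) \<in> V"
proof -
  assume fh: "f \<in> V" "h \<in> V"
  let ?c = "\<lambda>p. l2_inner M f (e p) + l2_inner M h (e p)"
  have c: "square_summable ?c"
    using square_summable_inner[OF L2_add[OF V_L2[OF fh(1)] V_L2[OF fh(2)]]] fh
    by (simp add: l2_inner_add_left V_L2 e_L2)
  have "(\<lambda>x. f x + h x) = synth ?c"
  proof
    fix x show "f x + h x = synth ?c x"
    proof (cases "x \<in> space M")
      case True
      have "(\<lambda>p. ?c p * e p x) sums (f x + h x)"
        unfolding distrib_right by (intro sums_add V_expansion fh True)
      then show ?thesis by (simp add: synth_def sums_iff)
    next
      case False
      then show ?thesis using V_off[OF fh(1) False] V_off[OF fh(2) False] V_off[OF e_V False] by (simp add: synth_def)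
    qed
  qed
  then show ?thesis using synth_V[OF c] by simp
qed

lemma V_cmult: "f \<in> V \<Longrightarrow> (\<lambda>x. b * f x) \<in> V"
proof -
  assume f: "f \<in> V"
  let ?c = "\<lambda>p. b * l2_inner M f (e p)"
  have c: "square_summable ?c"
    using square_summable_inner[OF L2_cmult[OF V_L2[OF f], of b]] by (simp add: l2_inner_cmult_left)
  have "(\<lambda>x. b * f x) = synth ?c"
  proof
    fix x show "b * f x = synth ?c x"
    proof (cases "x \<in> space M")
      case True
      have "(\<lambda>p. ?c p * e p x) sums (b * f x)"
        unfolding mult.assoc by (intro sums_mult V_expansion f True)
      then show ?thesis by (simp add: synth_def sums_iff)
    next
      case False
      then show ?thesis using V_off[OF f False] V_off[OF e_V False] by (simp add: synth_def)
    qed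
  qed
  then show ?thesis using synth_V[OF c] by simp
qed

section \<open>Compression of a multiplication operator that acts diagonally on the family\<close>

context
  fixes g :: "'a \<Rightarrow> complex" and C :: real and l :: "nat \<Rightarrow> complex" and T :: "('a \<Rightarrow> complex) \<Rightarrow> 'a \<Rightarrow> complex"
  assumes g: "g \<in> borel_measurable M" and C: "AE x in M. cmod (g x) \<le> C"
    and diag: "l2_inner M (\<lambda>x. g x * e p x) (e k) = (if p = k then l p else 0)"
    and T: "T = restrict (\<lambda>f. orth_proj M V (\<lambda>x. g x * f x)) V"
begin

text \<open>The number \<open>l p\<close> is the inner product of \<open>g * e p\<close> with the
  unit vector \<open>e p\<close>, so the essential bound of \<open>g\<close> controls it.
  Multiplication by \<open>l\<close> then preserves square-summable sequences.\<close>

lemma eigenvalue_bound: "cmod (l p) \<le> C"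
proof -
  have "l p = (LINT x|M. g x * (e p x * cnj (e p x)))"
    using diag[of p p] by (simp add: l2_inner_def mult.assoc)
  also have "cmod \<dots> \<le> (LINT x|M. cmod (g x * (e p x * cnj (e p x))))"
    by (rule integral_norm_bound)
  also have "\<dots> \<le> (LINT x|M. C * (cmod (e p x))\<^sup>2)"
  proof (rule integral_mono_AE)
    have "integrable M (\<lambda>x. g x * e p x * cnj (e p x))"
      by (rule L2_mult_cnj_integrable[OF L2_bounded_mult[OF e_L2 g C] e_L2])
    then show "integrable M (\<lambda>x. cmod (g x * (e p x * cnj (e p x))))"
      by (intro integrable_norm) (simp add: mult.assoc)
    show "integrable M (\<lambda>x. C * (cmod (e p x))\<^sup>2)"
      by (intro integrable_mult_right L2D e_L2)
    show "AE x in M. cmod (g x * (e p x * cnj (e p x))) \<le> C * (cmod (e p x))\<^sup>2"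
      using C by eventually_elim (auto simp: norm_mult power2_eq_square intro!: mult_right_mono)
  qed
  also have "\<dots> = C * (l2_norm M (e p))\<^sup>2" by (simp add: l2_norm_def)
  also have "(l2_norm M (e p))\<^sup>2 = 1"
    using l2_inner_self[of M "e p"] e_orthonormal[of p p] by (simp flip: of_real_power)
  finally show ?thesis by simp
qed

lemma square_summable_mult:
  assumes c: "square_summable c"
  shows "square_summable (\<lambda>p. l p * c p)"
    and "(\<Sum>p. (cmod (l p * c p))\<^sup>2) \<le> C\<^sup>2 * (\<Sum>p. (cmod (c p))\<^sup>2)"
proof -
  have le: "(cmod (l p * c p))\<^sup>2 \<le> C\<^sup>2 * (cmod (c p))\<^sup>2" for p
    using eigenvalue_bound[of p] by (auto simp: norm_mult power_mult_distrib intro!: mult_right_mono power_mono)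
  have s: "summable (\<lambda>p. C\<^sup>2 * (cmod (c p))\<^sup>2)"
    using c unfolding square_summable_def by (rule summable_mult)
  then have s': "summable (\<lambda>p. (cmod (l p * c p))\<^sup>2)"
    by (rule summable_comparison_test'[of _ 0]) (use le in auto)
  then show "square_summable (\<lambda>p. l p * c p)" by (simp add: square_summable_def)
  have "(\<Sum>p. (cmod (l p * c p))\<^sup>2) \<le> (\<Sum>p. C\<^sup>2 * (cmod (c p))\<^sup>2)"
    by (rule suminf_le[OF le s' s])
  also have "\<dots> = C\<^sup>2 * (\<Sum>p. (cmod (c p))\<^sup>2)"
    using c unfolding square_summable_def by (rule suminf_mult)
  finally show "(\<Sum>p. (cmod (l p * c p))\<^sup>2) \<le> C\<^sup>2 * (\<Sum>p. (cmod (c p))\<^sup>2)" .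
qed

text \<open>Moving cnj g to the other argument gives an inner product of \<open>f\<close> with a
  fixed L2 function. It is continuous along the partial sums of \<open>f\<close>, on which
  \<open>diag\<close> applies termwise.\<close>

lemma inner_multiplier:
  assumes f: "f \<in> V"
  shows "l2_inner M (\<lambda>x. g x * f x) (e k) = l k * l2_inner M f (e k)"
proof -
  let ?s = "\<lambda>N. \<lambda>x. \<Sum>p<N. l2_inner M f (e p) * e p x"
  let ?h = "\<lambda>x. cnj (g x) * e k x"
  have gm: "(\<lambda>x. cnj (g x)) \<in> borel_measurable M" using g by measurable
  have h: "?h \<in> L2 M" by (rule L2_bounded_mult[OF e_L2 gm]) (use C in simp)
  have move: "l2_inner M (\<lambda>x. g x * f x) (e k) = l2_inner M f ?h" for f
    by (simp add: l2_inner_def mult_ac)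
  have "(\<lambda>N. l2_inner M (?s N) ?h) \<longlonglongrightarrow> l2_inner M f ?h"
    by (rule l2_inner_tendsto[OF lin_comb_L2 V_L2[OF f] h V_norm_tendsto[OF f]])
  moreover have "\<forall>\<^sub>F N in sequentially. l2_inner M (?s N) ?h = l k * l2_inner M f (e k)"
    using eventually_gt_at_top[of k]
  proof eventually_elim
    case (elim N)
    have "l2_inner M (?s N) ?h = (\<Sum>p<N. l2_inner M f (e p) * (if p = k then l p else 0))"
      by (simp add: inner_lin_comb[OF h] diag flip: move)
    also have "\<dots> = l k * l2_inner M f (e k)"
      using elim by (simp add: if_distrib[of "\<lambda>x. _ * x"] cong: if_cong)
    finally show ?case .
  qed
  then have "(\<lambda>N. l2_inner M (?s N) ?h) \<longlonglongrightarrow> l k * l2_inner M f (e k)"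
    by (rule tendsto_eventually)
  ultimately have "l2_inner M f ?h = l k * l2_inner M f (e k)" by (rule LIMSEQ_unique)
  then show ?thesis by (simp add: move)
qed

text \<open>The series with coefficients \<open>l p * c p\<close> lies in \<open>V\<close> and has
  the right inner products with all \<open>e p\<close>, so it satisfies the defining property of the
  projection; any other candidate has the same coefficients and is equal to it by
  \<open>V_eqI\<close>.\<close>

lemma multiplier_compression:
  assumes f: "f \<in> V"
  shows "T f = synth (\<lambda>p. l p * l2_inner M f (e p))"
proof -
  define c where "c p = l2_inner M f (e p)" for p
  let ?u = "synth (\<lambda>p. l p * c p)"
  have c: "square_summable c" unfolding c_def by (rule square_summable_inner[OF V_L2[OF f]])
  note lc = square_summable_mult(1)[OF c]
  have gf: "(\<lambda>x. g x * f x) \<in> L2 M" by (rule L2_bounded_mult[OF V_L2[OF f] g C])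
  have u: "?u \<in> V" by (rule synth_V[OF lc])
  have "orth_proj M V (\<lambda>x. g x * f x) = ?u"
    unfolding orth_proj_def
  proof (rule the_equality)
    show "?u \<in> V \<and> (\<forall>v\<in>V. l2_inner M (\<lambda>x. g x * f x - ?u x) v = 0)"
    proof (intro conjI ballI u)
      fix v assume v: "v \<in> V"
      have 0: "l2_inner M (\<lambda>x. g x * f x - ?u x) (e p) = 0" for p
        unfolding l2_inner_diff_left[OF gf V_L2[OF u] e_L2] inner_multiplier[OF f] inner_synth[OF lc] by (simp add: c_def)
      show "l2_inner M (\<lambda>x. g x * f x - ?u x) v = 0"
        by (rule orthogonal_to_V[OF L2_diff[OF gf V_L2[OF u]] 0 v])
    qed
  next
    fix w assume w: "w \<in> V \<and> (\<forall>v\<in>V. l2_inner M (\<lambda>x. g x * f x - w x) v = 0)"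
    have wV: "w \<in> V" using w by blast
    show "w = ?u"
    proof (rule V_eqI[OF wV u])
      fix p
      have "l2_inner M (\<lambda>x. g x * f x - w x) (e p) = 0" using w e_V by blast
      then show "l2_inner M w (e p) = l2_inner M ?u (e p)"
        unfolding l2_inner_diff_left[OF gf V_L2[OF wV] e_L2] inner_multiplier[OF f] inner_synth[OF lc] by (simp add: c_def)
    qed
  qed
  then show ?thesis using f by (simp add: T c_def)
qed

lemma compression_diagonal: "diagonal_with_eigenvalues T e l"
  unfolding diagonal_with_eigenvalues_def
proof (intro allI ext)
  fix p x
  have "T (e p) x = (\<Sum>k. l k * l2_inner M (e p) (e k) * e k x)"
    unfolding multiplier_compression[OF e_V] synth_def ..
  also have "\<dots> = (\<Sum>k\<in>{p}. l k * l2_inner M (e p) (e k) * e k x)"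
    by (rule suminf_finite) (auto simp: e_orthonormal)
  finally show "T (e p) x = l p * e p x" by (simp add: e_orthonormal)
qed

lemma compression_V: "f \<in> V \<Longrightarrow> T f \<in> V"
  unfolding multiplier_compression
  by (intro synth_V square_summable_mult square_summable_inner V_L2)

lemma inner_compression: "f \<in> V \<Longrightarrow> l2_inner M (T f) (e p) = l p * l2_inner M f (e p)"
  unfolding multiplier_compression
  by (intro inner_synth square_summable_mult square_summable_inner V_L2)

text \<open>Linearity is read off the coefficients through \<open>V_eqI\<close>; the operator bound
  C comes from Parseval's identity \<open>norm_synth\<close>.\<close>

lemma compression_bounded: "T \<in> bounded_operators M V"
  unfolding bounded_operators_def
proof (intro CollectI conjI ballI allI)
  show "T \<in> V \<rightarrow>\<^sub>E V"
    using compression_V T by (auto simp: PiE_def extensional_def)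
  show "T (\<lambda>x. f x + h x) = (\<lambda>x. T f x + T h x)" if "f \<in> V" "h \<in> V" for f h
    using that
    by (intro V_eqI compression_V V_add)
       (simp_all add: inner_compression V_add l2_inner_add_left V_L2 compression_V e_L2 distrib_left)
  show "T (\<lambda>x. b * f x) = (\<lambda>x. b * T f x)" if "f \<in> V" for b f
    using that
    by (intro V_eqI compression_V V_cmult)
       (simp_all add: inner_compression V_cmult l2_inner_cmult_left)
  show "\<exists>K. \<forall>f\<in>V. l2_norm M (T f) \<le> K * l2_norm M f"
  proof (intro exI ballI)
    fix f assume f: "f \<in> V"
    let ?c = "\<lambda>p. l2_inner M f (e p)"
    have c: "square_summable ?c" by (rule square_summable_inner[OF V_L2[OF f]])
    have "C \<ge> 0" using eigenvalue_bound[of 0] norm_ge_zero order_trans by blast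
    have "(l2_norm M (T f))\<^sup>2 \<le> C\<^sup>2 * (l2_norm M (synth ?c))\<^sup>2"
      unfolding multiplier_compression[OF f] norm_synth[OF square_summable_mult(1)[OF c]] norm_synth[OF c]
      by (rule square_summable_mult(2)[OF c])
    also have "synth ?c = f" by (rule V_synth[OF f, symmetric])
    finally have "(l2_norm M (T f))\<^sup>2 \<le> (C * l2_norm M f)\<^sup>2" by (simp add: power_mult_distrib)
    then show "l2_norm M (T f) \<le> C * l2_norm M f"
      by (rule power2_le_imp_le) (simp add: \<open>C \<ge> 0\<close> l2_norm_nonneg)
  qed
qed

end

end

subsection \<open>Integrals of disk polynomials\<close>

text \<open>The function \<open>sqrt\<close> is odd on the whole line, so a preimage is covered by
  the images of N under x^2 and -x^2; differentiable maps send negligible sets to negligible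
  sets.\<close>

lemma null_sets_sqrt_vimage:
  assumes "N \<in> null_sets lborel"
  shows "sqrt -` N \<in> null_sets lebesgue"
proof -
  have "negligible N" using assms by (simp add: negligible_iff_null_sets null_sets_completionI)
  then have "negligible ((\<lambda>x. x * x) ` N)" "negligible ((\<lambda>x. - (x * x)) ` N)"
    by (auto intro!: negligible_differentiable_image_negligible derivative_intros simp: differentiable_on_def)
  then have "negligible ((\<lambda>x. x * x) ` N \<union> (\<lambda>x. - (x * x)) ` N)" by (rule negligible_Un)
  moreover have "sqrt -` N \<subseteq> (\<lambda>x. x * x) ` N \<union> (\<lambda>x. - (x * x)) ` N"
  proof
    fix t assume t: "t \<in> sqrt -` N"
    show "t \<in> (\<lambda>x. x * x) ` N \<union> (\<lambda>x. - (x * x)) ` N"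
    proof (cases "t \<ge> 0")
      case True
      then have "t = sqrt t * sqrt t" by simp
      then show ?thesis using t by blast
    next
      case False
      then have "t = - (sqrt t * sqrt t)" using real_sqrt_mult_self[of t] by simp
      then show ?thesis using t by blast
    qed
  qed
  ultimately have "negligible (sqrt -` N)" by (rule negligible_subset)
  then show ?thesis by (simp add: negligible_iff_null_sets)
qed

lemma Linfty_sqrt:
  assumes "a \<in> Linfty (lebesgue_on {0..<1})"
  shows "(\<lambda>t. a (sqrt t)) \<in> borel_measurable (lebesgue_on {0..<1})"
    and "\<exists>C. AE t in lebesgue. t \<in> {0..<1} \<longrightarrow> cmod (a (sqrt t)) \<le> C"
proof -
  have a: "a \<in> borel_measurable (lebesgue_on {0..<1})"
    using assms by (simp add: Linfty_def)
  note s = nonsingular_lebesgue[of sqrt, OF borel_measurable_sqrt null_sets_sqrt_vimage]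
  have "sqrt \<in> lebesgue_on {0..<1} \<rightarrow>\<^sub>M lebesgue_on {0..<1}"
    using s(1) by (auto intro!: measurable_restrict_space3)
  from measurable_compose[OF this a] show "(\<lambda>t. a (sqrt t)) \<in> borel_measurable (lebesgue_on {0..<1})" .
  obtain C where "AE x in lebesgue_on {0..<1}. cmod (a x) \<le> C"
    using assms by (auto simp: Linfty_def)
  then have "AE x in lebesgue. x \<in> {0..<1} \<longrightarrow> cmod (a x) \<le> C"
    by (subst (asm) AE_restrict_space_iff) auto
  from s(2)[OF _ this] have "AE t in lebesgue. sqrt t \<in> {0..<1} \<longrightarrow> cmod (a (sqrt t)) \<le> C" by simp
  then have "AE t in lebesgue. t \<in> {0..<1} \<longrightarrow> cmod (a (sqrt t)) \<le> C"
    by (elim eventually_mono) auto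
  then show "\<exists>C. AE t in lebesgue. t \<in> {0..<1} \<longrightarrow> cmod (a (sqrt t)) \<le> C" by blast
qed

lemma radial_ext_mu:
  assumes "a \<in> Linfty (lebesgue_on {0..<1})"
  shows "radial_ext a \<in> borel_measurable (mu \<alpha>)"
    and "\<exists>C. AE z in mu \<alpha>. cmod (radial_ext a z) \<le> C"
proof -
  have eq: "radial_ext a = (\<lambda>z. (\<lambda>t. a (sqrt t)) ((cmod z)\<^sup>2))"
    by (simp add: radial_ext_def fun_eq_iff)
  show "radial_ext a \<in> borel_measurable (mu \<alpha>)"
    unfolding eq by (rule measurable_compose[OF measurable_mu_cmod_squared Linfty_sqrt(1)[OF assms]])
  obtain C where C: "AE t in lebesgue. t \<in> {0..<1} \<longrightarrow> cmod (a (sqrt t)) \<le> C"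
    using Linfty_sqrt(2)[OF assms] by blast
  have "AE z in lebesgue. (cmod z)\<^sup>2 \<in> {0..<1} \<longrightarrow> cmod (a (sqrt ((cmod z)\<^sup>2))) \<le> C"
    by (rule nonsingular_cmod_squared(2)[OF C])
  then have "AE z in lebesgue_on unit_disk. cmod (radial_ext a z) \<le> C"
    by (subst AE_restrict_space_iff) (auto simp: eq power_less_one_iff abs_square_less_1 elim!: eventually_mono)
  moreover have "(\<lambda>z. ennreal ((\<alpha> + 1) / pi * (1 - (cmod z)\<^sup>2) powr \<alpha>)) \<in> borel_measurable (lebesgue_on unit_disk)"
    by (rule measurable_restrict_space1[OF measurable_disk_weight])
  ultimately have "AE z in mu \<alpha>. cmod (radial_ext a z) \<le> C"
    unfolding mu_def by (subst AE_density) auto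
  then show "\<exists>C. AE z in mu \<alpha>. cmod (radial_ext a z) \<le> C" by blast
qed

lemma set_integrable_of_real:
  fixes f :: "'a \<Rightarrow> real"
  assumes "set_integrable M A f"
  shows "set_integrable M A (\<lambda>x. of_real (f x) :: complex)"
proof -
  have "integrable M (\<lambda>x. of_real (indicator A x *\<^sub>R f x) :: complex)"
    using assms unfolding set_integrable_def by (rule integrable_of_real)
  then show ?thesis by (simp add: set_integrable_def scaleR_conv_of_real)
qed

text \<open>The constant 1 is radial, and \<alpha> > -1 makes its one-dimensional integral a
  convergent Beta integral.\<close>

lemma finite_measure_mu:
  assumes \<alpha>: "\<alpha> > -1"
  shows "finite_measure (mu \<alpha>)"
proof -
  have "((\<lambda>t. t powr (1 - 1) * (1 - t) powr (\<alpha> + 1 - 1)) has_integral Beta 1 (\<alpha> + 1)) {0..1}"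
    by (rule has_integral_Beta_real) (use \<alpha> in auto)
  then have "((\<lambda>t. t powr (1 - 1) * (1 - t) powr (\<alpha> + 1 - 1)) has_integral Beta 1 (\<alpha> + 1)) {0<..<1}"
    by (simp add: has_integral_Icc_iff_Ioo)
  from has_integral_mult_right[OF this, of "\<alpha> + 1"]
  have "((\<lambda>t. (\<alpha> + 1) * (1 - t) powr \<alpha>) has_integral (\<alpha> + 1) * Beta 1 (\<alpha> + 1)) {0<..<1}"
    by (rule has_integral_cong[THEN iffD1, rotated]) auto
  then have "(\<lambda>t. (\<alpha> + 1) * (1 - t) powr \<alpha>) absolutely_integrable_on {0<..<1}"
    using \<alpha> by (intro nonnegative_absolutely_integrable_1) (auto simp: integrable_on_def)
  from set_integrable_of_real[OF this]
  have "integrable (mu \<alpha>) (\<lambda>z. 1 :: complex)"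
    by (subst radial_integral_mu(1)[OF \<alpha>, of "\<lambda>_. 1"]) simp_all
  then show ?thesis by (intro finite_measureI) (auto simp: integrable_iff_bounded)
qed

section \<open>Measurability, bounds and inner products of disk polynomials\<close>

lemma continuous_on_disk_measurable:
  assumes "continuous_on unit_disk f"
  shows "f \<in> borel_measurable (mu \<alpha>)"
proof -
  have "f \<in> borel_measurable (lebesgue_on unit_disk)"
    using assms by (intro continuous_imp_measurable_on_sets_lebesgue) auto
  then show ?thesis using measurable_cong_sets[OF sets_mu refl] by blast
qed

lemma integrable_mu_bounded:
  fixes f :: "complex \<Rightarrow> 'b::{banach, second_countable_topology}"
  assumes "\<alpha> > -1" "f \<in> borel_measurable (mu \<alpha>)" "AE z in mu \<alpha>. norm (f z) \<le> C"
  shows "integrable (mu \<alpha>) f"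
  using finite_measure.integrable_const_bound[OF finite_measure_mu[OF assms(1)] assms(3,2)] .

lemma norm_monomial_le_1: "z \<in> unit_disk \<Longrightarrow> cmod (z ^ k * cnj z ^ l) \<le> 1"
  by (simp add: norm_mult norm_power mult_le_one power_le_one)

lemma disk_poly_bounded:
  assumes \<alpha>: "\<alpha> > -1"
  shows "cmod (disk_poly \<alpha> p q z) \<le> (\<Sum>j\<le>min p q. \<bar>disk_poly_monomial_coeff \<alpha> p q j\<bar>)"
proof (cases "z \<in> unit_disk")
  case True
  show ?thesis unfolding disk_poly_monomials[OF \<alpha> True]
    by (intro sum_norm_le) (use norm_monomial_le_1[OF True] in \<open>simp add: norm_mult mult_left_le\<close>)
next
  case False
  then show ?thesis by (simp add: disk_poly_def sum_nonneg)
qed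

lemma disk_poly_measurable:
  assumes \<alpha>: "\<alpha> > -1"
  shows "disk_poly \<alpha> p q \<in> borel_measurable (mu \<alpha>)"
proof (rule continuous_on_disk_measurable)
  have "continuous_on unit_disk (\<lambda>z. \<Sum>j\<le>min p q. of_real (disk_poly_monomial_coeff \<alpha> p q j) * (z ^ (p - j) * cnj z ^ (q - j)))"
    by (intro continuous_intros)
  then show "continuous_on unit_disk (disk_poly \<alpha> p q)"
    by (rule continuous_on_cong[THEN iffD1, rotated -1]) (auto simp: disk_poly_monomials[OF \<alpha>])
qed

text \<open>Both factors have the same rotation character, so the product is a function of t =
  |z|^2: the weight t^b, the Jacobi polynomial of degree m, and t^(m-j), a lower power because j
  \<ge> 1.\<close>

lemma disk_poly_monomial_orthogonal:
  assumes \<alpha>: "\<alpha> > -1" and j: "1 \<le> j" "j \<le> min p q"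
  shows "(LINT z|mu \<alpha>. disk_poly \<alpha> p q z * cnj (z ^ (p - j) * cnj z ^ (q - j))) = 0"
proof -
  define m where "m = min p q"
  define b where "b = max p q - m"
  let ?P = "jacobi_poly m \<alpha> (real b)"
  let ?F = "\<lambda>t. of_real (jacobi_scale \<alpha> p q * poly ?P t * t ^ (b + (m - j))) :: complex"
  have jm: "j \<le> m" using j by (simp add: m_def)
  have eq: "disk_poly \<alpha> p q z * cnj (z ^ (p - j) * cnj z ^ (q - j)) = ?F ((cmod z)\<^sup>2)" if "z \<in> unit_disk" for z
  proof -
    \<comment> \<open>One of p - m and q - m is 0 and the other is b, so z and cnj z have the same
      total exponent in the product.\<close>
    have "p - m + (q - j) = b + (m - j)" "q - m + (p - j) = b + (m - j)"
      using j unfolding m_def b_def by auto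
    then have "of_real (((cmod z)\<^sup>2) ^ (b + (m - j))) = (z ^ (p - m) * cnj z ^ (q - m)) * cnj (z ^ (p - j) * cnj z ^ (q - j))"
      unfolding of_real_cmod_squared_power by (simp add: mult_ac flip: power_add) (simp add: mult_ac add_ac flip: power_add)
    then show ?thesis
      unfolding disk_poly_jacobi[OF \<alpha> that] m_def[symmetric] b_def[symmetric]
      by (simp add: mult_ac)
  qed
  have "continuous_on {0..<1} ?F" by (intro continuous_intros)
  then have Fm: "?F \<in> borel_measurable (lebesgue_on {0..<1})"
    by (intro continuous_imp_measurable_on_sets_lebesgue) auto
  have bd: "cmod (?F ((cmod z)\<^sup>2)) \<le> (\<Sum>j\<le>min p q. \<bar>disk_poly_monomial_coeff \<alpha> p q j\<bar>) * 1" if "z \<in> unit_disk" for z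
    unfolding eq[OF that, symmetric] norm_mult complex_mod_cnj
    using disk_poly_bounded[OF \<alpha>, of p q z] norm_monomial_le_1[OF that, of "p - j" "q - j"]
    by (intro mult_mono) (auto simp: norm_mult intro: order_trans[OF norm_ge_zero])
  have "(\<lambda>z. ?F ((cmod z)\<^sup>2)) \<in> borel_measurable (mu \<alpha>)"
    by (rule measurable_compose[OF measurable_mu_cmod_squared Fm])
  then have "integrable (mu \<alpha>) (\<lambda>z. ?F ((cmod z)\<^sup>2))"
    by (rule integrable_mu_bounded[OF \<alpha>]) (use bd in \<open>auto intro!: AE_I2\<close>)
  then have si: "set_integrable lebesgue {0<..<1} (\<lambda>t. of_real ((\<alpha> + 1) * (1 - t) powr \<alpha>) * ?F t)"
    by (simp only: radial_integral_mu(1)[OF \<alpha> Fm])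
  have "((\<lambda>t. (1 - t) powr \<alpha> * t powr real b * t ^ (m - j) * poly ?P t) has_integral 0) {0<..<1}"
    using has_integral_monomial_jacobi[of \<alpha> "real b" "m - j" m] \<alpha> j jm by auto
  from has_integral_of_real[OF has_integral_mult_right[OF this, of "(\<alpha> + 1) * jacobi_scale \<alpha> p q"]]
  have "((\<lambda>t. of_real ((\<alpha> + 1) * jacobi_scale \<alpha> p q * ((1 - t) powr \<alpha> * t powr real b * t ^ (m - j) * poly ?P t)) :: complex)
      has_integral 0) {0<..<1}" by simp
  then have hi: "((\<lambda>t. of_real ((\<alpha> + 1) * (1 - t) powr \<alpha>) * ?F t) has_integral 0) {0<..<1}"
    by (rule has_integral_cong[THEN iffD1, rotated]) (simp add: powr_realpow power_add mult_ac)
  have "(LINT z|mu \<alpha>. disk_poly \<alpha> p q z * cnj (z ^ (p - j) * cnj z ^ (q - j))) = (LINT z|mu \<alpha>. ?F ((cmod z)\<^sup>2))"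
    by (intro Bochner_Integration.integral_cong eq) auto
  also have "\<dots> = integral {0<..<1} (\<lambda>t. of_real ((\<alpha> + 1) * (1 - t) powr \<alpha>) * ?F t)"
    unfolding radial_integral_mu(2)[OF \<alpha> Fm] by (rule set_lebesgue_integral_eq_integral(2)[OF si])
  also have "\<dots> = 0" using hi by (rule integral_unique)
  finally show ?thesis .
qed

text \<open>The integrand is a(|z|) |b|^2 for the disk polynomial b, hence radial, and
  \<open>jacobi_fun_disk_poly\<close> identifies it after the substitution. Integrability follows
  from boundedness on a finite measure space.\<close>

lemma disk_poly_eigenvalue:
  assumes \<alpha>: "\<alpha> > -1" and a: "a \<in> Linfty (lebesgue_on {0..<1})"
  shows "set_integrable lebesgue {0<..<1} (\<lambda>t. a (sqrt t) * of_real ((jacobi_fun (min p q) \<alpha> \<bar>real p - real q\<bar> t)\<^sup>2))"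
    and "l2_inner (mu \<alpha>) (\<lambda>z. radial_ext a z * disk_poly \<alpha> p q z) (disk_poly \<alpha> p q) =
      (LINT t:{0<..<1}|lebesgue. a (sqrt t) * of_real ((jacobi_fun (min p q) \<alpha> \<bar>real p - real q\<bar> t)\<^sup>2))"
proof -
  let ?J = "\<lambda>t. a (sqrt t) * of_real ((jacobi_fun (min p q) \<alpha> \<bar>real p - real q\<bar> t)\<^sup>2)"
  let ?G = "\<lambda>t. (jacobi_scale \<alpha> p q)\<^sup>2 * t ^ (max p q - min p q) * (poly (radial_part \<alpha> p q) t)\<^sup>2"
  let ?F = "\<lambda>t. a (sqrt t) * of_real (?G t)"
  have "continuous_on {0..<1} (\<lambda>t. of_real (?G t) :: complex)" by (intro continuous_intros)
  then have "(\<lambda>t. of_real (?G t) :: complex) \<in> borel_measurable (lebesgue_on {0..<1})"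
    by (intro continuous_imp_measurable_on_sets_lebesgue) auto
  then have Fm: "?F \<in> borel_measurable (lebesgue_on {0..<1})"
    by (intro borel_measurable_times Linfty_sqrt(1)[OF a])
  have eq: "radial_ext a z * disk_poly \<alpha> p q z * cnj (disk_poly \<alpha> p q z) = ?F ((cmod z)\<^sup>2)" if "z \<in> unit_disk" for z
    using norm_disk_poly_squared[OF \<alpha> that, of p q]
    by (simp add: radial_ext_def mult.assoc flip: complex_norm_square)
  obtain C where C: "AE z in mu \<alpha>. cmod (radial_ext a z) \<le> C" using radial_ext_mu(2)[OF a] by blast
  define B where "B = (\<Sum>j\<le>min p q. \<bar>disk_poly_monomial_coeff \<alpha> p q j\<bar>)"
  have B: "cmod (disk_poly \<alpha> p q z) \<le> B" for z unfolding B_def by (rule disk_poly_bounded[OF \<alpha>])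
  have "AE z in mu \<alpha>. cmod (?F ((cmod z)\<^sup>2)) \<le> C * B * B"
    using C
  proof (rule AE_mp, intro AE_I2 impI)
    fix z assume z: "z \<in> space (mu \<alpha>)" and c: "cmod (radial_ext a z) \<le> C"
    have "C \<ge> 0" using c norm_ge_zero order_trans by blast
    moreover have "B \<ge> 0" using B[of z] norm_ge_zero order_trans by blast
    ultimately show "cmod (?F ((cmod z)\<^sup>2)) \<le> C * B * B"
      using z c B[of z] by (subst eq[symmetric]) (auto simp: norm_mult intro!: mult_mono)
  qed
  moreover have "(\<lambda>z. ?F ((cmod z)\<^sup>2)) \<in> borel_measurable (mu \<alpha>)"
    by (rule measurable_compose[OF measurable_mu_cmod_squared Fm])
  ultimately have int: "integrable (mu \<alpha>) (\<lambda>z. ?F ((cmod z)\<^sup>2))"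
    by (intro integrable_mu_bounded[OF \<alpha>])
  have J: "of_real ((\<alpha> + 1) * (1 - t) powr \<alpha>) * ?F t = ?J t"
    if "t \<in> {0<..<1}" for t
  proof -
    have "0 < t" "t < 1" using that by auto
    show ?thesis unfolding jacobi_fun_disk_poly[OF \<alpha> \<open>0 < t\<close> \<open>t < 1\<close>] by (simp add: mult_ac)
  qed
  show "set_integrable lebesgue {0<..<1} ?J"
    using int unfolding radial_integral_mu(1)[OF \<alpha> Fm]
    by (subst (asm) set_integrable_cong[OF refl refl J]) auto
  have "l2_inner (mu \<alpha>) (\<lambda>z. radial_ext a z * disk_poly \<alpha> p q z) (disk_poly \<alpha> p q) = (LINT z|mu \<alpha>. ?F ((cmod z)\<^sup>2))"
    unfolding l2_inner_def by (intro Bochner_Integration.integral_cong eq) auto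
  also have "\<dots> = (LINT t:{0<..<1}|lebesgue. ?J t)"
    unfolding radial_integral_mu(2)[OF \<alpha> Fm] by (intro set_lebesgue_integral_cong) (use J in auto)
  finally show "l2_inner (mu \<alpha>) (\<lambda>z. radial_ext a z * disk_poly \<alpha> p q z) (disk_poly \<alpha> p q) =
      (LINT t:{0<..<1}|lebesgue. ?J t)" .
qed

lemma disk_poly_normalized:
  assumes \<alpha>: "\<alpha> > -1"
  shows "l2_inner (mu \<alpha>) (disk_poly \<alpha> p q) (disk_poly \<alpha> p q) = 1"
proof -
  let ?J = "\<lambda>t. (jacobi_fun (min p q) \<alpha> \<bar>real p - real q\<bar> t)\<^sup>2"
  \<comment> \<open>For the symbol 1 the eigenvalue integral is the squared norm.\<close>
  have 1: "(\<lambda>_. 1) \<in> Linfty (lebesgue_on {0..<1::real})" by (auto simp: Linfty_def)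
  note e = disk_poly_eigenvalue[OF \<alpha> 1, of p q]
  have "l2_inner (mu \<alpha>) (disk_poly \<alpha> p q) (disk_poly \<alpha> p q) = (LINT t:{0<..<1}|lebesgue. of_real (?J t))"
    using e(2) by (simp add: radial_ext_def)
  also have "\<dots> = integral {0<..<1} (\<lambda>t. of_real (?J t))"
    using e(1) by (intro set_lebesgue_integral_eq_integral(2)) simp
  also have "\<dots> = 1"
    using has_integral_of_real[OF has_integral_jacobi_fun_squared[OF \<alpha>, of "\<bar>real p - real q\<bar>" "min p q"], where 'b = complex]
    by (intro integral_unique) simp
  finally show ?thesis .
qed

subsection \<open>Angular modes\<close>

text \<open>The angle \<pi> / (p - p') turns the quotient of the two characters into -1.\<close>

lemma exists_separating_rotation:
  assumes "p \<noteq> (p' :: nat)"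
  shows "\<exists>\<tau>. cmod \<tau> = 1 \<and> \<tau> ^ p * cnj \<tau> ^ p' \<noteq> 1"
proof -
  define t where "t = pi / (real p - real p')"
  have "cis t ^ p * cnj (cis t) ^ p' = cis (real p * t - real p' * t)"
    unfolding cis_cnj Complex.DeMoivre cis_mult by simp
  also have "real p * t - real p' * t = pi"
    unfolding left_diff_distrib[symmetric] using assms by (simp add: t_def)
  finally show ?thesis by (intro exI[of _ "cis t"]) simp
qed

text \<open>The character \<tau>^(p-q), written with two natural exponents to avoid integer powers.
  Since q is fixed throughout, p alone labels the characters.\<close>

definition angular_mode :: "nat \<Rightarrow> nat \<Rightarrow> (complex \<Rightarrow> complex) \<Rightarrow> bool" where
  "angular_mode p q F \<longleftrightarrow> (\<forall>\<tau>. cmod \<tau> = 1 \<longrightarrow> (\<forall>z\<in>unit_disk. F (\<tau> * z) = \<tau> ^ p * cnj \<tau> ^ q * F z))"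

lemma unimodular_mult_cnj: "cmod \<tau> = 1 \<Longrightarrow> \<tau> ^ k * cnj \<tau> ^ k = 1"
  by (simp flip: power_mult_distrib complex_norm_square)

lemma angular_mode_monomial:
  assumes "j \<le> p" "j \<le> q"
  shows "angular_mode p q (\<lambda>z. z ^ (p - j) * cnj z ^ (q - j))"
  unfolding angular_mode_def
proof (intro allI impI ballI)
  fix \<tau> z :: complex assume \<tau>: "cmod \<tau> = 1"
  have "\<tau> ^ p * cnj \<tau> ^ q = (\<tau> ^ j * cnj \<tau> ^ j) * (\<tau> ^ (p - j) * cnj \<tau> ^ (q - j))"
  proof -
    have "p = j + (p - j)" "q = j + (q - j)" using assms by auto
    then have "\<tau> ^ p * cnj \<tau> ^ q = \<tau> ^ (j + (p - j)) * cnj \<tau> ^ (j + (q - j))" by metis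
    then show ?thesis by (simp only: power_add mult_ac)
  qed
  then have "\<tau> ^ p * cnj \<tau> ^ q = \<tau> ^ (p - j) * cnj \<tau> ^ (q - j)"
    by (simp add: unimodular_mult_cnj[OF \<tau>])
  then show "(\<tau> * z) ^ (p - j) * cnj (\<tau> * z) ^ (q - j) = \<tau> ^ p * cnj \<tau> ^ q * (z ^ (p - j) * cnj z ^ (q - j))"
    by (simp add: power_mult_distrib)
qed

lemma angular_mode_sum:
  "(\<And>j. j \<in> I \<Longrightarrow> angular_mode p q (F j)) \<Longrightarrow> angular_mode p q (\<lambda>z. \<Sum>j\<in>I. c j * F j z)"
  by (auto simp: angular_mode_def sum_distrib_left mult_ac intro!: sum.cong)

lemma angular_mode_disk_poly:
  assumes \<alpha>: "\<alpha> > -1"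
  shows "angular_mode p q (disk_poly \<alpha> p q)"
proof -
  have "angular_mode p q (\<lambda>z. \<Sum>j\<in>{..min p q}. of_real (disk_poly_monomial_coeff \<alpha> p q j) * (z ^ (p - j) * cnj z ^ (q - j)))"
    by (intro angular_mode_sum angular_mode_monomial) auto
  then show ?thesis
    unfolding angular_mode_def by (auto simp: disk_poly_monomials[OF \<alpha>] norm_mult)
qed

text \<open>A suitable rotation preserves the integral and also multiplies it by a number different
  from 1. The factor \<open>R\<close> stands both for a radial symbol and for the cut-off to a
  smaller disk.\<close>

lemma angular_mode_orthogonal:
  assumes F: "angular_mode p q F" and G: "angular_mode p' q G" and pp': "p \<noteq> p'"
    and R: "\<And>\<tau> z. cmod \<tau> = 1 \<Longrightarrow> R (\<tau> * z) = R z"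
    and meas: "(\<lambda>z. R z * F z * cnj (G z)) \<in> borel_measurable (mu \<alpha>)"
  shows "(LINT z|mu \<alpha>. R z * F z * cnj (G z)) = 0"
proof -
  obtain \<tau> where \<tau>: "cmod \<tau> = 1" and ne: "\<tau> ^ p * cnj \<tau> ^ p' \<noteq> 1"
    using exists_separating_rotation[OF pp'] by blast
  let ?I = "LINT z|mu \<alpha>. R z * F z * cnj (G z)"
  have "?I = (LINT z|mu \<alpha>. R (\<tau> * z) * F (\<tau> * z) * cnj (G (\<tau> * z)))"
    by (rule integral_mu_rotation[OF \<tau> meas, symmetric])
  also have "\<dots> = (LINT z|mu \<alpha>. (\<tau> ^ p * cnj \<tau> ^ p') * (R z * F z * cnj (G z)))"
  proof (rule Bochner_Integration.integral_cong[OF refl])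
    fix z assume "z \<in> space (mu \<alpha>)"
    then have "R (\<tau> * z) * F (\<tau> * z) * cnj (G (\<tau> * z)) = R z * (\<tau> ^ p * cnj \<tau> ^ q * F z) * cnj (\<tau> ^ p' * cnj \<tau> ^ q * G z)"
      using R[OF \<tau>] F G \<tau> by (auto simp: angular_mode_def)
    also have "\<dots> = (\<tau> ^ q * cnj \<tau> ^ q) * (\<tau> ^ p * cnj \<tau> ^ p') * (R z * F z * cnj (G z))"
      by (simp add: mult_ac)
    finally show "R (\<tau> * z) * F (\<tau> * z) * cnj (G (\<tau> * z)) = (\<tau> ^ p * cnj \<tau> ^ p') * (R z * F z * cnj (G z))"
      by (simp add: unimodular_mult_cnj[OF \<tau>])
  qed
  also have "\<dots> = (\<tau> ^ p * cnj \<tau> ^ p') * ?I" by simp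
  finally show ?thesis using ne by simp
qed

text \<open>The general element of the p-th mode among (q+1)-analytic functions, spanned by the
  monomials of the disk polynomial with indices p and q.\<close>

definition mode_part :: "(nat \<Rightarrow> nat \<Rightarrow> complex) \<Rightarrow> nat \<Rightarrow> nat \<Rightarrow> complex \<Rightarrow> complex" where
  "mode_part H q p z = (\<Sum>j\<le>min p q. H p j * (z ^ (p - j) * cnj z ^ (q - j)))"

lemma angular_mode_part: "angular_mode p q (mode_part H q p)"
  unfolding mode_part_def by (intro angular_mode_sum angular_mode_monomial) auto

lemma continuous_mode_part: "continuous_on S (mode_part H q p)"
  unfolding mode_part_def by (intro continuous_intros)

lemma norm_mode_part_le:
  assumes "cmod z \<le> r" "r \<le> 1"
  shows "cmod (mode_part H q p z) \<le> (\<Sum>j\<le>min p q. cmod (H p j) * r ^ (p - j))"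
  unfolding mode_part_def
proof (intro sum_norm_le)
  fix j
  have "cmod z ^ (p - j) * cmod z ^ (q - j) \<le> r ^ (p - j) * 1"
    using assms order_trans[OF norm_ge_zero assms(1)] by (intro mult_mono power_mono power_le_one) auto
  then show "cmod (H p j * (z ^ (p - j) * cnj z ^ (q - j))) \<le> cmod (H p j) * r ^ (p - j)"
    by (simp add: norm_mult norm_power mult_left_mono)
qed

text \<open>Each holomorphic coefficient is expanded in a power series, and monomials z^m cnj z^k
  are regrouped by m - k = p - q, that is, k = q - j and m = p - j. The second conclusion allows
  integration term by term on |z| \<le> r; the third records which powers of cnj z are absent when n
  \<le> q.\<close>

lemma polyanalytic_expansion:
  assumes f: "polyanalytic_rep n unit_disk f" and n: "n \<le> Suc q"
  obtains H where "\<And>z. z \<in> unit_disk \<Longrightarrow> (\<lambda>p. mode_part H q p z) sums f z"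
    and "\<And>r. 0 \<le> r \<Longrightarrow> r < 1 \<Longrightarrow> summable (\<lambda>p. \<Sum>j\<le>min p q. cmod (H p j) * r ^ (p - j))"
    and "\<And>p j. n \<le> q - j \<Longrightarrow> H p j = 0"
proof -
  obtain h where h: "\<And>k. k < n \<Longrightarrow> h k holomorphic_on unit_disk"
    and fz: "\<And>z. z \<in> unit_disk \<Longrightarrow> f z = (\<Sum>k<n. cnj z ^ k * h k z)"
    using f unfolding polyanalytic_rep_def by blast
  \<comment> \<open>Coefficients of missing powers of cnj z are set to 0, so that q may exceed n -
    1.\<close>
  define a where "a k m = (if k < n then (deriv ^^ m) (h k) 0 / fact m else 0)" for k m
  define g where "g k z = (if k < n then h k z else 0)" for k z
  have a: "(\<lambda>m. a k m * z ^ m) sums g k z" if z: "z \<in> unit_disk" for k z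
    using holomorphic_power_series[OF h z] by (auto simp: a_def g_def)
  have summ: "summable (\<lambda>m. cmod (a k m) * r ^ m)" if r: "0 \<le> r" "r < 1" for k r
  proof -
    \<comment> \<open>Convergence at a radius strictly between r and 1 gives absolute convergence at
      r.\<close>
    define \<rho> where "\<rho> = (1 + r) / 2"
    have \<rho>: "r < \<rho>" "\<rho> < 1" using r by (auto simp: \<rho>_def)
    then have "(of_real \<rho> :: complex) \<in> unit_disk" using r by simp
    then have "summable (\<lambda>m. a k m * of_real \<rho> ^ m)" using a sums_summable by blast
    then have "summable (\<lambda>m. norm (a k m * of_real r ^ m))"
      by (rule powser_insidea) (use r \<rho> in simp)
    then show ?thesis using r by (simp add: norm_mult norm_power)
  qed
  define H where "H p j = a (q - j) (p - j)" for p j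
  \<comment> \<open>A range independent of p is needed before the finite sum over j is exchanged
    with the series over p.\<close>
  have split: "(\<Sum>j\<le>min p q. T j) = (\<Sum>j\<le>q. if j \<le> p then T j else 0)" for p and T :: "nat \<Rightarrow> 'b::comm_monoid_add"
    by (subst sum.inter_filter[symmetric]) (auto intro!: sum.cong)
  show thesis
  proof (rule that[of H])
    fix z assume z: "z \<in> unit_disk"
    let ?t = "\<lambda>j p. if j \<le> p then H p j * (z ^ (p - j) * cnj z ^ (q - j)) else 0"
    let ?s = "\<lambda>j. cnj z ^ (q - j) * g (q - j) z"
    have "(\<lambda>p. \<Sum>j\<le>q. ?t j p) sums (\<Sum>j\<le>q. ?s j)"
    proof (rule sums_sum)
      fix j assume "j \<in> {..q}"
      have "(\<lambda>m. cnj z ^ (q - j) * (a (q - j) m * z ^ m)) sums ?s j"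
        by (rule sums_mult[OF a[OF z]])
      then have "(\<lambda>i. if j \<le> i + j then H (i + j) j * (z ^ (i + j - j) * cnj z ^ (q - j)) else 0) sums ?s j"
        by (simp add: H_def mult_ac)
      then show "?t j sums ?s j"
        using sums_iff_shift[of "?t j" j "?s j"]
        by simp
    qed
    also have "(\<Sum>j\<le>q. cnj z ^ (q - j) * g (q - j) z) = (\<Sum>k\<le>q. cnj z ^ k * g k z)"
      by (rule sum.reindex_bij_witness[where i = "\<lambda>i. q - i" and j = "\<lambda>i. q - i"]) auto
    also have "\<dots> = (\<Sum>k<n. cnj z ^ k * g k z)"
      using n by (intro sum.mono_neutral_right) (auto simp: g_def)
    also have "\<dots> = f z" by (simp add: fz[OF z] g_def)
    finally show "(\<lambda>p. mode_part H q p z) sums f z"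
      unfolding mode_part_def split .
  next
    fix r :: real assume r: "0 \<le> r" "r < 1"
    have "summable (\<lambda>p. \<Sum>j\<le>q. if j \<le> p then cmod (H p j) * r ^ (p - j) else 0)"
    proof (rule summable_sum)
      fix j
      have "summable (\<lambda>i. (\<lambda>p. if j \<le> p then cmod (H p j) * r ^ (p - j) else 0) (i + j))"
        using summ[OF r, of "q - j"] by (simp add: H_def)
      then show "summable (\<lambda>p. if j \<le> p then cmod (H p j) * r ^ (p - j) else 0)"
        using summable_iff_shift[of "\<lambda>p. if j \<le> p then cmod (H p j) * r ^ (p - j) else 0" j] by simp
    qed
    then show "summable (\<lambda>p. \<Sum>j\<le>min p q. cmod (H p j) * r ^ (p - j))"
      unfolding split .
  next
    show "H p j = 0" if "n \<le> q - j" for p j using that by (simp add: H_def a_def)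
  qed
qed

lemma L2_mu_integrable:
  assumes \<alpha>: "\<alpha> > -1" and f: "f \<in> L2 (mu \<alpha>)"
  shows "integrable (mu \<alpha>) f"
proof -
  have fm: "f \<in> borel_measurable (mu \<alpha>)" and f2: "integrable (mu \<alpha>) (\<lambda>z. (cmod (f z))\<^sup>2)"
    using f by (auto simp: L2_def)
  have "integrable (mu \<alpha>) (\<lambda>z. 1 + (cmod (f z))\<^sup>2)"
    by (intro Bochner_Integration.integrable_add f2 finite_measure.integrable_const finite_measure_mu \<alpha>)
  then show ?thesis
  proof (rule Bochner_Integration.integrable_bound[OF _ fm])
    have "cmod (f z) \<le> 1 + (cmod (f z))\<^sup>2" for z
    proof (cases "cmod (f z) \<le> 1")
      case False
      then have "cmod (f z) * 1 \<le> cmod (f z) * cmod (f z)" by (intro mult_left_mono) auto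
      then show ?thesis by (simp add: power2_eq_square)
    qed (simp add: add_increasing2)
    then show "AE z in mu \<alpha>. norm (f z) \<le> norm (1 + (cmod (f z))\<^sup>2)"
      by (auto intro!: AE_I2 order_trans[OF _ abs_ge_self])
  qed
qed

text \<open>Testing against \<open>G\<close> isolates one mode. On |z| \<le> r the series may be
  integrated termwise and the other modes vanish by rotation; then r tends to 1, with C |f| as an
  integrable majorant because \<open>f\<close> is square-integrable on a finite measure
  space.\<close>

lemma inner_mode_part:
  assumes \<alpha>: "\<alpha> > -1" and f: "f \<in> L2 (mu \<alpha>)"
    and H1: "\<And>z. z \<in> unit_disk \<Longrightarrow> (\<lambda>p. mode_part H q p z) sums f z"
    and H2: "\<And>r. 0 \<le> r \<Longrightarrow> r < 1 \<Longrightarrow> summable (\<lambda>p. \<Sum>j\<le>min p q. cmod (H p j) * r ^ (p - j))"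
    and G: "angular_mode p0 q G" and Gm: "G \<in> borel_measurable (mu \<alpha>)"
    and Gb: "\<And>z. z \<in> unit_disk \<Longrightarrow> cmod (G z) \<le> C"
  shows "(LINT z|mu \<alpha>. f z * cnj (G z)) = (LINT z|mu \<alpha>. mode_part H q p0 z * cnj (G z))"
proof -
  interpret finite_measure "mu \<alpha>" by (rule finite_measure_mu[OF \<alpha>])
  have C0: "C \<ge> 0" using Gb[of 0] norm_ge_zero[of "G 0"] by (simp del: norm_ge_zero)
  have fm[measurable]: "f \<in> borel_measurable (mu \<alpha>)" using f by (simp add: L2_def)
  note Gm[measurable]
  have mm[measurable]: "mode_part H q p \<in> borel_measurable (mu \<alpha>)" for p
    by (rule continuous_on_disk_measurable[OF continuous_mode_part])
  \<comment> \<open>The cut-off is complex-valued and radial, so that it can serve as the factor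
    \<open>R\<close> of \<open>angular_mode_orthogonal\<close>.\<close>
  define R where "R r z = (if cmod z \<le> r then 1 else 0 :: complex)" for r :: real and z
  have Rm[measurable]: "R r \<in> borel_measurable (mu \<alpha>)" for r
  proof -
    have "R r = indicator (cball 0 r)" by (auto simp: R_def indicator_def fun_eq_iff)
    moreover have "{z \<in> unit_disk. z \<in> cball 0 r} \<in> sets (lebesgue_on unit_disk)"
      by (auto simp: sets_restrict_space_iff Collect_conj_eq)
    ultimately show ?thesis by (auto simp: sets_mu intro!: borel_measurable_indicator')
  qed
  have fin: "(LINT z|mu \<alpha>. R r z * f z * cnj (G z)) = (LINT z|mu \<alpha>. R r z * mode_part H q p0 z * cnj (G z))"
    if r: "0 \<le> r" "r < 1" for r
  proof -
    define b where "b p = (\<Sum>j\<le>min p q. cmod (H p j) * r ^ (p - j))" for p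
    have b: "summable b" unfolding b_def by (rule H2[OF r])
    let ?T = "\<lambda>p z. R r z * mode_part H q p z * cnj (G z)"
    have b0: "0 \<le> b p" for p unfolding b_def using r by (intro sum_nonneg) auto
    have Tb: "cmod (?T p z) \<le> b p * C" if "z \<in> unit_disk" for p z
    proof (cases "cmod z \<le> r")
      case True
      then show ?thesis using norm_mode_part_le[OF True, of H q p] Gb[OF that] r C0
        by (auto simp: R_def norm_mult b_def intro!: mult_mono sum_nonneg)
    next
      case False
      then show ?thesis using b0 C0 by (simp add: R_def)
    qed
    have Ti: "integrable (mu \<alpha>) (?T p)" for p
    proof (rule integrable_const_bound[where B = "b p * C"])
      show "?T p \<in> borel_measurable (mu \<alpha>)" by measurable
    qed (use Tb in \<open>auto intro!: AE_I2\<close>)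
    have bC: "summable (\<lambda>p. b p * C)" by (rule summable_mult2[OF b])
    have "(\<lambda>p. LINT z|mu \<alpha>. ?T p z) sums (LINT z|mu \<alpha>. (\<Sum>p. ?T p z))"
    proof (rule sums_integral[OF Ti])
      show "AE z in mu \<alpha>. summable (\<lambda>p. norm (?T p z))"
        by (intro AE_I2 summable_comparison_test'[OF bC, of 0]) (use Tb in auto)
      have "(LINT z|mu \<alpha>. norm (?T p z)) \<le> measure (mu \<alpha>) unit_disk * (b p * C)" for p
        using integral_mono[OF integrable_norm[OF Ti[of p]], of "\<lambda>_. b p * C"] Tb by simp
      then show "summable (\<lambda>p. LINT z|mu \<alpha>. norm (?T p z))"
        by (intro summable_comparison_test'[OF summable_mult[OF bC], of 0]) (auto simp: integral_nonneg_AE)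
    qed
    moreover have "(LINT z|mu \<alpha>. ?T p z) = 0" if "p \<noteq> p0" for p
    proof (rule angular_mode_orthogonal[OF angular_mode_part G that])
      show "R r (\<tau> * z) = R r z" if "cmod \<tau> = 1" for \<tau> z
        using that by (simp add: R_def norm_mult)
    qed measurable
    then have "(\<lambda>p. LINT z|mu \<alpha>. ?T p z) sums (LINT z|mu \<alpha>. ?T p0 z)"
      using sums_If_finite_set[of "{p0}" "\<lambda>p. LINT z|mu \<alpha>. ?T p z"]
      by (auto elim!: sums_cong[THEN iffD1, rotated])
    ultimately have "(LINT z|mu \<alpha>. (\<Sum>p. ?T p z)) = (LINT z|mu \<alpha>. ?T p0 z)" by (rule sums_unique2)
    moreover have "(LINT z|mu \<alpha>. (\<Sum>p. ?T p z)) = (LINT z|mu \<alpha>. R r z * f z * cnj (G z))"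
    proof (rule Bochner_Integration.integral_cong[OF refl])
      fix z assume "z \<in> space (mu \<alpha>)"
      then have "(\<lambda>p. ?T p z) sums (R r z * f z * cnj (G z))"
        by (intro sums_mult2 sums_mult H1) auto
      then show "(\<Sum>p. ?T p z) = R r z * f z * cnj (G z)" by (rule sums_unique[symmetric])
    qed
    ultimately show ?thesis by simp
  qed
  define r where "r k = 1 - inverse (real (Suc k))" for k
  have r: "0 \<le> r k" "r k < 1" for k by (auto simp: r_def field_simps)
  have rlim: "r \<longlonglongrightarrow> 1"
    unfolding r_def using LIMSEQ_inverse_real_of_nat_add_minus[of 1] by simp
  have lim: "(\<lambda>k. LINT z|mu \<alpha>. R (r k) z * F z * cnj (G z)) \<longlonglongrightarrow> (LINT z|mu \<alpha>. F z * cnj (G z))"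
    if Fi: "integrable (mu \<alpha>) F" for F
  proof (rule integral_dominated_convergence[where w = "\<lambda>z. C * norm (F z)"])
    have [measurable]: "F \<in> borel_measurable (mu \<alpha>)" using Fi by auto
    show "(\<lambda>z. F z * cnj (G z)) \<in> borel_measurable (mu \<alpha>)"
      "\<And>k. (\<lambda>z. R (r k) z * F z * cnj (G z)) \<in> borel_measurable (mu \<alpha>)" by measurable
    show "integrable (mu \<alpha>) (\<lambda>z. C * norm (F z))" using Fi by simp
    show "AE z in mu \<alpha>. (\<lambda>k. R (r k) z * F z * cnj (G z)) \<longlonglongrightarrow> F z * cnj (G z)"
    proof (rule AE_I2)
      fix z assume "z \<in> space (mu \<alpha>)"
      then have "cmod z < 1" by simp
      then have "eventually (\<lambda>k. cmod z < r k) sequentially" by (rule order_tendstoD(1)[OF rlim])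
      then have "eventually (\<lambda>k. R (r k) z * F z * cnj (G z) = F z * cnj (G z)) sequentially"
        by eventually_elim (simp add: R_def)
      then show "(\<lambda>k. R (r k) z * F z * cnj (G z)) \<longlonglongrightarrow> F z * cnj (G z)" by (rule tendsto_eventually)
    qed
    show "AE z in mu \<alpha>. norm (R (r k) z * F z * cnj (G z)) \<le> C * norm (F z)" for k
    proof (rule AE_I2)
      fix z assume "z \<in> space (mu \<alpha>)"
      then have "norm (F z) * norm (G z) \<le> norm (F z) * C" using Gb by (intro mult_left_mono) auto
      then show "norm (R (r k) z * F z * cnj (G z)) \<le> C * norm (F z)"
        using C0 by (auto simp: R_def norm_mult mult.commute)
    qed
  qed
  have mi: "integrable (mu \<alpha>) (mode_part H q p0)"
  proof (rule integrable_const_bound[where B = "\<Sum>j\<le>min p0 q. cmod (H p0 j) * 1 ^ (p0 - j)"])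
    show "AE z in mu \<alpha>. norm (mode_part H q p0 z) \<le> (\<Sum>j\<le>min p0 q. cmod (H p0 j) * 1 ^ (p0 - j))"
      by (intro AE_I2 norm_mode_part_le) auto
  qed simp
  show ?thesis
    using LIMSEQ_unique[OF lim[OF L2_mu_integrable[OF \<alpha> f]], of "LINT z|mu \<alpha>. mode_part H q p0 z * cnj (G z)"]
      lim[OF mi] fin[OF r] by simp
qed

section \<open>Membership in the poly-Bergman spaces and expansion in disk polynomials\<close>

lemma polyanalytic_rep_monomial:
  assumes "k < n" "g holomorphic_on S"
  shows "polyanalytic_rep n S (\<lambda>z. cnj z ^ k * g z)"
  unfolding polyanalytic_rep_def
proof (intro exI[of _ "\<lambda>i z. if i = k then g z else 0"] conjI allI impI ballI)
  show "(\<lambda>z. if i = k then g z else 0) holomorphic_on S" for i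
    using assms by (cases "i = k") auto
  show "cnj z ^ k * g z = (\<Sum>i<n. cnj z ^ i * (if i = k then g z else 0))" for z
    using assms(1) by (simp add: if_distrib[of "\<lambda>x. _ * x"] sum.delta cong: if_cong)
qed

lemma polyanalytic_rep_sum:
  assumes "finite I" "\<And>i. i \<in> I \<Longrightarrow> polyanalytic_rep n S (f i)"
  shows "polyanalytic_rep n S (\<lambda>z. \<Sum>i\<in>I. f i z)"
proof -
  have "\<forall>i\<in>I. \<exists>h. (\<forall>k<n. h k holomorphic_on S) \<and> (\<forall>z\<in>S. f i z = (\<Sum>k<n. cnj z ^ k * h k z))"
    using assms(2) unfolding polyanalytic_rep_def by blast
  from bchoice[OF this] obtain h where h: "\<And>i k. i \<in> I \<Longrightarrow> k < n \<Longrightarrow> h i k holomorphic_on S"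
    and f: "\<And>i z. i \<in> I \<Longrightarrow> z \<in> S \<Longrightarrow> f i z = (\<Sum>k<n. cnj z ^ k * h i k z)" by blast
  have "(\<lambda>z. \<Sum>i\<in>I. h i k z) holomorphic_on S" if "k < n" for k
    using h that by (intro holomorphic_on_sum) auto
  moreover have "(\<Sum>i\<in>I. f i z) = (\<Sum>k<n. cnj z ^ k * (\<Sum>i\<in>I. h i k z))" if "z \<in> S" for z
  proof -
    have "(\<Sum>i\<in>I. f i z) = (\<Sum>i\<in>I. \<Sum>k<n. cnj z ^ k * h i k z)" using f that by simp
    also have "\<dots> = (\<Sum>k<n. \<Sum>i\<in>I. cnj z ^ k * h i k z)" by (rule sum.swap)
    finally show ?thesis by (simp add: sum_distrib_left)
  qed
  ultimately show ?thesis unfolding polyanalytic_rep_def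
    by (intro exI[of _ "\<lambda>k z. \<Sum>i\<in>I. h i k z"]) auto
qed

lemma polyanalytic_rep_cong:
  "polyanalytic_rep n S f \<Longrightarrow> (\<And>z. z \<in> S \<Longrightarrow> g z = f z) \<Longrightarrow> polyanalytic_rep n S g"
  unfolding polyanalytic_rep_def by auto

lemma polyanalytic_rep_continuous:
  assumes "open S" "polyanalytic_rep n S f"
  shows "continuous_on S f"
  using polyanalytic_rep_frechet(1)[OF assms]
  by (auto intro!: continuous_at_imp_continuous_on differentiable_imp_continuous_within)

lemma poly_bergman_iff:
  "f \<in> poly_bergman n \<alpha> \<longleftrightarrow> f \<in> L2 (mu \<alpha>) \<and> polyanalytic_rep n unit_disk f \<and> (\<forall>z. z \<notin> unit_disk \<longrightarrow> f z = 0)"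
  using n_analytic_imp_polyanalytic_rep[OF open_ball] polyanalytic_rep_n_analytic[OF open_ball]
  by (auto simp: poly_bergman_def)

lemma bounded_L2_mu:
  assumes \<alpha>: "\<alpha> > -1" and f: "f \<in> borel_measurable (mu \<alpha>)" and b: "\<And>z. z \<in> unit_disk \<Longrightarrow> cmod (f z) \<le> C"
  shows "f \<in> L2 (mu \<alpha>)"
proof -
  have "integrable (mu \<alpha>) (\<lambda>z. (cmod (f z))\<^sup>2)"
    by (rule integrable_mu_bounded[OF \<alpha>, of _ "C\<^sup>2"])
       (use f in measurable, use b in \<open>auto intro!: AE_I2 power_mono\<close>)
  then show ?thesis using f by (simp add: L2_def)
qed

lemma polyanalytic_bounded_poly_bergman:
  assumes \<alpha>: "\<alpha> > -1" and f: "polyanalytic_rep n unit_disk f" and b: "\<And>z. z \<in> unit_disk \<Longrightarrow> cmod (f z) \<le> C"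
    and off: "\<And>z. z \<notin> unit_disk \<Longrightarrow> f z = 0"
  shows "f \<in> poly_bergman n \<alpha>"
  unfolding poly_bergman_iff
  using bounded_L2_mu[OF \<alpha> continuous_on_disk_measurable[OF polyanalytic_rep_continuous[OF open_ball f]] b] f off
  by auto

lemma monomial_poly_bergman:
  assumes \<alpha>: "\<alpha> > -1" and "l < n"
  shows "(\<lambda>z. if z \<in> unit_disk then z ^ k * cnj z ^ l else 0) \<in> poly_bergman n \<alpha>"
proof (rule polyanalytic_bounded_poly_bergman[OF \<alpha>])
  have "polyanalytic_rep n unit_disk (\<lambda>z. cnj z ^ l * z ^ k)"
    using assms(2) by (intro polyanalytic_rep_monomial holomorphic_intros)
  then show "polyanalytic_rep n unit_disk (\<lambda>z. if z \<in> unit_disk then z ^ k * cnj z ^ l else 0)"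
    by (rule polyanalytic_rep_cong) (simp add: mult.commute)
  show "cmod (if z \<in> unit_disk then z ^ k * cnj z ^ l else 0) \<le> 1" if "z \<in> unit_disk" for z
    using norm_monomial_le_1[OF that] that by simp
qed auto

lemma disk_poly_poly_bergman:
  assumes \<alpha>: "\<alpha> > -1"
  shows "disk_poly \<alpha> p q \<in> poly_bergman (Suc q) \<alpha>"
proof (rule polyanalytic_bounded_poly_bergman[OF \<alpha>])
  have "polyanalytic_rep (Suc q) unit_disk (\<lambda>z. \<Sum>j\<le>min p q. cnj z ^ (q - j) * (of_real (disk_poly_monomial_coeff \<alpha> p q j) * z ^ (p - j)))"
    by (intro polyanalytic_rep_sum polyanalytic_rep_monomial holomorphic_intros) auto
  then show "polyanalytic_rep (Suc q) unit_disk (disk_poly \<alpha> p q)"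
    by (rule polyanalytic_rep_cong) (simp add: disk_poly_monomials[OF \<alpha>] mult_ac)
  show "cmod (disk_poly \<alpha> p q z) \<le> (\<Sum>j\<le>min p q. \<bar>disk_poly_monomial_coeff \<alpha> p q j\<bar>)" for z
    by (rule disk_poly_bounded[OF \<alpha>])
qed (simp add: disk_poly_def)

text \<open>The weight is positive on the disk, so the open set where \<open>r\<close> is nonzero is
  Lebesgue null, hence empty.\<close>

lemma AE_mu_imp_zero:
  assumes \<alpha>: "\<alpha> > -1" and r: "continuous_on unit_disk r" and ae: "AE z in mu \<alpha>. r z = (0::complex)" and z: "z \<in> unit_disk"
  shows "r z = 0"
proof -
  have w: "(\<lambda>z. ennreal ((\<alpha> + 1) / pi * (1 - (cmod z)\<^sup>2) powr \<alpha>)) \<in> borel_measurable (lebesgue_on unit_disk)"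
    by (rule measurable_restrict_space1[OF measurable_disk_weight])
  have "AE z in lebesgue_on unit_disk. r z = 0"
    using ae unfolding mu_def AE_density[OF w]
  proof (rule AE_mp, intro AE_I2 impI)
    fix z assume z: "z \<in> space (lebesgue_on unit_disk)"
      and *: "0 < ennreal ((\<alpha> + 1) / pi * (1 - (cmod z)\<^sup>2) powr \<alpha>) \<longrightarrow> r z = 0"
    have "1 - (cmod z)\<^sup>2 > 0" using z by (simp add: power_less_one_iff abs_square_less_1)
    then show "r z = 0" using * \<alpha> by simp
  qed
  then have "AE z in lebesgue. z \<in> unit_disk \<longrightarrow> r z = 0"
    by (subst (asm) AE_restrict_space_iff) auto
  then have "AE z in lebesgue. z \<notin> {z \<in> unit_disk. r z \<noteq> 0}" by (auto elim: eventually_mono)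
  moreover have op: "open {z \<in> unit_disk. r z \<noteq> 0}"
  proof -
    have "open (unit_disk \<inter> r -` (- {0}))"
      by (rule continuous_open_preimage[OF r open_ball]) (simp add: open_Compl)
    also have "unit_disk \<inter> r -` (- {0}) = {z \<in> unit_disk. r z \<noteq> 0}" by auto
    finally show ?thesis .
  qed
  ultimately have "{z \<in> unit_disk. r z \<noteq> 0} \<in> null_sets lebesgue"
    by (subst AE_iff_null_sets) auto
  then have "negligible {z \<in> unit_disk. r z \<noteq> 0}" by (simp add: negligible_iff_null_sets)
  then have "{z \<in> unit_disk. r z \<noteq> 0} = {}" using open_not_negligible[OF op] by blast
  then show ?thesis using z by blast
qed

text \<open>Only the p-th mode of a q-analytic \<open>g\<close> matters. It has no term z^p cnj z^q,
  and its remaining monomials are those handled by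
  \<open>disk_poly_monomial_orthogonal\<close>.\<close>

lemma disk_poly_true_poly_bergman:
  assumes \<alpha>: "\<alpha> > -1"
  shows "disk_poly \<alpha> p q \<in> true_poly_bergman (Suc q) \<alpha>"
  unfolding true_poly_bergman_def
proof (intro CollectI conjI ballI disk_poly_poly_bergman[OF \<alpha>])
  fix g assume "g \<in> poly_bergman (Suc q - 1) \<alpha>"
  then have g2: "g \<in> L2 (mu \<alpha>)" and g: "polyanalytic_rep q unit_disk g" by (auto simp: poly_bergman_iff)
  obtain H where H: "\<And>z. z \<in> unit_disk \<Longrightarrow> (\<lambda>p. mode_part H q p z) sums g z"
    "\<And>r. 0 \<le> r \<Longrightarrow> r < 1 \<Longrightarrow> summable (\<lambda>p. \<Sum>j\<le>min p q. cmod (H p j) * r ^ (p - j))"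
    and H0: "\<And>p j. q \<le> q - j \<Longrightarrow> H p j = 0"
    by (rule polyanalytic_expansion[OF g, of q]) auto
  \<comment> \<open>The index j = 0 belongs to cnj z^q, which does not occur in a q-analytic
    function.\<close>
  have H00: "H p 0 = 0" by (rule H0) simp
  let ?e = "disk_poly \<alpha> p q" and ?mon = "\<lambda>j z. z ^ (p - j) * cnj z ^ (q - j)"
  let ?B = "\<Sum>j\<le>min p q. \<bar>disk_poly_monomial_coeff \<alpha> p q j\<bar>"
  have em: "?e \<in> borel_measurable (mu \<alpha>)" by (rule disk_poly_measurable[OF \<alpha>])
  have mm: "?mon j \<in> borel_measurable (mu \<alpha>)" for j
    by (intro continuous_on_disk_measurable continuous_intros)
  have int: "integrable (mu \<alpha>) (\<lambda>z. ?e z * cnj (?mon j z))" for j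
  proof (rule integrable_mu_bounded[OF \<alpha>])
    show "(\<lambda>z. ?e z * cnj (?mon j z)) \<in> borel_measurable (mu \<alpha>)"
      by (intro borel_measurable_times em borel_measurable_cnj mm)
    show "AE z in mu \<alpha>. cmod (?e z * cnj (?mon j z)) \<le> ?B * 1"
    proof (rule AE_I2)
      fix z assume "z \<in> space (mu \<alpha>)"
      then show "cmod (?e z * cnj (?mon j z)) \<le> ?B * 1"
        unfolding norm_mult[of "?e z"] complex_mod_cnj
        using disk_poly_bounded[OF \<alpha>, of p q z] norm_monomial_le_1[of z "p - j" "q - j"]
        by (intro mult_mono) (auto intro: sum_nonneg)
    qed
  qed
  have "cnj (l2_inner (mu \<alpha>) ?e g) = (LINT z|mu \<alpha>. g z * cnj (?e z))"
    unfolding l2_inner_def by (subst Bochner_Integration.integral_cnj[symmetric]) (simp add: mult.commute)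
  also have "\<dots> = (LINT z|mu \<alpha>. mode_part H q p z * cnj (?e z))"
    by (rule inner_mode_part[OF \<alpha> g2 H angular_mode_disk_poly[OF \<alpha>] em disk_poly_bounded[OF \<alpha>]])
  finally have "l2_inner (mu \<alpha>) ?e g = cnj (LINT z|mu \<alpha>. mode_part H q p z * cnj (?e z))"
    by (metis complex_cnj_cnj)
  also have "\<dots> = (LINT z|mu \<alpha>. ?e z * cnj (mode_part H q p z))"
    by (subst Bochner_Integration.integral_cnj[symmetric]) (simp add: mult.commute)
  also have "\<dots> = (LINT z|mu \<alpha>. (\<Sum>j\<le>min p q. cnj (H p j) * (?e z * cnj (?mon j z))))"
    by (simp add: mode_part_def sum_distrib_left mult_ac)
  also have "\<dots> = (\<Sum>j\<le>min p q. cnj (H p j) * (LINT z|mu \<alpha>. ?e z * cnj (?mon j z)))"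
    using int by (subst Bochner_Integration.integral_sum) (auto intro!: integrable_mult_right)
  also have "\<dots> = 0"
  proof (rule sum.neutral, rule ballI)
    fix j assume "j \<in> {..min p q}"
    then show "cnj (H p j) * (LINT z|mu \<alpha>. ?e z * cnj (?mon j z)) = 0"
      using disk_poly_monomial_orthogonal[OF \<alpha>, of j p q] H00 by (cases "j = 0") auto
  qed
  finally show "l2_inner (mu \<alpha>) ?e g = 0" .
qed

text \<open>Each mode of \<open>f\<close>, minus a multiple of the disk polynomial, is a combination
  of monomials with j \<ge> 1 and is orthogonal to all of these. It is therefore orthogonal to
  itself and vanishes.\<close>

lemma true_poly_bergman_expansion:
  assumes \<alpha>: "\<alpha> > -1" and f: "f \<in> true_poly_bergman (Suc q) \<alpha>" and z: "z \<in> unit_disk"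
  shows "(\<lambda>p. l2_inner (mu \<alpha>) f (disk_poly \<alpha> p q) * disk_poly \<alpha> p q z) sums f z"
proof -
  have f2: "f \<in> L2 (mu \<alpha>)" and fr: "polyanalytic_rep (Suc q) unit_disk f"
    and orth: "\<And>g. g \<in> poly_bergman q \<alpha> \<Longrightarrow> l2_inner (mu \<alpha>) f g = 0"
    using f by (auto simp: true_poly_bergman_def poly_bergman_iff)
  obtain H where H: "\<And>z. z \<in> unit_disk \<Longrightarrow> (\<lambda>p. mode_part H q p z) sums f z"
    "\<And>r. 0 \<le> r \<Longrightarrow> r < 1 \<Longrightarrow> summable (\<lambda>p. \<Sum>j\<le>min p q. cmod (H p j) * r ^ (p - j))"
    by (rule polyanalytic_expansion[OF fr, of q]) auto
  have "mode_part H q p z = l2_inner (mu \<alpha>) f (disk_poly \<alpha> p q) * disk_poly \<alpha> p q z" for p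
  proof -
    let ?m = "min p q" and ?e = "disk_poly \<alpha> p q" and ?mon = "\<lambda>j z. z ^ (p - j) * cnj z ^ (q - j)"
    define E where "E j = (of_real (disk_poly_monomial_coeff \<alpha> p q j) :: complex)" for j
    have E0: "E 0 \<noteq> 0" using disk_poly_leading_coeff[OF \<alpha>] by (simp add: E_def)
    \<comment> \<open>Chosen to cancel the top monomial z^p cnj z^q.\<close>
    define c where "c = H p 0 / E 0"
    define d where "d j = (if j = 0 then 0 else H p j - c * E j)" for j
    define r where "r z = (\<Sum>j\<le>?m. d j * ?mon j z)" for z
    have r: "r z = mode_part H q p z - c * ?e z" if "z \<in> unit_disk" for z
    proof -
      have "H p j = d j + c * E j" for j using E0 by (simp add: d_def c_def)
      then have "mode_part H q p z = (\<Sum>j\<le>?m. (d j + c * E j) * ?mon j z)" by (simp add: mode_part_def)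
      also have "\<dots> = r z + c * (\<Sum>j\<le>?m. E j * ?mon j z)"
        by (simp add: r_def distrib_right sum.distrib sum_distrib_left mult.assoc)
      finally show ?thesis by (simp add: disk_poly_monomials[OF \<alpha> that] E_def)
    qed
    have em[measurable]: "?e \<in> borel_measurable (mu \<alpha>)" by (rule disk_poly_measurable[OF \<alpha>])
    have mm[measurable]: "?mon j \<in> borel_measurable (mu \<alpha>)" for j
      by (intro continuous_on_disk_measurable continuous_intros)
    have pm[measurable]: "mode_part H q p \<in> borel_measurable (mu \<alpha>)"
      by (rule continuous_on_disk_measurable[OF continuous_mode_part])
    have rm[measurable]: "r \<in> borel_measurable (mu \<alpha>)"
      unfolding r_def by (intro continuous_on_disk_measurable continuous_intros)
    define B where "B = (\<Sum>j\<le>?m. \<bar>disk_poly_monomial_coeff \<alpha> p q j\<bar>)"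
    define B' where "B' = (\<Sum>j\<le>?m. cmod (H p j) * 1 ^ (p - j))"
    have eb: "cmod (?e z) \<le> B" for z unfolding B_def by (rule disk_poly_bounded[OF \<alpha>])
    have pb: "cmod (mode_part H q p z) \<le> B'" if "z \<in> unit_disk" for z
      unfolding B'_def by (rule norm_mode_part_le) (use that in auto)
    have i1: "integrable (mu \<alpha>) (\<lambda>z. F z * cnj (G z))" if "F \<in> borel_measurable (mu \<alpha>)" "G \<in> borel_measurable (mu \<alpha>)"
      "\<And>z. z \<in> unit_disk \<Longrightarrow> cmod (F z) \<le> C" "\<And>z. z \<in> unit_disk \<Longrightarrow> cmod (G z) \<le> C'" for F G C C'
    proof (rule integrable_mu_bounded[OF \<alpha>])
      show "(\<lambda>z. F z * cnj (G z)) \<in> borel_measurable (mu \<alpha>)" using that by measurable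
      show "AE z in mu \<alpha>. cmod (F z * cnj (G z)) \<le> C * C'"
        unfolding norm_mult complex_mod_cnj using that(3,4) order_trans[OF norm_ge_zero that(3)]
        by (intro AE_I2 mult_mono) auto
    qed
    have rmon: "(LINT z|mu \<alpha>. r z * cnj (?mon j z)) = 0" if j: "1 \<le> j" "j \<le> ?m" for j
    proof -
      have "(LINT z|mu \<alpha>. r z * cnj (?mon j z)) = (LINT z|mu \<alpha>. mode_part H q p z * cnj (?mon j z) - c * (?e z * cnj (?mon j z)))"
        by (intro Bochner_Integration.integral_cong) (auto simp: r algebra_simps)
      also have "\<dots> = (LINT z|mu \<alpha>. mode_part H q p z * cnj (?mon j z)) - c * (LINT z|mu \<alpha>. ?e z * cnj (?mon j z))"
        using i1[OF pm mm pb norm_monomial_le_1] i1[OF em mm eb norm_monomial_le_1]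
        by (subst Bochner_Integration.integral_diff) auto
      also have "(LINT z|mu \<alpha>. ?e z * cnj (?mon j z)) = 0" by (rule disk_poly_monomial_orthogonal[OF \<alpha> j])
      \<comment> \<open>Back from the mode to \<open>f\<close> itself, because the hypothesis on
        \<open>f\<close> concerns inner products of the whole function; for j \<ge> 1 the monomial
        is q-analytic.\<close>
      also have "(LINT z|mu \<alpha>. mode_part H q p z * cnj (?mon j z)) = (LINT z|mu \<alpha>. f z * cnj (?mon j z))"
        by (rule inner_mode_part[OF \<alpha> f2 H _ mm norm_monomial_le_1, symmetric]) (use j in \<open>auto intro: angular_mode_monomial\<close>)
      also have "\<dots> = l2_inner (mu \<alpha>) f (\<lambda>z. if z \<in> unit_disk then ?mon j z else 0)"
        unfolding l2_inner_def by (intro Bochner_Integration.integral_cong) auto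
      also have "\<dots> = 0" by (rule orth[OF monomial_poly_bergman[OF \<alpha>]]) (use j in auto)
      finally show ?thesis by simp
    qed
    have rb: "cmod (r z) \<le> B' + cmod c * B" if "z \<in> unit_disk" for z
      unfolding r[OF that] using pb[OF that] mult_left_mono[OF eb[of z], of "cmod c"]
      by (intro order_trans[OF norm_triangle_ineq4]) (auto simp: norm_mult)
    have irm: "integrable (mu \<alpha>) (\<lambda>z. r z * cnj (?mon j z))" for j
      by (rule i1[OF rm mm rb norm_monomial_le_1])
    have irr: "integrable (mu \<alpha>) (\<lambda>z. r z * cnj (r z))" by (rule i1[OF rm rm rb rb])
    have rr: "r z * cnj (r z) = of_real ((cmod (r z))\<^sup>2)" for z by (rule complex_norm_square[symmetric])
    \<comment> \<open>Only the second factor is expanded: its j = 0 term has coefficient 0, the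
      others are orthogonal to \<open>r\<close>.\<close>
    have "(LINT z|mu \<alpha>. r z * cnj (r z)) = (LINT z|mu \<alpha>. (\<Sum>j\<le>?m. cnj (d j) * (r z * cnj (?mon j z))))"
      by (subst (2) r_def) (simp add: sum_distrib_left mult_ac)
    also have "\<dots> = (\<Sum>j\<le>?m. cnj (d j) * (LINT z|mu \<alpha>. r z * cnj (?mon j z)))"
      using irm by (subst Bochner_Integration.integral_sum) (auto intro!: integrable_mult_right)
    also have "\<dots> = 0"
      using rmon by (intro sum.neutral) (auto simp: d_def)
    finally have "(LINT z|mu \<alpha>. (cmod (r z))\<^sup>2) = 0"
      unfolding rr integral_complex_of_real by (simp only: of_real_eq_0_iff)
    moreover have "integrable (mu \<alpha>) (\<lambda>z. (cmod (r z))\<^sup>2)"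
      using integrable_norm[OF irr] by (simp add: norm_mult power2_eq_square)
    ultimately have "AE z in mu \<alpha>. (cmod (r z))\<^sup>2 = 0"
      by (subst (asm) integral_nonneg_eq_0_iff_AE) auto
    then have "AE z in mu \<alpha>. r z = 0" by simp
    then have "r z = 0" if "z \<in> unit_disk" for z
      by (rule AE_mu_imp_zero[OF \<alpha> _ _ that, rotated]) (auto simp: r_def intro!: continuous_intros)
    then have eq: "mode_part H q p z = c * ?e z" if "z \<in> unit_disk" for z using r[OF that] that by simp
    have "l2_inner (mu \<alpha>) f ?e = (LINT z|mu \<alpha>. mode_part H q p z * cnj (?e z))"
      unfolding l2_inner_def
      by (rule inner_mode_part[OF \<alpha> f2 H angular_mode_disk_poly[OF \<alpha>] em eb])
    also have "\<dots> = (LINT z|mu \<alpha>. c * (?e z * cnj (?e z)))"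
      by (intro Bochner_Integration.integral_cong) (auto simp: eq)
    also have "\<dots> = c" using disk_poly_normalized[OF \<alpha>, of p q] by (simp add: l2_inner_def)
    finally show ?thesis using eq[OF z] by simp
  qed
  then show ?thesis using H(1)[OF z] by simp
qed

subsection \<open>Toeplitz operators with radial symbols\<close>

text \<open>The functional equation of Gamma makes the ratio of squares rational in p, with limit 1;
  this drives the ratio test below.\<close>

lemma disk_poly_scale_ratio:
  assumes \<alpha>: "\<alpha> > -1"
  shows "disk_poly_scale \<alpha> p q / disk_poly_scale \<alpha> (Suc p) q =
    sqrt ((\<alpha> + real p + real q + 1) / (\<alpha> + real p + real q + 2) * ((real p + 1) / (\<alpha> + real p + 1)))" (is "_ = sqrt ?R")
proof -
  have G: "Gamma (\<alpha> + real (Suc p) + 1) = (\<alpha> + real p + 1) * Gamma (\<alpha> + real p + 1)"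
  proof -
    have "\<alpha> + real p + 1 \<notin> \<int>\<^sub>\<le>\<^sub>0" using \<alpha> by (auto elim!: nonpos_Ints_cases)
    from Gamma_plus1[OF this] show ?thesis by (simp add: add_ac)
  qed
  have pos: "Gamma (\<alpha> + real p + 1) > 0" "Gamma (\<alpha> + real q + 1) > 0" using \<alpha> by (auto intro!: Gamma_real_pos)
  have s: "disk_poly_scale \<alpha> p q = sqrt ((disk_poly_scale \<alpha> p q)\<^sup>2)" for p
    using disk_poly_scale_pos[OF \<alpha>, of p q] by simp
  have "disk_poly_scale \<alpha> p q / disk_poly_scale \<alpha> (Suc p) q =
     sqrt ((disk_poly_scale \<alpha> p q)\<^sup>2 / (disk_poly_scale \<alpha> (Suc p) q)\<^sup>2)"
    by (subst (1 2) s) (simp add: real_sqrt_divide)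
  also have "(disk_poly_scale \<alpha> p q)\<^sup>2 / (disk_poly_scale \<alpha> (Suc p) q)\<^sup>2 = ?R"
  proof -
    have ne: "\<alpha> + real p + 1 \<noteq> 0" "\<alpha> + real p + real q + 2 \<noteq> 0" "\<alpha> + 1 \<noteq> 0" "real p + 1 \<noteq> 0" using \<alpha> by auto
    have e: "\<alpha> + real (Suc p) + real q + 1 = \<alpha> + real p + real q + 2" "(fact (Suc p) :: real) = (real p + 1) * fact p" by simp_all
    show ?thesis
      unfolding disk_poly_scale_squared[OF \<alpha>] G e using pos ne by (simp add: divide_simps)
  qed
  finally show ?thesis .
qed

text \<open>The index is shifted by p = m + j, so that z^(p-j) becomes z^m. The scale and the
  binomial both have consecutive ratios tending to 1, so the radius of convergence is 1, and bounded
  factors \<open>c\<close> preserve convergence inside.\<close>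

lemma disk_poly_coefficient_series_summable:
  assumes \<alpha>: "\<alpha> > -1" and c: "\<And>p. cmod (c p) \<le> B" and z: "cmod z < 1"
  shows "summable (\<lambda>m. (c (m + j) * of_real (disk_poly_scale \<alpha> (m + j) q * real ((m + j) choose j))) * z ^ m)"
proof -
  define b where "b m = disk_poly_scale \<alpha> (m + j) q * real ((m + j) choose j)" for m
  let ?R = "\<lambda>m. sqrt ((\<alpha> + real (m + j) + real q + 1) / (\<alpha> + real (m + j) + real q + 2) * ((real (m + j) + 1) / (\<alpha> + real (m + j) + 1))) *
     ((real m + 1) / (real m + real j + 1))"
  have b: "b m > 0" for m unfolding b_def using disk_poly_scale_pos[OF \<alpha>] by simp
  have "b m / b (Suc m) = ?R m" for m
  proof -
    have "(Suc m) * (Suc (m + j) choose j) = Suc (m + j) * ((m + j) choose j)"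
      using binomial_absorb_comp[of "Suc (m + j)" j] by simp
    then have "real (Suc m) * real (Suc (m + j) choose j) = real (Suc (m + j)) * real ((m + j) choose j)"
      by (metis of_nat_mult)
    moreover have "Suc (m + j) choose j > 0" by simp
    ultimately have "real ((m + j) choose j) / real (Suc (m + j) choose j) = (real m + 1) / (real m + real j + 1)"
      by (simp add: field_simps)
    moreover have "b m / b (Suc m) = disk_poly_scale \<alpha> (m + j) q / disk_poly_scale \<alpha> (Suc (m + j)) q *
        (real ((m + j) choose j) / real (Suc (m + j) choose j))" by (simp add: b_def)
    ultimately show ?thesis unfolding disk_poly_scale_ratio[OF \<alpha>] by metis
  qed
  moreover have "?R \<longlonglongrightarrow> 1"
    unfolding of_nat_add by real_asymp
  ultimately have "(\<lambda>m. b m / b (Suc m)) \<longlonglongrightarrow> 1" by presburger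
  then have "(\<lambda>m. norm (b m) / norm (b (Suc m))) \<longlonglongrightarrow> 1"
    using b by (simp add: abs_of_pos)
  then have "conv_radius b = 1" by (intro conv_radius_ratio_limit_nonzero[of _ 1]) simp_all
  then have "summable (\<lambda>m. norm (b m * cmod z ^ m))"
    using z by (intro abs_summable_in_conv_radius) simp
  from summable_mult[OF this, of B]
  show ?thesis
  proof (rule summable_comparison_test'[of _ 0])
    fix m
    have "cmod (c (m + j)) * (b m * cmod z ^ m) \<le> B * (b m * cmod z ^ m)"
      using b[of m] by (intro mult_right_mono c mult_nonneg_nonneg) auto
    then show "norm ((c (m + j) * of_real (disk_poly_scale \<alpha> (m + j) q * real ((m + j) choose j))) * z ^ m) \<le> B * norm (b m * cmod z ^ m)"
      unfolding b_def[symmetric] using b[of m] by (simp add: norm_mult norm_power mult.assoc)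
  qed
qed

text \<open>In \<open>disk_poly_explicit\<close> the dependence on p is confined to the power series
  \<open>G j\<close>. Summing over p first leaves finitely many of these holomorphic functions,
  multiplied by powers of 1 - |z|^2 and cnj z.\<close>

lemma disk_poly_series:
  assumes \<alpha>: "\<alpha> > -1" and c: "\<And>p. cmod (c p) \<le> B"
  obtains g where "polyanalytic_rep (Suc q) unit_disk g"
    and "\<And>z. z \<in> unit_disk \<Longrightarrow> (\<lambda>p. c p * disk_poly \<alpha> p q z) sums g z"
proof -
  define a where "a j m = c (m + j) * of_real (disk_poly_scale \<alpha> (m + j) q * real ((m + j) choose j))" for j m
  define G where "G j z = (\<Sum>m. a j m * z ^ m)" for j z
  define w where "w j = (of_real ((-1) ^ j * real (q choose j) * fact j / Gamma (\<alpha> + real j + 1)) :: complex)" for j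
  have G: "(\<lambda>m. a j m * z ^ m) sums G j z" if "z \<in> unit_disk" for j z
    unfolding G_def a_def
    by (intro summable_sums disk_poly_coefficient_series_summable[OF \<alpha> c]) (use that in simp)
  have Ghol: "G j holomorphic_on unit_disk" for j
    by (rule power_series_holomorphic[of _ _ "a j"]) (use G in simp)
  define g where "g z = (\<Sum>j\<le>q. w j * of_real (1 - (cmod z)\<^sup>2) ^ j * cnj z ^ (q - j) * G j z)" for z
  show thesis
  proof (rule that[of g])
    \<comment> \<open>Expanding (1 - z cnj z)^j keeps the exponent l + (q - j) of cnj z at most q,
      because l \<le> j.\<close>
    have 1: "polyanalytic_rep (Suc q) unit_disk (\<lambda>z. \<Sum>j\<le>q. \<Sum>l\<le>j. cnj z ^ (l + (q - j)) * (w j * of_nat (j choose l) * (- z) ^ l * G j z))"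
      by (intro polyanalytic_rep_sum polyanalytic_rep_monomial holomorphic_intros Ghol) auto
    have 2: "g z = (\<Sum>j\<le>q. \<Sum>l\<le>j. cnj z ^ (l + (q - j)) * (w j * of_nat (j choose l) * (- z) ^ l * G j z))" for z
      unfolding g_def
    proof (rule sum.cong[OF refl])
      fix j
      have "of_real (1 - (cmod z)\<^sup>2) = (- z * cnj z) + 1"
        unfolding of_real_diff complex_norm_square by simp
      then have "of_real (1 - (cmod z)\<^sup>2) ^ j = (\<Sum>l\<le>j. of_nat (j choose l) * (- z * cnj z) ^ l)"
        by (simp only: binomial_ring[of "- z * cnj z" 1 j]) simp
      then show "w j * of_real (1 - (cmod z)\<^sup>2) ^ j * cnj z ^ (q - j) * G j z =
        (\<Sum>l\<le>j. cnj z ^ (l + (q - j)) * (w j * of_nat (j choose l) * (- z) ^ l * G j z))"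
        by (simp only: sum_distrib_left sum_distrib_right power_mult_distrib power_add mult_ac)
    qed
    show "polyanalytic_rep (Suc q) unit_disk g" by (rule polyanalytic_rep_cong[OF 1 2])
  next
    fix z :: complex assume z: "z \<in> unit_disk"
    let ?f = "\<lambda>j p. c p * of_real (disk_poly_scale \<alpha> p q * real (p choose j)) * z ^ (p - j)"
    have "?f j sums G j z" for j
    proof -
      have "(\<lambda>m. ?f j (m + j)) sums G j z" using G[OF z, of j] by (simp add: a_def)
      then show ?thesis using sums_iff_shift[of "?f j" j "G j z"] by (simp add: binomial_eq_0)
    qed
    then have "(\<lambda>p. \<Sum>j\<le>q. w j * of_real (1 - (cmod z)\<^sup>2) ^ j * cnj z ^ (q - j) * ?f j p) sums g z"
      unfolding g_def by (intro sums_sum sums_mult)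
    moreover have "(\<Sum>j\<le>q. w j * of_real (1 - (cmod z)\<^sup>2) ^ j * cnj z ^ (q - j) * ?f j p) = c p * disk_poly \<alpha> p q z" for p
      unfolding disk_poly_explicit[OF \<alpha> z] sum_distrib_left
      by (intro sum.cong refl) (simp add: w_def mult_ac)
    ultimately show "(\<lambda>p. c p * disk_poly \<alpha> p q z) sums g z" by simp
  qed
qed

lemma square_summable_bounded:
  fixes c :: "nat \<Rightarrow> complex"
  assumes "summable (\<lambda>p. (cmod (c p))\<^sup>2)"
  shows "\<exists>B. \<forall>p. cmod (c p) \<le> B"
proof (intro exI allI)
  fix p
  have "(cmod (c p))\<^sup>2 \<le> (\<Sum>p. (cmod (c p))\<^sup>2)"
    using sum_le_suminf[OF assms, of "{p}"] by simp
  then show "cmod (c p) \<le> sqrt (\<Sum>p. (cmod (c p))\<^sup>2)" by (rule real_le_rsqrt)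
qed

lemma disk_poly_multiplier_orthogonal:
  assumes \<alpha>: "\<alpha> > -1" and a: "radial_ext a \<in> borel_measurable (mu \<alpha>)" and "p \<noteq> k"
  shows "l2_inner (mu \<alpha>) (\<lambda>z. radial_ext a z * disk_poly \<alpha> p q z) (disk_poly \<alpha> k q) = 0"
  unfolding l2_inner_def
proof (rule angular_mode_orthogonal[OF angular_mode_disk_poly[OF \<alpha>] angular_mode_disk_poly[OF \<alpha>] assms(3)])
  show "radial_ext a (\<tau> * z) = radial_ext a z" if "cmod \<tau> = 1" for \<tau> z
    using that by (simp add: radial_ext_def norm_mult)
  show "(\<lambda>z. radial_ext a z * disk_poly \<alpha> p q z * cnj (disk_poly \<alpha> k q z)) \<in> borel_measurable (mu \<alpha>)"
    by (intro borel_measurable_times borel_measurable_cnj a disk_poly_measurable[OF \<alpha>])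
qed

lemma disk_poly_orthonormal:
  assumes \<alpha>: "\<alpha> > -1"
  shows "l2_inner (mu \<alpha>) (disk_poly \<alpha> p q) (disk_poly \<alpha> k q) = (if p = k then 1 else 0)"
  using disk_poly_multiplier_orthogonal[OF \<alpha>, of "\<lambda>_. 1" p k q] disk_poly_normalized[OF \<alpha>, of p q]
  by (auto simp: radial_ext_def[abs_def])

text \<open>Square-summable sequences are bounded, so the pointwise series is available; Fatou's
  lemma then supplies square-integrability and norm convergence, which are what the orthogonality of
  the limit requires.\<close>

lemma disk_poly_l2_expansion_space:
  assumes \<alpha>: "\<alpha> > -1"
  shows "l2_expansion_space (mu \<alpha>) (\<lambda>p. disk_poly \<alpha> p q) (true_poly_bergman (Suc q) \<alpha>)"
proof -
  let ?V = "true_poly_bergman (Suc q) \<alpha>" and ?e = "\<lambda>p. disk_poly \<alpha> p q"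
  have eV: "?e p \<in> ?V" for p by (rule disk_poly_true_poly_bergman[OF \<alpha>])
  have VL2: "f \<in> L2 (mu \<alpha>)" "z \<notin> unit_disk \<Longrightarrow> f z = 0" if "f \<in> ?V" for f z
    using that by (auto simp: true_poly_bergman_def poly_bergman_iff)
  interpret l2_orthonormal "mu \<alpha>" ?e
    by unfold_locales (rule VL2[OF eV], rule disk_poly_orthonormal[OF \<alpha>])
  show ?thesis
  proof unfold_locales
    fix c :: "nat \<Rightarrow> complex" assume c: "summable (\<lambda>p. (cmod (c p))\<^sup>2)"
    obtain B where B: "\<And>p. cmod (c p) \<le> B" using square_summable_bounded[OF c] by blast
    obtain g where gr: "polyanalytic_rep (Suc q) unit_disk g"
      and g: "\<And>z. z \<in> unit_disk \<Longrightarrow> (\<lambda>p. c p * ?e p z) sums g z"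
      using disk_poly_series[OF \<alpha>, of c B q] B by metis
    show "summable (\<lambda>p. c p * ?e p z)" if "z \<in> space (mu \<alpha>)" for z
      using g[of z] that by (auto simp: sums_iff)
    let ?g = "\<lambda>z. \<Sum>p. c p * ?e p z"
    have gs: "(\<lambda>p. c p * ?e p z) sums ?g z" if "z \<in> space (mu \<alpha>)" for z
      using g[of z] that by (auto simp: sums_iff)
    have "polyanalytic_rep (Suc q) unit_disk ?g"
      by (rule polyanalytic_rep_cong[OF gr]) (use g in \<open>simp add: sums_iff\<close>)
    moreover have g2: "?g \<in> L2 (mu \<alpha>)" by (rule expansion_L2(1)[OF c gs])
    moreover have "?g z = 0" if "z \<notin> unit_disk" for z using that by (simp add: disk_poly_def)
    ultimately have "?g \<in> poly_bergman (Suc q) \<alpha>" by (simp add: poly_bergman_iff)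
    \<comment> \<open>The partial sums are orthogonal to \<open>h\<close>, and norm convergence
      passes this to the limit.\<close>
    moreover have "l2_inner (mu \<alpha>) ?g h = 0" if h: "h \<in> poly_bergman q \<alpha>" for h
    proof -
      have h2: "h \<in> L2 (mu \<alpha>)" using h by (simp add: poly_bergman_iff)
      have "l2_inner (mu \<alpha>) (?e p) h = 0" for p
        using eV[of p] h by (auto simp: true_poly_bergman_def)
      then have "l2_inner (mu \<alpha>) (\<lambda>z. \<Sum>p<N. c p * ?e p z) h = 0" for N
        by (simp add: inner_lin_comb[OF h2])
      moreover have "(\<lambda>N. l2_inner (mu \<alpha>) (\<lambda>z. \<Sum>p<N. c p * ?e p z) h) \<longlonglongrightarrow> l2_inner (mu \<alpha>) ?g h"
        by (rule l2_inner_tendsto[OF lin_comb_L2 g2 h2 expansion_norm_tendsto[OF c gs]])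
      ultimately show ?thesis by (simp add: LIMSEQ_const_iff)
    qed
    ultimately show "?g \<in> ?V" by (simp add: true_poly_bergman_def)
  next
    show "(\<lambda>p. l2_inner (mu \<alpha>) f (?e p) * ?e p z) sums f z" if "f \<in> ?V" "z \<in> space (mu \<alpha>)" for f z
      by (rule true_poly_bergman_expansion[OF \<alpha> that(1)]) (use that in simp)
  qed (use VL2 eV in auto)
qed

theorem proposition8p6:
  fixes n :: nat and \<alpha> :: real and a :: "real \<Rightarrow> complex"
  assumes "n \<ge> 1" and "\<alpha> > -1" and "a \<in> Linfty (lebesgue_on {0..<1})"
  shows "toeplitz n \<alpha> (radial_ext a) \<in> radial_operators n \<alpha> \<and>
    orthonormal_basis (mu \<alpha>) (true_poly_bergman n \<alpha>) (\<lambda>p. disk_poly \<alpha> p (n - 1)) \<and>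
    (\<forall>p. set_integrable lebesgue {0<..<1} (eigenvalue_integrand a \<alpha> n p)) \<and>
    diagonal_with_eigenvalues (toeplitz n \<alpha> (radial_ext a)) (\<lambda>p. disk_poly \<alpha> p (n - 1))
      (\<lambda>p. LINT t:{0<..<1}|lebesgue. eigenvalue_integrand a \<alpha> n p t)"
proof -
  obtain q where n: "n = Suc q" using assms(1) by (cases n) auto
  note \<alpha> = assms(2) and a = assms(3)
  let ?V = "true_poly_bergman n \<alpha>" and ?e = "\<lambda>p. disk_poly \<alpha> p q" and ?T = "toeplitz n \<alpha> (radial_ext a)"
  let ?l = "\<lambda>p. LINT t:{0<..<1}|lebesgue. eigenvalue_integrand a \<alpha> n p t"
  interpret l2_expansion_space "mu \<alpha>" ?e ?V
    unfolding n by (rule disk_poly_l2_expansion_space[OF \<alpha>])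
  have am: "radial_ext a \<in> borel_measurable (mu \<alpha>)" by (rule radial_ext_mu(1)[OF a])
  obtain C where C: "AE z in mu \<alpha>. cmod (radial_ext a z) \<le> C" using radial_ext_mu(2)[OF a] by blast
  \<comment> \<open>With q = n - 1 the Jacobi parameter |p - n + 1| is |p - q|.\<close>
  have ei: "eigenvalue_integrand a \<alpha> n p = (\<lambda>t. a (sqrt t) * of_real ((jacobi_fun (min p q) \<alpha> \<bar>real p - real q\<bar> t)\<^sup>2))" for p
    by (simp add: eigenvalue_integrand_def[abs_def] n)
  have diag: "l2_inner (mu \<alpha>) (\<lambda>z. radial_ext a z * ?e p z) (?e k) = (if p = k then ?l p else 0)" for p k
    using disk_poly_multiplier_orthogonal[OF \<alpha> am] disk_poly_eigenvalue(2)[OF \<alpha> a] by (auto simp: ei)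
  have T: "?T = restrict (\<lambda>f. orth_proj (mu \<alpha>) ?V (\<lambda>z. radial_ext a z * f z)) ?V" by (rule toeplitz_def)
  note mc = multiplier_compression[OF am C diag T]
  have "?T \<in> radial_operators n \<alpha>"
    unfolding radial_operators_def
  proof (intro CollectI conjI allI impI ballI)
    show "?T \<in> bounded_operators (mu \<alpha>) ?V" by (rule compression_bounded[OF am C diag T])
  next
    fix \<tau> f assume \<tau>: "cmod \<tau> = 1" and f: "f \<in> ?V"
    \<comment> \<open>\<open>rotate_fun\<close> composes with the inverse rotation, so the
      characters are taken at \<sigma>.\<close>
    define \<sigma> where "\<sigma> = inverse \<tau>"
    define u where "u p = \<sigma> ^ p * cnj \<sigma> ^ q" for p
    have \<sigma>: "cmod \<sigma> = 1" using \<tau> by (simp add: \<sigma>_def norm_inverse)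
    have u: "cmod (u p) = 1" for p using \<sigma> by (simp add: u_def norm_mult norm_power)
    have e: "?e p (\<sigma> * z) = u p * ?e p z" for p z
    proof (cases "z \<in> unit_disk")
      case True
      then show ?thesis using angular_mode_disk_poly[OF \<alpha>, of p q] \<sigma> by (simp add: angular_mode_def u_def)
    next
      case False
      then show ?thesis using \<sigma> by (simp add: disk_poly_def norm_mult)
    qed
    \<comment> \<open>In coefficients a rotation multiplies by the unimodular \<open>u p\<close>.
      Square-summability is preserved, so the rotated function stays in \<open>?V\<close>, and
      commutation with the Toeplitz operator reduces to commuting two scalars.\<close>
    have rot: "rotate_fun \<tau> (synth c) = synth (\<lambda>p. u p * c p)" for c
      unfolding rotate_fun_def synth_def[abs_def] \<sigma>_def[symmetric] e by (simp add: mult_ac)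
    have su: "square_summable (\<lambda>p. u p * c p)" if "square_summable c" for c
      using that u by (simp add: square_summable_def norm_mult)
    define c where "c p = l2_inner (mu \<alpha>) f (?e p)" for p
    have c: "square_summable c" unfolding c_def by (rule square_summable_inner[OF V_L2[OF f]])
    have fc: "f = synth c" unfolding c_def by (rule V_synth[OF f])
    have rf: "rotate_fun \<tau> f = synth (\<lambda>p. u p * c p)" unfolding fc by (rule rot)
    have "?T (rotate_fun \<tau> f) = synth (\<lambda>p. ?l p * (u p * c p))"
      unfolding rf mc[OF synth_V[OF su[OF c]]] inner_synth[OF su[OF c]] ..
    also have "\<dots> = synth (\<lambda>p. u p * (?l p * c p))" by (simp add: mult.left_commute)
    also have "\<dots> = rotate_fun \<tau> (?T f)" unfolding mc[OF f] rot c_def ..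
    finally show "?T (rotate_fun \<tau> f) = rotate_fun \<tau> (?T f)" .
  qed
  moreover have "orthonormal_basis (mu \<alpha>) ?V ?e" by (rule orthonormal_basis_V)
  moreover have "set_integrable lebesgue {0<..<1} (eigenvalue_integrand a \<alpha> n p)" for p
    unfolding ei by (rule disk_poly_eigenvalue(1)[OF \<alpha> a])
  moreover have "diagonal_with_eigenvalues ?T ?e ?l" by (rule compression_diagonal[OF am C diag T])
  ultimately show ?thesis by (simp add: n)
qed

end
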